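(* Let $A\to M$ be a transitive Lie algebroid with anchor $\rho\colon A\to TM$ and assume that $M$ is connected. Then the kernel $K=\ker(\rho\colon A\to TM)$ is a Lie algebra bundle.
   Context: All manifolds and vector bundles are smooth and real. A Lie algebroid is a vector bundle $A\to M$ with a vector bundle morphism $\rho\colon A\to TM$ over $\operatorname{id}_M$ (the anchor) and a real Lie algebra bracket $[\cdot,\cdot]$ on $\Gamma(A)$ with $[a,fb]=f[a,b]+\rho(a)(f)\,b$ for $a,b\in\Gamma(A)$, $f\in C^\infty(M)$. It is transitive if $\rho$ is (fibrewise) surjective. In that case $K=\ker\rho$ is a vector subbundle of $A$ and a Lie subalgebroid with trivial (zero) anchor; hence its bracket is $C^\infty(M)$-bilinear, i.e. defined pointwise, and each fibre $K_x$, $x\in M$, is a Lie algebra (the isotropy Lie algebra at $x$). A Lie algebroid with trivial anchor is called a bundle of Lie algebras; its fibres are Lie algebras which may depend on the base point. A Lie algebra bundle is a Lie algebroid with trivial anchor and isomorphic isotropy Lie algebras, i.e. all of its fibres are isomorphic to each other as Lie algebras. *)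

theory Defs
  imports "HOL-Analysis.Analysis" "HOL-Library.Function_Algebras"
begin

section \<open>Linear algebra\<close>

instantiation "fun" :: (type, real_vector) real_vector
begin

definition "c *\<^sub>R f = (\<lambda>x. c *\<^sub>R f x)"

instance
  by standard (simp_all add: fun_eq_iff scaleR_fun_def algebra_simps)

end

definition linear_on_set :: "'a::real_vector set \<Rightarrow> ('a \<Rightarrow> 'b::real_vector) \<Rightarrow> bool" where
  "linear_on_set V h \<longleftrightarrow>
     (\<forall>u\<in>V. \<forall>v\<in>V. h (u + v) = h u + h v) \<and> (\<forall>c. \<forall>v\<in>V. h (c *\<^sub>R v) = c *\<^sub>R h v)"

definition linear_iso :: "('a::real_vector \<Rightarrow> 'b::real_vector) \<Rightarrow> 'a set \<Rightarrow> 'b set \<Rightarrow> bool" where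
  "linear_iso h V W \<longleftrightarrow> linear_on_set V h \<and> bij_betw h V W"

text \<open>A real Lie algebra whose underlying vector space is the subspace \<open>V\<close> of an ambient
  vector space; the bracket is irrelevant outside \<open>V\<close>.\<close>

definition lie_algebra :: "'a::real_vector set \<Rightarrow> ('a \<Rightarrow> 'a \<Rightarrow> 'a) \<Rightarrow> bool" where
  "lie_algebra V br \<longleftrightarrow>
     subspace V \<and>
     (\<forall>u\<in>V. \<forall>v\<in>V. br u v \<in> V) \<and>
     (\<forall>u\<in>V. linear_on_set V (br u)) \<and>
     (\<forall>v\<in>V. linear_on_set V (\<lambda>u. br u v)) \<and>
     (\<forall>u\<in>V. br u u = 0) \<and>
     (\<forall>u\<in>V. \<forall>v\<in>V. \<forall>w\<in>V. br u (br v w) + br v (br w u) + br w (br u v) = 0)"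

definition lie_algebra_isomorphic ::
  "'a::real_vector set \<Rightarrow> ('a \<Rightarrow> 'a \<Rightarrow> 'a) \<Rightarrow> 'b::real_vector set \<Rightarrow> ('b \<Rightarrow> 'b \<Rightarrow> 'b) \<Rightarrow> bool" where
  "lie_algebra_isomorphic V br W br' \<longleftrightarrow>
     lie_algebra V br \<and> lie_algebra W br' \<and>
     (\<exists>T. linear_iso T V W \<and> (\<forall>u\<in>V. \<forall>v\<in>V. T (br u v) = br' (T u) (T v)))"

section \<open>Smooth functions on \<open>R\<^sup>n\<close>\<close>

text \<open>\<open>R\<^sup>n\<close> is \<open>Euclidean_space n\<close>, i.e. the sequences vanishing from index \<open>n\<close> on. This allows
  \<open>n = 0\<close>, which type-indexed Euclidean spaces do not.\<close>

abbreviation Rn :: "nat \<Rightarrow> (nat \<Rightarrow> real) set" where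
  "Rn n \<equiv> topspace (Euclidean_space n)"

definition unit_vec :: "nat \<Rightarrow> nat \<Rightarrow> real" where
  "unit_vec j = (\<lambda>i. if i = j then 1 else 0)"

definition partial :: "nat \<Rightarrow> ((nat \<Rightarrow> real) \<Rightarrow> real) \<Rightarrow> (nat \<Rightarrow> real) \<Rightarrow> real" where
  "partial i f = (\<lambda>x. deriv (\<lambda>t. f (x(i := t))) (x i))"

primrec Ck_on :: "nat \<Rightarrow> nat \<Rightarrow> (nat \<Rightarrow> real) set \<Rightarrow> ((nat \<Rightarrow> real) \<Rightarrow> real) \<Rightarrow> bool" where
  "Ck_on n 0 U f \<longleftrightarrow> continuous_on U f"
| "Ck_on n (Suc k) U f \<longleftrightarrow> continuous_on U f \<and>
     (\<forall>i<n. (\<forall>x\<in>U. (\<lambda>t. f (x(i := t))) field_differentiable at (x i)) \<and> Ck_on n k U (partial i f))"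

text \<open>Only meaningful for \<open>U\<close> open in \<open>R\<^sup>n\<close>.\<close>

definition smooth_on :: "nat \<Rightarrow> (nat \<Rightarrow> real) set \<Rightarrow> ((nat \<Rightarrow> real) \<Rightarrow> real) \<Rightarrow> bool" where
  "smooth_on n U f \<longleftrightarrow> (\<forall>k. Ck_on n k U f)"

section \<open>Smooth manifolds\<close>

text \<open>The underlying topological space of a manifold is a whole type. A chart is a pair \<open>(U, \<phi>)\<close>
  of an open set and a homeomorphism \<open>\<phi>\<close> from \<open>U\<close> onto an open subset of \<open>R\<^sup>n\<close>. The atlas is not
  required to be maximal.\<close>

record 'm manifold =
  mdim :: nat
  charts :: "('m set \<times> ('m \<Rightarrow> nat \<Rightarrow> real)) set"

definition smooth_fun :: "'m manifold \<Rightarrow> 'm set \<Rightarrow> ('m \<Rightarrow> real) \<Rightarrow> bool" where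
  "smooth_fun M W f \<longleftrightarrow>
     (\<forall>(U, \<phi>) \<in> charts M. smooth_on (mdim M) (\<phi> ` (U \<inter> W)) (f \<circ> inv_into U \<phi>))"

definition smooth_manifold :: "'m::{t2_space, second_countable_topology} manifold \<Rightarrow> bool" where
  "smooth_manifold M \<longleftrightarrow>
     (\<Union>(U, \<phi>) \<in> charts M. U) = UNIV \<and>
     (\<forall>(U, \<phi>) \<in> charts M.
        open U \<and> openin (Euclidean_space (mdim M)) (\<phi> ` U) \<and>
        homeomorphism U (\<phi> ` U) \<phi> (inv_into U \<phi>)) \<and>
     (\<forall>(U, \<phi>) \<in> charts M. \<forall>(V, \<psi>) \<in> charts M. \<forall>i<mdim M.
        smooth_on (mdim M) (\<phi> ` (U \<inter> V)) (\<lambda>y. \<psi> (inv_into U \<phi> y) i))"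

definition C_infinity :: "'m manifold \<Rightarrow> ('m \<Rightarrow> real) set" where
  "C_infinity M = {f. smooth_fun M UNIV f}"

section \<open>Vector bundles\<close>

text \<open>The fibres are subspaces of one ambient real vector space \<open>'v\<close>. The ambient space only
  provides the linear operations; it carries no topology and is no restriction, since any
  family of vector spaces embeds into a single one. Different fibres need not be disjoint: a point
  of the total space is a pair \<open>(x, v)\<close> with \<open>v \<in> fibre E x\<close>.

  The topology and the smooth structure of the total space come from the local trivialisations.
  A triple \<open>(U, r, \<Phi>)\<close> stands for the trivialisation \<open>U \<times> R\<^sup>r \<rightarrow> E|\<^sub>U\<close>, \<open>(x, v) \<mapsto> (x, \<Phi> x v)\<close>.\<close>

record ('m, 'v) vbundle =
  fibre :: "'m \<Rightarrow> 'v set"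
  trivs :: "('m set \<times> nat \<times> ('m \<Rightarrow> (nat \<Rightarrow> real) \<Rightarrow> 'v)) set"

text \<open>Smoothness on \<open>W\<close> of \<open>s\<close> with respect to a trivialisation \<open>\<Phi>\<close> of rank \<open>r\<close>: all components of
  \<open>(\<Phi> x)\<^sup>-\<^sup>1 (s x)\<close> are smooth in \<open>x\<close>.\<close>

definition smooth_coords ::
  "'m manifold \<Rightarrow> 'm set \<Rightarrow> nat \<Rightarrow> ('m \<Rightarrow> (nat \<Rightarrow> real) \<Rightarrow> 'v) \<Rightarrow> ('m \<Rightarrow> 'v) \<Rightarrow> bool" where
  "smooth_coords M W r \<Phi> s \<longleftrightarrow> (\<forall>i<r. smooth_fun M W (\<lambda>x. inv_into (Rn r) (\<Phi> x) (s x) i))"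

text \<open>The last clause says that the entries of the transition matrices are smooth.\<close>

definition vector_bundle :: "'m::topological_space manifold \<Rightarrow> ('m, 'v::real_vector) vbundle \<Rightarrow> bool" where
  "vector_bundle M E \<longleftrightarrow>
     (\<forall>x. subspace (fibre E x)) \<and>
     (\<Union>(U, r, \<Phi>) \<in> trivs E. U) = UNIV \<and>
     (\<forall>(U, r, \<Phi>) \<in> trivs E. open U \<and> (\<forall>x\<in>U. linear_iso (\<Phi> x) (Rn r) (fibre E x))) \<and>
     (\<forall>(U, r, \<Phi>) \<in> trivs E. \<forall>(V, s, \<Psi>) \<in> trivs E. \<forall>j<r.
        smooth_coords M (U \<inter> V) s \<Psi> (\<lambda>x. \<Phi> x (unit_vec j)))"

definition smooth_section ::
  "'m manifold \<Rightarrow> ('m, 'v) vbundle \<Rightarrow> 'm set \<Rightarrow> ('m \<Rightarrow> 'v) \<Rightarrow> bool" where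
  "smooth_section M E W s \<longleftrightarrow>
     (\<forall>x\<in>W. s x \<in> fibre E x) \<and> (\<forall>(V, r, \<Psi>) \<in> trivs E. smooth_coords M (W \<inter> V) r \<Psi> s)"

definition sections :: "'m manifold \<Rightarrow> ('m, 'v) vbundle \<Rightarrow> ('m \<Rightarrow> 'v) set" where
  "sections M E = {s. smooth_section M E UNIV s}"

text \<open>Morphisms over the identity; smoothness is smoothness of the matrix entries with respect to
  all local trivialisations.\<close>

definition bundle_morphism ::
  "'m manifold \<Rightarrow> ('m, 'v::real_vector) vbundle \<Rightarrow> ('m, 'w::real_vector) vbundle \<Rightarrow> ('m \<Rightarrow> 'v \<Rightarrow> 'w) \<Rightarrow> bool" where
  "bundle_morphism M E F h \<longleftrightarrow>
     (\<forall>x. linear_on_set (fibre E x) (h x) \<and> h x ` fibre E x \<subseteq> fibre F x) \<and>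
     (\<forall>(U, r, \<Phi>) \<in> trivs E. \<forall>(V, s, \<Psi>) \<in> trivs F. \<forall>j<r.
        smooth_coords M (U \<inter> V) s \<Psi> (\<lambda>x. h x (\<Phi> x (unit_vec j))))"

text \<open>The bundle structure induced on a family \<open>F\<close> of subspaces of the fibres of \<open>E\<close>: its
  trivialisations are all those given by local frames of \<open>F\<close> that are smooth as sections of \<open>E\<close>.
  This is a vector bundle exactly if \<open>F\<close> is a vector subbundle of \<open>E\<close>.\<close>

definition subbundle ::
  "'m::topological_space manifold \<Rightarrow> ('m, 'v::real_vector) vbundle \<Rightarrow> ('m \<Rightarrow> 'v set) \<Rightarrow> ('m, 'v) vbundle" where
  "subbundle M E F = \<lparr>
     fibre = F,
     trivs = {(U, r, \<Phi>). open U \<and> (\<forall>x\<in>U. linear_iso (\<Phi> x) (Rn r) (F x)) \<and>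
                (\<forall>j<r. smooth_section M E U (\<lambda>x. \<Phi> x (unit_vec j)))} \<rparr>"

section \<open>The tangent bundle\<close>

text \<open>Tangent vectors at \<open>p\<close> are the derivations of \<open>C\<^sup>\<infinity>(M)\<close> at \<open>p\<close>, extended by \<open>0\<close> to functions that
  are not smooth.\<close>

definition tangent_space :: "'m manifold \<Rightarrow> 'm \<Rightarrow> (('m \<Rightarrow> real) \<Rightarrow> real) set" where
  "tangent_space M p = {D.
     linear_on_set (C_infinity M) D \<and>
     (\<forall>f\<in>C_infinity M. \<forall>g\<in>C_infinity M. D (f * g) = f p * D g + g p * D f) \<and>
     (\<forall>f. f \<notin> C_infinity M \<longrightarrow> D f = 0)}"

definition coord_vector ::
  "'m manifold \<Rightarrow> 'm set \<Rightarrow> ('m \<Rightarrow> nat \<Rightarrow> real) \<Rightarrow> nat \<Rightarrow> 'm \<Rightarrow> ('m \<Rightarrow> real) \<Rightarrow> real" where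
  "coord_vector M U \<phi> i x =
     (\<lambda>f. if f \<in> C_infinity M then partial i (f \<circ> inv_into U \<phi>) (\<phi> x) else 0)"

definition tangent_bundle :: "'m manifold \<Rightarrow> ('m, ('m \<Rightarrow> real) \<Rightarrow> real) vbundle" where
  "tangent_bundle M = \<lparr>
     fibre = tangent_space M,
     trivs = {(U, mdim M, \<lambda>x v. \<Sum>i<mdim M. v i *\<^sub>R coord_vector M U \<phi> i x) | U \<phi>. (U, \<phi>) \<in> charts M} \<rparr>"

section \<open>Lie algebroids\<close>

text \<open>The vector field \<open>\<rho>(a)\<close> acts on functions by \<open>\<rho>(a)(f)(x) = \<rho> x (a x) f\<close>.\<close>

definition lie_algebroid ::
  "'m::topological_space manifold \<Rightarrow> ('m, 'v::real_vector) vbundle \<Rightarrow>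
   ('m \<Rightarrow> 'v \<Rightarrow> ('m \<Rightarrow> real) \<Rightarrow> real) \<Rightarrow> (('m \<Rightarrow> 'v) \<Rightarrow> ('m \<Rightarrow> 'v) \<Rightarrow> 'm \<Rightarrow> 'v) \<Rightarrow> bool" where
  "lie_algebroid M A \<rho> br \<longleftrightarrow>
     vector_bundle M A \<and>
     bundle_morphism M A (tangent_bundle M) \<rho> \<and>
     lie_algebra (sections M A) br \<and>
     (\<forall>a\<in>sections M A. \<forall>b\<in>sections M A. \<forall>f\<in>C_infinity M.
        br a (\<lambda>x. f x *\<^sub>R b x) = (\<lambda>x. f x *\<^sub>R br a b x + \<rho> x (a x) f *\<^sub>R b x))"

definition transitive_lie_algebroid ::
  "'m::topological_space manifold \<Rightarrow> ('m, 'v::real_vector) vbundle \<Rightarrow>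
   ('m \<Rightarrow> 'v \<Rightarrow> ('m \<Rightarrow> real) \<Rightarrow> real) \<Rightarrow> (('m \<Rightarrow> 'v) \<Rightarrow> ('m \<Rightarrow> 'v) \<Rightarrow> 'm \<Rightarrow> 'v) \<Rightarrow> bool" where
  "transitive_lie_algebroid M A \<rho> br \<longleftrightarrow>
     lie_algebroid M A \<rho> br \<and> (\<forall>x. \<rho> x ` fibre A x = tangent_space M x)"

definition anchor_kernel ::
  "'m::topological_space manifold \<Rightarrow> ('m, 'v::real_vector) vbundle \<Rightarrow>
   ('m \<Rightarrow> 'v \<Rightarrow> ('m \<Rightarrow> real) \<Rightarrow> real) \<Rightarrow> ('m, 'v) vbundle" where
  "anchor_kernel M A \<rho> = subbundle M A (\<lambda>x. {v \<in> fibre A x. \<rho> x v = 0})"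

text \<open>If the anchor is zero then \<open>br a b x\<close> depends only on \<open>a x\<close> and \<open>b x\<close>; this is the induced
  bracket on the fibre over \<open>x\<close>.\<close>

definition fibre_bracket ::
  "'m manifold \<Rightarrow> ('m, 'v) vbundle \<Rightarrow> (('m \<Rightarrow> 'v) \<Rightarrow> ('m \<Rightarrow> 'v) \<Rightarrow> 'm \<Rightarrow> 'v) \<Rightarrow> 'm \<Rightarrow> 'v \<Rightarrow> 'v \<Rightarrow> 'v" where
  "fibre_bracket M E br x u v =
     (THE w. \<exists>a\<in>sections M E. \<exists>b\<in>sections M E. a x = u \<and> b x = v \<and> w = br a b x)"

definition lie_algebra_bundle ::
  "'m::topological_space manifold \<Rightarrow> ('m, 'v::real_vector) vbundle \<Rightarrow>
   ('m \<Rightarrow> 'v \<Rightarrow> ('m \<Rightarrow> real) \<Rightarrow> real) \<Rightarrow> (('m \<Rightarrow> 'v) \<Rightarrow> ('m \<Rightarrow> 'v) \<Rightarrow> 'm \<Rightarrow> 'v) \<Rightarrow> bool" where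
  "lie_algebra_bundle M E \<rho> br \<longleftrightarrow>
     lie_algebroid M E \<rho> br \<and>
     (\<forall>x. \<forall>v\<in>fibre E x. \<rho> x v = 0) \<and>
     (\<forall>x y. lie_algebra_isomorphic (fibre E x) (fibre_bracket M E br x)
                                   (fibre E y) (fibre_bracket M E br y))"

end

theory Submission
  imports Defs "Jordan_Normal_Form.Determinant" "HOL-Probability.Discrete_Topology"
begin

text \<open>The anchor is surjective, so near every point there are sections \<open>S\<^sub>1, \<dots>, S\<^sub>n\<close> of \<open>A\<close> lifting the
  coordinate vector fields of a chart; subtracting combinations of them from arbitrary sections gives smooth
  local frames \<open>E\<^sub>1, \<dots>, E\<^sub>m\<close> of the kernel \<open>K\<close>. Since the anchor preserves brackets, \<open>[S\<^sub>a, E\<^sub>i]\<close> is again a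
  section of \<open>K\<close>, and \<open>[S\<^sub>a, \<cdot>]\<close> is a partial connection on \<open>K\<close> whose covariant derivatives are derivations of
  the fibrewise bracket by the Jacobi identity. Parallel transport along a straight segment in a chart is
  therefore an isomorphism between the isotropy Lie algebras at its end points. Hence the isomorphism type is
  locally constant, and constant as \<open>M\<close> is connected. Short segments suffice, so that the transport equation
  only has to be solved for small coefficients.\<close>

section \<open>Calculus on open subsets of \<open>R\<^sup>n\<close>\<close>

text \<open>The bracket lives on global sections and is not assumed to be local, while frames, lifts
  and coordinates exist only locally. Bump functions bridge the gap, and the Leibniz rule makes the
  bracket local. Tangent vectors are derivations, so that components of the anchor in a chart make
  sense only once the coordinate fields are known to be bases; this is the purpose of Hadamard's
  lemma. The trivialisations of K are all of its smooth frames. Their compatibility is seen by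
  completing a kernel frame with the lifts to a frame of A and inverting a transition matrix by
  Cramer's rule. The connection may be curved: only transport along one segment at a time is used,
  so curvature never enters. In a frame an isotropy algebra is R^m with structure constants, and the
  Jacobi identity becomes a linear differential equation for these constants along the segment. The
  threshold 1/2 for the size of the coefficients makes the Picard operator on [0,1] a contraction
  and also gives uniqueness.\<close>

lemma Rn_iff: "x \<in> Rn n \<longleftrightarrow> (\<forall>i\<ge>n. x i = 0)"
  by (simp add: topspace_Euclidean_space)

lemma openin_Rn_iff: "openin (Euclidean_space n) U \<longleftrightarrow> (\<exists>T. open T \<and> U = T \<inter> Rn n)"
  unfolding Euclidean_space_def openin_subtopology topspace_subtopology
  by (simp add: euclidean_product_topology)

lemma openin_Rn_subset: "openin (Euclidean_space n) U \<Longrightarrow> x \<in> U \<Longrightarrow> x \<in> Rn n"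
  using openin_subset by blast

text \<open>Open cubes. They contain the segments to their centre and every point obtained by moving
  one coordinate within its range, which general open sets do not; the mean value theorem and
  Hadamard's lemma rely on this.\<close>

definition rbox :: "nat \<Rightarrow> (nat \<Rightarrow> real) \<Rightarrow> real \<Rightarrow> (nat \<Rightarrow> real) set" where
  "rbox n a \<delta> = {y \<in> Rn n. \<forall>i<n. \<bar>y i - a i\<bar> < \<delta>}"

lemma rbox_mono: "\<delta> \<le> \<delta>' \<Longrightarrow> rbox n a \<delta> \<subseteq> rbox n a \<delta>'"
  unfolding rbox_def by force

lemma centre_in_rbox: "a \<in> Rn n \<Longrightarrow> \<delta> > 0 \<Longrightarrow> a \<in> rbox n a \<delta>"
  unfolding rbox_def by simp

lemma openin_rbox: "openin (Euclidean_space n) (rbox n a \<delta>)"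
proof -
  have "open (\<Inter>i\<in>{..<n}. {y::nat \<Rightarrow> real. \<bar>y i - a i\<bar> < \<delta>})"
    by (intro open_INT ballI finite_lessThan open_Collect_less continuous_intros
        continuous_on_product_coordinates)
  moreover have "rbox n a \<delta> = (\<Inter>i\<in>{..<n}. {y. \<bar>y i - a i\<bar> < \<delta>}) \<inter> Rn n"
    unfolding rbox_def by auto
  ultimately show ?thesis
    unfolding openin_Rn_iff by blast
qed

text \<open>Only the coordinates below n need a radius: beyond them every point of
  \<open>Rn n\<close> agrees with \<open>a\<close>.\<close>

lemma openin_Rn_rbox:
  assumes "openin (Euclidean_space n) U" "a \<in> U"
  obtains \<delta> where "\<delta> > 0" "rbox n a \<delta> \<subseteq> U"
proof -
  obtain T where T: "open T" "U = T \<inter> Rn n"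
    using assms(1) openin_Rn_iff by blast
  have "a \<in> T" using T assms by blast
  then obtain X where X: "a \<in> Pi\<^sub>E UNIV X" "\<And>i. open (X i)" "finite {i. X i \<noteq> UNIV}" "Pi\<^sub>E UNIV X \<subseteq> T"
    using product_topology_open_contains_basis[of "\<lambda>i. euclidean" UNIV T a] T(1)
    by (auto simp: open_fun_def)
  have "\<exists>d>0. \<forall>t. \<bar>t - a i\<bar> < d \<longrightarrow> t \<in> X i" for i
  proof -
    have "a i \<in> X i" using X(1) by auto
    then show ?thesis using X(2)[of i] by (auto simp: open_dist dist_real_def)
  qed
  then obtain d where d: "\<And>i. d i > 0" "\<And>i t. \<bar>t - a i\<bar> < d i \<Longrightarrow> t \<in> X i"
    by metis
  \<comment> \<open>The inserted 1 keeps the set nonempty when n = 0.\<close>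
  define \<delta> where "\<delta> = Min (insert 1 (d ` {..<n}))"
  have "\<delta> > 0" unfolding \<delta>_def using d by (subst Min_gr_iff) auto
  moreover have "rbox n a \<delta> \<subseteq> U"
  proof
    fix y assume y: "y \<in> rbox n a \<delta>"
    have "y i \<in> X i" for i
    proof (cases "i < n")
      case True
      then have "\<delta> \<le> d i" unfolding \<delta>_def by (intro Min_le) auto
      then show ?thesis using y True d(2) unfolding rbox_def by force
    next
      case False
      then have "y i = a i"
        using y assms openin_Rn_subset[OF assms] unfolding rbox_def Rn_iff by auto
      then show ?thesis using d by simp
    qed
    then show "y \<in> U" using X(4) T(2) y unfolding rbox_def by auto
  qed
  ultimately show ?thesis using that by blast
qed

lemma update_in_rbox: "x \<in> rbox n a \<delta> \<Longrightarrow> i < n \<Longrightarrow> x(i := t) \<in> rbox n a \<delta> \<longleftrightarrow> \<bar>t - a i\<bar> < \<delta>"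
  unfolding rbox_def Rn_iff by auto

text \<open>The reason why \<open>partial\<close> is local: a small move in a direction i < n stays
  inside U, whereas a move in a direction i \<ge> n would leave \<open>Rn n\<close>.\<close>

lemma eventually_update_in:
  assumes "openin (Euclidean_space n) U" "x \<in> U" "i < n"
  shows "eventually (\<lambda>t. x(i := t) \<in> U) (nhds (x i))"
proof -
  obtain \<delta> where \<delta>: "\<delta> > 0" "rbox n x \<delta> \<subseteq> U"
    using openin_Rn_rbox[OF assms(1,2)] .
  have "x \<in> rbox n x \<delta>"
    using centre_in_rbox \<delta> openin_Rn_subset[OF assms(1,2)] by blast
  then have "x(i := t) \<in> U" if "dist t (x i) < \<delta>" for t
    using update_in_rbox[OF _ \<open>i < n\<close>] \<delta> that by (auto simp: dist_real_def)
  then show ?thesis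
    unfolding eventually_nhds_metric using \<delta> by blast
qed

lemma openin_Rn_preimage:
  assumes "openin (Euclidean_space n) U" "continuous_on U f" "open S"
  shows "openin (Euclidean_space n) {x \<in> U. f x \<in> S}"
proof -
  obtain T where T: "open T" "U = T \<inter> Rn n"
    using assms(1) openin_Rn_iff by blast
  obtain T' where T': "open T'" "U \<inter> f -` S = U \<inter> T'"
    using continuous_openin_preimage_gen[OF assms(2,3)] unfolding openin_open by blast
  have "{x \<in> U. f x \<in> S} = (T \<inter> T') \<inter> Rn n"
    using T T' by blast
  moreover have "open (T \<inter> T')" using T T' by blast
  ultimately show ?thesis unfolding openin_Rn_iff by blast
qed

lemma continuous_on_Rn_local:
  fixes f :: "(nat \<Rightarrow> real) \<Rightarrow> real"
  assumes "U \<subseteq> Rn n"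
    and loc: "\<And>x. x \<in> U \<Longrightarrow> \<exists>V. openin (Euclidean_space n) V \<and> x \<in> V \<and> continuous_on (U \<inter> V) f"
  shows "continuous_on U f"
  unfolding continuous_on_eq_continuous_within
proof
  fix x assume x: "x \<in> U"
  obtain V where V: "openin (Euclidean_space n) V" "x \<in> V" "continuous_on (U \<inter> V) f"
    using loc[OF x] by blast
  obtain T where T: "open T" "V = T \<inter> Rn n"
    using V(1) openin_Rn_iff by blast
  have "U \<inter> V = U \<inter> T" using T assms by blast
  then have "continuous (at x within U \<inter> T) f"
    using V x by (auto simp: continuous_on_eq_continuous_within)
  moreover have "at x within U \<inter> T = at x within U"
    using at_within_nhd[of x T U "U \<inter> T"] T V by auto
  ultimately show "continuous (at x within U) f" by simp
qed

section \<open>Basic rules for C^k functions\<close>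

lemma Ck_on_imp_continuous: "Ck_on n k U f \<Longrightarrow> continuous_on U f"
  by (cases k) auto

lemma Ck_on_SucD:
  assumes "Ck_on n (Suc k) U f" "i < n" "x \<in> U"
  shows "((\<lambda>t. f (x(i := t))) has_real_derivative partial i f x) (at (x i))"
  using assms by (auto simp: partial_def DERIV_deriv_iff_field_differentiable)

lemma Ck_on_partial: "Ck_on n (Suc k) U f \<Longrightarrow> i < n \<Longrightarrow> Ck_on n k U (partial i f)"
  by simp

lemma partial_eqI:
  "((\<lambda>t. f (x(i := t))) has_real_derivative d) (at (x i)) \<Longrightarrow> partial i f x = d"
  unfolding partial_def by (rule DERIV_imp_deriv)

lemma partial_cong:
  assumes "openin (Euclidean_space n) U" "\<And>x. x \<in> U \<Longrightarrow> f x = g x" "x \<in> U" "i < n"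
  shows "partial i f x = partial i g x"
  unfolding partial_def using eventually_update_in[OF assms(1,3,4)]
  by (intro deriv_cong_ev) (auto elim!: eventually_mono simp: assms(2))

text \<open>Since U is open, \<open>partial\<close> at a point of U depends only on values on U.
  Equality of f and g therefore passes to their partial derivatives, which is the induction
  step.\<close>

lemma Ck_on_cong:
  assumes "openin (Euclidean_space n) U" "\<And>x. x \<in> U \<Longrightarrow> f x = g x" "Ck_on n k U f"
  shows "Ck_on n k U g"
  using assms(2,3)
proof (induction k arbitrary: f g)
  case 0
  then show ?case using continuous_on_cong[of U U f g] by auto
next
  case (Suc k)
  have "continuous_on U g"
    using Suc.prems continuous_on_cong[of U U f g] by auto
  moreover have "(\<lambda>t. g (x(i := t))) field_differentiable at (x i)" if "i < n" "x \<in> U" for i x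
  proof -
    have "eventually (\<lambda>t. f (x(i := t)) = g (x(i := t))) (nhds (x i))"
      using eventually_update_in[OF assms(1) that(2,1)]
      by eventually_elim (use Suc.prems in auto)
    then have "((\<lambda>t. g (x(i := t))) has_real_derivative partial i f x) (at (x i))"
      using Ck_on_SucD[OF Suc.prems(2) that] by (rule DERIV_cong_ev[OF refl _ refl, THEN iffD1])
    then show ?thesis by (auto simp: field_differentiable_def)
  qed
  moreover have "Ck_on n k U (partial i g)" if "i < n" for i
    using partial_cong[OF assms(1) Suc.prems(1) _ that] Ck_on_partial[OF Suc.prems(2) that]
    by (rule Suc.IH)
  ultimately show ?case by simp
qed

text \<open>The working introduction rule: candidates D for the partial derivatives are exhibited,
  and \<open>Ck_on_cong\<close> exchanges them for \<open>partial\<close>, so the closure properties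
  below never compute with \<open>deriv\<close>.\<close>

lemma Ck_on_SucI:
  assumes "openin (Euclidean_space n) U" "continuous_on U f"
    and "\<And>i x. i < n \<Longrightarrow> x \<in> U \<Longrightarrow> ((\<lambda>t. f (x(i := t))) has_real_derivative D i x) (at (x i))"
    and "\<And>i. i < n \<Longrightarrow> Ck_on n k U (D i)"
  shows "Ck_on n (Suc k) U f"
proof -
  have "Ck_on n k U (partial i f)" if "i < n" for i
    using partial_eqI[OF assms(3)[OF that], symmetric]
    by (rule Ck_on_cong[OF assms(1) _ assms(4)[OF that]])
  then show ?thesis
    using assms(2,3) by (auto simp: field_differentiable_def)
qed

lemma Ck_on_pred: "Ck_on n (Suc k) U f \<Longrightarrow> Ck_on n k U f"
  by (induction k arbitrary: f) auto

lemma Ck_on_mono: "Ck_on n k U f \<Longrightarrow> V \<subseteq> U \<Longrightarrow> Ck_on n k V f"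
  by (induction k arbitrary: f) (auto intro: continuous_on_subset)

lemma Ck_on_local:
  assumes "U \<subseteq> Rn n"
    and "\<And>x. x \<in> U \<Longrightarrow> \<exists>V. openin (Euclidean_space n) V \<and> x \<in> V \<and> Ck_on n k V f"
  shows "Ck_on n k U f"
  using assms(2)
proof (induction k arbitrary: f)
  case 0
  have "\<exists>V. openin (Euclidean_space n) V \<and> x \<in> V \<and> continuous_on (U \<inter> V) f" if x: "x \<in> U" for x
  proof -
    obtain V where "openin (Euclidean_space n) V" "x \<in> V" "Ck_on n 0 V f"
      using 0[OF x] by blast
    then show ?thesis
      by (intro exI[of _ V]) (auto intro: continuous_on_subset)
  qed
  from continuous_on_Rn_local[OF assms(1) this] show ?case by simp
next
  case (Suc k)
  have loc: "\<exists>V. openin (Euclidean_space n) V \<and> x \<in> V \<and> continuous_on (U \<inter> V) f \<and> Ck_on n (Suc k) V f"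
    if x: "x \<in> U" for x
  proof -
    obtain V where "openin (Euclidean_space n) V" "x \<in> V" "Ck_on n (Suc k) V f"
      using Suc.prems[OF x] by blast
    then show ?thesis
      by (intro exI[of _ V]) (auto intro: continuous_on_subset)
  qed
  have "continuous_on U f"
    using loc by (intro continuous_on_Rn_local[OF assms(1)]) blast
  moreover have "Ck_on n k U (partial i f)" if "i < n" for i
  proof (rule Suc.IH)
    fix x assume "x \<in> U"
    then show "\<exists>V. openin (Euclidean_space n) V \<and> x \<in> V \<and> Ck_on n k V (partial i f)"
      using loc[of x] Ck_on_partial[of n k _ f i] that by metis
  qed
  moreover have "(\<lambda>t. f (x(i := t))) field_differentiable at (x i)" if "i < n" "x \<in> U" for i x
    using loc[OF that(2)] Ck_on_SucD[of n k _ f i x] that by (auto simp: field_differentiable_def)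
  ultimately show ?case by simp
qed

section \<open>Closure of C^k functions under algebraic operations\<close>

lemma Ck_on_const: "openin (Euclidean_space n) U \<Longrightarrow> Ck_on n k U (\<lambda>x. c)"
proof (induction k arbitrary: c)
  case (Suc k)
  then show ?case
    by (intro Ck_on_SucI[where D="\<lambda>i x. 0"]) auto
qed simp

lemma Ck_on_add:
  "openin (Euclidean_space n) U \<Longrightarrow> Ck_on n k U f \<Longrightarrow> Ck_on n k U g \<Longrightarrow> Ck_on n k U (\<lambda>x. f x + g x)"
proof (induction k arbitrary: f g)
  case 0
  then show ?case by (simp add: continuous_on_add)
next
  case (Suc k)
  have "((\<lambda>t. f (x(i := t)) + g (x(i := t))) has_real_derivative
      partial i f x + partial i g x) (at (x i))" if "i < n" "x \<in> U" for i x
    using Ck_on_SucD[OF Suc.prems(2) that] Ck_on_SucD[OF Suc.prems(3) that] by (rule DERIV_add)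
  moreover have "continuous_on U (\<lambda>x. f x + g x)"
    using Suc.prems by (auto intro: continuous_on_add)
  moreover have "Ck_on n k U (\<lambda>x. partial i f x + partial i g x)" if "i < n" for i
    using Ck_on_partial[OF Suc.prems(2) that] Ck_on_partial[OF Suc.prems(3) that] Suc.prems(1)
    by (intro Suc.IH)
  ultimately show ?case
    by (intro Ck_on_SucI[where D="\<lambda>i x. partial i f x + partial i g x", OF Suc.prems(1)])
qed

lemma Ck_on_mult:
  "openin (Euclidean_space n) U \<Longrightarrow> Ck_on n k U f \<Longrightarrow> Ck_on n k U g \<Longrightarrow> Ck_on n k U (\<lambda>x. f x * g x)"
proof (induction k arbitrary: f g)
  case 0
  then show ?case by (simp add: continuous_on_mult)
next
  case (Suc k)
  have "((\<lambda>t. f (x(i := t)) * g (x(i := t))) has_real_derivative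
      partial i f x * g x + partial i g x * f x) (at (x i))" if "i < n" "x \<in> U" for i x
    using DERIV_mult[OF Ck_on_SucD[OF Suc.prems(2) that] Ck_on_SucD[OF Suc.prems(3) that]]
    by (simp only: fun_upd_triv)
  moreover have "continuous_on U (\<lambda>x. f x * g x)"
    using Suc.prems by (auto intro: continuous_on_mult)
  moreover have "Ck_on n k U (\<lambda>x. partial i f x * g x + partial i g x * f x)" if "i < n" for i
    using Ck_on_partial[OF Suc.prems(2) that] Ck_on_partial[OF Suc.prems(3) that]
      Ck_on_pred[OF Suc.prems(2)] Ck_on_pred[OF Suc.prems(3)] Suc.prems(1)
    by (intro Ck_on_add Suc.IH)
  ultimately show ?case
    by (intro Ck_on_SucI[where D="\<lambda>i x. partial i f x * g x + partial i g x * f x", OF Suc.prems(1)])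
qed

text \<open>With g = 1/f the partial derivatives are -f' g g. They are expressed by g itself, so the
  induction hypothesis for g and closure under products suffice.\<close>

lemma Ck_on_inverse:
  "openin (Euclidean_space n) U \<Longrightarrow> Ck_on n k U f \<Longrightarrow> (\<And>x. x \<in> U \<Longrightarrow> f x \<noteq> 0) \<Longrightarrow>
    Ck_on n k U (\<lambda>x. inverse (f x))"
proof (induction k)
  case 0
  then show ?case by (simp add: continuous_on_inverse)
next
  case (Suc k)
  define g where "g = (\<lambda>x. inverse (f x))"
  have g: "Ck_on n k U g"
    unfolding g_def using Suc Ck_on_pred by blast
  have "((\<lambda>t. g (x(i := t))) has_real_derivative
      (-1) * (partial i f x * (g x * g x))) (at (x i))" if "i < n" "x \<in> U" for i x
    unfolding g_def
    by (rule DERIV_cong[OF DERIV_inverse'[OF Ck_on_SucD[OF Suc.prems(2) that]]])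
      (use Suc.prems(3)[OF that(2)] in simp_all)
  moreover have "continuous_on U g"
    using g Ck_on_imp_continuous by blast
  moreover have "Ck_on n k U (\<lambda>x. (-1) * (partial i f x * (g x * g x)))" if "i < n" for i
    using Ck_on_partial[OF Suc.prems(2) that] g Suc.prems(1)
    by (intro Ck_on_mult Ck_on_const)
  ultimately show ?case unfolding g_def[symmetric]
    by (intro Ck_on_SucI[where D="\<lambda>i x. (-1) * (partial i f x * (g x * g x))", OF Suc.prems(1)])
qed

lemma Ck_on_sum:
  "openin (Euclidean_space n) U \<Longrightarrow> (\<And>i. i \<in> I \<Longrightarrow> Ck_on n k U (f i)) \<Longrightarrow>
    Ck_on n k U (\<lambda>x. \<Sum>i\<in>I. f i x)"
  by (induction I rule: infinite_finite_induct) (auto intro: Ck_on_const Ck_on_add)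

subsection \<open>A flat function\<close>

text \<open>The classical function exp(-1/t), multiplied by powers of 1/t. The derivative of a
  member of this family is a combination of members, so smoothness follows by one induction for all
  j.\<close>

definition flat :: "nat \<Rightarrow> real \<Rightarrow> real" where
  "flat j t = (if t > 0 then exp (- inverse t) * inverse t ^ j else 0)"

lemma flat_pos: "t > 0 \<Longrightarrow> flat j t > 0"
  by (simp add: flat_def)

lemma flat_nonneg: "flat j t \<ge> 0"
  by (simp add: flat_def)

lemma flat_zero: "t \<le> 0 \<Longrightarrow> flat j t = 0"
  by (simp add: flat_def)

text \<open>On the right, s = 1/t turns the claim into the decay of s^j / exp s at infinity.\<close>

lemma flat_tendsto_0: "(flat j \<longlongrightarrow> 0) (at 0)"
proof -
  have "(flat j \<longlongrightarrow> 0) (at_left 0)"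
    by (rule Lim_transform_eventually[of "\<lambda>_. 0"])
      (auto simp: flat_def eventually_at_filter intro: always_eventually)
  moreover have "(flat j \<longlongrightarrow> 0) (at_right 0)"
  proof -
    have "((\<lambda>t. inverse t ^ j / exp (inverse t)) \<longlongrightarrow> 0) (at_right (0::real))"
      using filterlim_compose[OF tendsto_power_div_exp_0 filterlim_inverse_at_top_right] .
    moreover have "eventually (\<lambda>t. inverse t ^ j / exp (inverse t) = flat j t) (at_right 0)"
      unfolding eventually_at_filter
      by (intro always_eventually)
        (auto simp: flat_def exp_minus field_simps)
    ultimately show ?thesis by (rule Lim_transform_eventually)
  qed
  ultimately show ?thesis by (rule filterlim_split_at)
qed

lemma DERIV_flat: "(flat j has_real_derivative flat (j + 2) t - real j * flat (j + 1) t) (at t)"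
proof -
  consider "t > 0" | "t = 0" | "t < 0" by linarith
  then show ?thesis
  proof cases
    case 1
    have D1: "((\<lambda>t. exp (- inverse t)) has_real_derivative exp (- inverse t) * inverse t ^ 2) (at t)"
      using 1 by (auto intro!: derivative_eq_intros simp: power2_eq_square)
    have D2: "((\<lambda>t. inverse t ^ j) has_real_derivative - real j * inverse t ^ (j + 1)) (at t)"
      using DERIV_power[OF DERIV_inverse[of t UNIV], of j] 1
      by (cases j) (auto simp: algebra_simps)
    have D: "((\<lambda>t. exp (- inverse t) * inverse t ^ j) has_real_derivative flat (j + 2) t - real j * flat (j + 1) t) (at t)"
      by (rule DERIV_cong[OF DERIV_mult[OF D1 D2]]) (use 1 in \<open>simp add: flat_def power2_eq_square algebra_simps\<close>)
    have "eventually (\<lambda>s. exp (- inverse s) * inverse s ^ j = flat j s) (nhds t)"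
      using eventually_nhds_in_open[of "{0<..}" t] 1
      by (auto elim!: eventually_mono simp: flat_def)
    from DERIV_cong_ev[OF refl this refl, THEN iffD1, OF D] show ?thesis .
  next
    case 2
    \<comment> \<open>Division by y raises the exponent: the difference quotient of
      \<open>flat j\<close> at 0 is \<open>flat (Suc j)\<close>.\<close>
    have "(flat (Suc j) \<longlongrightarrow> 0) (at 0)" by (rule flat_tendsto_0)
    then have "((\<lambda>y. (flat j y - flat j 0) / (y - 0)) \<longlongrightarrow> 0) (at 0)"
      by (rule Lim_transform_eventually)
        (auto simp: eventually_at_filter flat_def divide_inverse algebra_simps intro!: always_eventually)
    then show ?thesis
      using 2 by (simp add: has_field_derivative_iff flat_zero)
  next
    case 3
    have "eventually (\<lambda>s. 0 = flat j s) (nhds t)"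
      using eventually_nhds_in_open[of "{..<0}" t] 3
      by (auto elim!: eventually_mono simp: flat_def)
    then show ?thesis
      by (rule DERIV_cong_ev[OF refl _ refl, THEN iffD1]) (use 3 in \<open>simp add: flat_def\<close>)
  qed
qed

lemma Ck_on_flat:
  "openin (Euclidean_space n) U \<Longrightarrow> Ck_on n k U f \<Longrightarrow> Ck_on n k U (\<lambda>x. flat j (f x))"
proof (induction k arbitrary: j)
  case 0
  have "continuous_on UNIV (flat j)"
    using DERIV_flat DERIV_isCont by (blast intro: continuous_at_imp_continuous_on)
  then show ?case using 0 by (auto intro: continuous_on_compose2)
next
  case (Suc k)
  have f: "Ck_on n k U f" using Suc.prems Ck_on_pred by blast
  have "((\<lambda>t. flat j (f (x(i := t)))) has_real_derivative
      (flat (j + 2) (f x) + (- real j) * flat (j + 1) (f x)) * partial i f x) (at (x i))"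
    if "i < n" "x \<in> U" for i x
    by (rule DERIV_cong[OF DERIV_chain2[OF DERIV_flat Ck_on_SucD[OF Suc.prems(2) that]]]) simp
  moreover have "continuous_on U (\<lambda>x. flat j (f x))"
    using Suc.IH[OF Suc.prems(1) f] Ck_on_imp_continuous by blast
  moreover have "Ck_on n k U (\<lambda>x. (flat (j + 2) (f x) + (- real j) * flat (j + 1) (f x)) * partial i f x)"
    if "i < n" for i
    using Suc.prems(1) f Ck_on_partial[OF Suc.prems(2) that]
    by (intro Ck_on_mult Ck_on_add Ck_on_const Suc.IH)
  ultimately show ?case
    by (intro Ck_on_SucI[where D="\<lambda>i x. (flat (j + 2) (f x) + (- real j) * flat (j + 1) (f x)) * partial i f x",
          OF Suc.prems(1)])
qed

subsection \<open>The chain rule\<close>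

text \<open>The increment of \<open>f\<close> is split along the coordinate directions; the mean value theorem turns
  each part into a difference quotient that is close to a partial derivative.\<close>

lemma Ck_on_increment:
  assumes V: "openin (Euclidean_space n) V" and f: "Ck_on n (Suc k) V f" and a: "a \<in> V"
  shows "\<exists>p. (\<forall>i<n. \<forall>\<epsilon>>0. \<exists>\<delta>>0. \<forall>y\<in>rbox n a \<delta>. \<bar>p i y - partial i f a\<bar> < \<epsilon>) \<and>
    (\<forall>y\<in>Rn n. f y - f a = (\<Sum>i<n. p i y * (y i - a i)))"
proof -
  obtain d where d: "d > 0" "rbox n a d \<subseteq> V"
    using openin_Rn_rbox[OF V a] .
  have aR: "a \<in> Rn n" using openin_Rn_subset[OF V a] .
  \<comment> \<open>Corners of a path from a to y along the coordinate directions: the first i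
    coordinates are taken from y, the others from a.\<close>
  define h where "h i y = (\<lambda>j. if j < i then y j else a j)" for i :: nat and y :: "nat \<Rightarrow> real"
  \<comment> \<open>The difference quotient along the i-th edge of that path. Where it would be 0/0
    it gets the partial derivative at a, so that it stays close to that value.\<close>
  define p where "p i y = (if y i = a i then partial i f a
    else (f (h (Suc i) y) - f (h i y)) / (y i - a i))" for i y
  have h_Suc: "h (Suc i) y = (h i y)(i := y i)" for i y
    unfolding h_def by auto
  have h_same: "h i y = (h i y)(i := a i)" for i y
    unfolding h_def by auto
  have "f y - f a = (\<Sum>i<n. p i y * (y i - a i))" if y: "y \<in> Rn n" for y
  proof -
    have "h n y = y" "h 0 y = a"
      using y aR unfolding h_def Rn_iff by (auto simp: fun_eq_iff)
    then have "f y - f a = (\<Sum>i<n. f (h (Suc i) y) - f (h i y))"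
      using sum_lessThan_telescope[of "\<lambda>i. f (h i y)" n] by simp
    also have "\<dots> = (\<Sum>i<n. p i y * (y i - a i))"
    proof (rule sum.cong[OF refl])
      fix i
      have "h (Suc i) y = h i y" if "y i = a i"
        unfolding h_Suc using h_same[of i y] that by simp
      then show "f (h (Suc i) y) - f (h i y) = p i y * (y i - a i)"
        unfolding p_def by simp
    qed
    finally show ?thesis .
  qed
  moreover have "\<exists>\<delta>>0. \<forall>y\<in>rbox n a \<delta>. \<bar>p i y - partial i f a\<bar> < \<epsilon>" if i: "i < n" and "\<epsilon> > 0" for i \<epsilon>
  proof -
    have cont: "continuous_on V (partial i f)"
      using f i Ck_on_imp_continuous Ck_on_partial by blast
    have "openin (Euclidean_space n) {z \<in> V. partial i f z \<in> ball (partial i f a) \<epsilon>}"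
      by (rule openin_Rn_preimage[OF V cont]) simp
    moreover have "a \<in> {z \<in> V. partial i f z \<in> ball (partial i f a) \<epsilon>}"
      using a \<open>\<epsilon> > 0\<close> by simp
    ultimately obtain \<delta>' where \<delta>': "\<delta>' > 0" "rbox n a \<delta>' \<subseteq> {z \<in> V. partial i f z \<in> ball (partial i f a) \<epsilon>}"
      by (rule openin_Rn_rbox)
    have "\<bar>p i y - partial i f a\<bar> < \<epsilon>" if y: "y \<in> rbox n a \<delta>'" for y
    proof (cases "y i = a i")
      case True
      then show ?thesis unfolding p_def using \<open>\<epsilon> > 0\<close> by simp
    next
      case False
      \<comment> \<open>Points of the i-th edge take their coordinates from a or y, except the i-th,
        which is no farther from \<open>a i\<close> than \<open>y i\<close> is. Hence the whole edge
        stays in the cube.\<close>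
      have box: "(h i y)(i := t) \<in> rbox n a \<delta>'" if "\<bar>t - a i\<bar> \<le> \<bar>y i - a i\<bar>" for t
      proof -
        have "\<bar>y i - a i\<bar> < \<delta>'" using y i unfolding rbox_def by blast
        then show ?thesis using y aR that \<delta>'(1) i unfolding rbox_def h_def Rn_iff by auto
      qed
      have D: "((\<lambda>t. f ((h i y)(i := t))) has_real_derivative partial i f ((h i y)(i := t))) (at t)"
        if "\<bar>t - a i\<bar> \<le> \<bar>y i - a i\<bar>" for t
      proof -
        have "(h i y)(i := t) \<in> V" using box[OF that] \<delta>' by blast
        from Ck_on_SucD[OF f i this] show ?thesis by (simp only: fun_upd_same fun_upd_upd)
      qed
      have "\<exists>z. \<bar>z - a i\<bar> \<le> \<bar>y i - a i\<bar> \<and> f ((h i y)(i := y i)) - f ((h i y)(i := a i))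
          = (y i - a i) * partial i f ((h i y)(i := z))"
      proof (cases "a i < y i")
        case True
        have "\<exists>z>a i. z < y i \<and> f ((h i y)(i := y i)) - f ((h i y)(i := a i))
          = (y i - a i) * partial i f ((h i y)(i := z))"
          by (rule MVT2[OF True]) (rule D, auto)
        then show ?thesis by force
      next
        case F: False
        then have "y i < a i" using \<open>y i \<noteq> a i\<close> by simp
        then have "\<exists>z>y i. z < a i \<and> f ((h i y)(i := a i)) - f ((h i y)(i := y i))
          = (a i - y i) * partial i f ((h i y)(i := z))"
          by (rule MVT2) (rule D, auto)
        then obtain z where z: "y i < z" "z < a i"
          "f ((h i y)(i := a i)) - f ((h i y)(i := y i)) = (a i - y i) * partial i f ((h i y)(i := z))"
          by blast
        then show ?thesis
          by (intro exI[of _ z]) (simp add: algebra_simps del: fun_upd_apply)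
      qed
      then obtain z where z: "\<bar>z - a i\<bar> \<le> \<bar>y i - a i\<bar>"
        "f ((h i y)(i := y i)) - f ((h i y)(i := a i)) = (y i - a i) * partial i f ((h i y)(i := z))"
        by blast
      then have "p i y = partial i f ((h i y)(i := z))"
        unfolding p_def h_Suc using False h_same[of i y] by simp
      then show ?thesis
        using box[OF z(1)] \<delta>'(2) by (auto simp: dist_real_def abs_minus_commute)
    qed
    then show ?thesis using \<delta>'(1) by blast
  qed
  ultimately show ?thesis by blast
qed

text \<open>Divide the increment formula by t - t0: the factors p tend to the partial derivatives,
  the remaining quotients to d. The curve has to stay in \<open>Rn n\<close> near t0 because the
  increment formula holds only there.\<close>

lemma has_real_derivative_along_curve:
  assumes V: "openin (Euclidean_space n) V" and f: "Ck_on n (Suc k) V f" and a: "\<gamma> t0 \<in> V"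
    and \<gamma>: "eventually (\<lambda>t. \<gamma> t \<in> Rn n) (at t0)"
    and d: "\<And>i. i < n \<Longrightarrow> ((\<lambda>t. \<gamma> t i) has_real_derivative d i) (at t0)"
  shows "((\<lambda>t. f (\<gamma> t)) has_real_derivative (\<Sum>i<n. partial i f (\<gamma> t0) * d i)) (at t0)"
proof -
  obtain p where p: "\<And>i \<epsilon>. i < n \<Longrightarrow> \<epsilon> > 0 \<Longrightarrow> \<exists>\<delta>>0. \<forall>y\<in>rbox n (\<gamma> t0) \<delta>. \<bar>p i y - partial i f (\<gamma> t0)\<bar> < \<epsilon>"
    "\<And>y. y \<in> Rn n \<Longrightarrow> f y - f (\<gamma> t0) = (\<Sum>i<n. p i y * (y i - \<gamma> t0 i))"
    using Ck_on_increment[OF V f a] by blast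
  have box: "eventually (\<lambda>t. \<gamma> t \<in> rbox n (\<gamma> t0) \<delta>) (at t0)" if "\<delta> > 0" for \<delta>
  proof -
    have "eventually (\<lambda>t. \<forall>i\<in>{..<n}. \<bar>\<gamma> t i - \<gamma> t0 i\<bar> < \<delta>) (at t0)"
    proof (intro eventually_ball_finite ballI)
      fix i assume "i \<in> {..<n}"
      then have "((\<lambda>t. \<gamma> t i) \<longlongrightarrow> \<gamma> t0 i) (at t0)"
        using DERIV_isCont[OF d] by (auto simp: isCont_def)
      from tendstoD[OF this that] show "eventually (\<lambda>t. \<bar>\<gamma> t i - \<gamma> t0 i\<bar> < \<delta>) (at t0)"
        by (simp add: dist_real_def)
    qed simp
    then show ?thesis using \<gamma> by eventually_elim (auto simp: rbox_def)
  qed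
  have lim: "((\<lambda>t. p i (\<gamma> t)) \<longlongrightarrow> partial i f (\<gamma> t0)) (at t0)" if i: "i < n" for i
  proof (rule tendstoI)
    fix \<epsilon> :: real assume "\<epsilon> > 0"
    then obtain \<delta> where \<delta>: "\<delta> > 0" "\<forall>y\<in>rbox n (\<gamma> t0) \<delta>. \<bar>p i y - partial i f (\<gamma> t0)\<bar> < \<epsilon>"
      using p(1)[OF i] by blast
    show "eventually (\<lambda>t. dist (p i (\<gamma> t)) (partial i f (\<gamma> t0)) < \<epsilon>) (at t0)"
      using box[OF \<delta>(1)] by (rule eventually_mono) (use \<delta>(2) in \<open>auto simp: dist_real_def\<close>)
  qed
  have "((\<lambda>t. \<Sum>i<n. p i (\<gamma> t) * ((\<gamma> t i - \<gamma> t0 i) / (t - t0))) \<longlongrightarrow> (\<Sum>i<n. partial i f (\<gamma> t0) * d i)) (at t0)"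
    using d by (intro tendsto_sum tendsto_mult lim) (auto simp: has_field_derivative_iff)
  moreover have "eventually (\<lambda>t. (\<Sum>i<n. p i (\<gamma> t) * ((\<gamma> t i - \<gamma> t0 i) / (t - t0)))
      = (f (\<gamma> t) - f (\<gamma> t0)) / (t - t0)) (at t0)"
    using \<gamma> by eventually_elim (simp add: p(2) sum_divide_distrib)
  ultimately show ?thesis
    unfolding has_field_derivative_iff by (rule Lim_transform_eventually)
qed

text \<open>Induction on k with f arbitrary and g fixed, since the chain rule replaces f by its
  partial derivatives. Continuity of g into the product topology follows from its coordinates; those
  from n on vanish because V lies in \<open>Rn n\<close>.\<close>

lemma Ck_on_compose:
  assumes U: "openin (Euclidean_space m) U" and V: "openin (Euclidean_space n) V"
    and "Ck_on n k V f" "\<And>i. i < n \<Longrightarrow> Ck_on m k U (\<lambda>x. g x i)" and gV: "\<And>x. x \<in> U \<Longrightarrow> g x \<in> V"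
  shows "Ck_on m k U (\<lambda>x. f (g x))"
proof -
  have cont: "continuous_on U g" if "\<And>i. i < n \<Longrightarrow> continuous_on U (\<lambda>x. g x i)"
  proof (rule continuous_on_coordinatewise_then_product)
    fix i
    show "continuous_on U (\<lambda>x. g x i)"
    proof (cases "i < n")
      case False
      then have "g x i = 0" if "x \<in> U" for x
        using openin_Rn_subset[OF V gV[OF that]] unfolding Rn_iff by simp
      then show ?thesis using continuous_on_cong[of U U "\<lambda>x. g x i" "\<lambda>_. 0"] by simp
    qed (use that in simp)
  qed
  show ?thesis
    using assms(3,4)
  proof (induction k arbitrary: f)
    case 0
    then have "continuous_on V f" "continuous_on U g" using cont by auto
    moreover have "g ` U \<subseteq> V" using gV by blast
    ultimately show ?case by (simp add: continuous_on_compose2)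
  next
    case (Suc k)
    have g: "continuous_on U g"
      using Suc.prems Ck_on_imp_continuous cont by blast
    have "((\<lambda>t. f (g (x(j := t)))) has_real_derivative
        (\<Sum>i<n. partial i f (g x) * partial j (\<lambda>x. g x i) x)) (at (x j))" if j: "j < m" and x: "x \<in> U" for j x
    proof -
      have ev: "eventually (\<lambda>t. g (x(j := t)) \<in> Rn n) (at (x j))"
        using eventually_update_in[OF U x j] unfolding eventually_at_filter
        by eventually_elim (use gV openin_Rn_subset[OF V] in blast)
      have "((\<lambda>t. g (x(j := t)) i) has_real_derivative partial j (\<lambda>x. g x i) x) (at (x j))" if "i < n" for i
        using Ck_on_SucD[OF Suc.prems(2)[OF that] j x] .
      from has_real_derivative_along_curve[OF V Suc.prems(1) _ ev this]
      show ?thesis using gV[OF x] by (simp only: fun_upd_triv)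
    qed
    moreover have "continuous_on U (\<lambda>x. f (g x))"
      by (rule continuous_on_compose2[OF Ck_on_imp_continuous[OF Suc.prems(1)] g]) (use gV in blast)
    moreover have "Ck_on m k U (\<lambda>x. \<Sum>i<n. partial i f (g x) * partial j (\<lambda>x. g x i) x)" if "j < m" for j
    proof (intro Ck_on_sum[OF U] Ck_on_mult[OF U])
      fix i assume "i \<in> {..<n}"
      then have i: "i < n" by simp
      show "Ck_on m k U (\<lambda>x. partial i f (g x))"
        using Suc.IH[OF Ck_on_partial[OF Suc.prems(1) i]] Ck_on_pred[OF Suc.prems(2)] by blast
      show "Ck_on m k U (partial j (\<lambda>x. g x i))"
        using Ck_on_partial[OF Suc.prems(2)[OF i] that] .
    qed
    ultimately show ?case
      by (intro Ck_on_SucI[OF U, where D="\<lambda>j x. \<Sum>i<n. partial i f (g x) * partial j (\<lambda>x. g x i) x"])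
  qed
qed

subsection \<open>Hadamard's lemma\<close>

lemma rbox_starlike:
  assumes "p \<in> Rn n" "x \<in> rbox n p \<delta>" "0 \<le> t" "t \<le> 1"
  shows "(\<lambda>i. p i + t * (x i - p i)) \<in> rbox n p \<delta>"
proof -
  have "\<bar>t * (x i - p i)\<bar> < \<delta>" if "i < n" for i
  proof -
    have "t * \<bar>x i - p i\<bar> \<le> 1 * \<bar>x i - p i\<bar>"
      using assms by (intro mult_right_mono) auto
    then show ?thesis using assms that unfolding rbox_def by (auto simp: abs_mult)
  qed
  then show ?thesis using assms unfolding rbox_def Rn_iff by auto
qed

text \<open>Differentiating under the integral sign produces a factor t. The weight t^j, with j
  arbitrary, makes the class of such integrals stable under partial derivatives.\<close>

lemma Ck_on_integral_segment:
  assumes p: "p \<in> Rn n" and "Ck_on n k (rbox n p \<delta>) F"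
  shows "Ck_on n k (rbox n p \<delta>) (\<lambda>x. integral {0..1} (\<lambda>t. t ^ j * F (\<lambda>i. p i + t * (x i - p i))))"
proof -
  note U = openin_rbox[of n p \<delta>]
  have seg: "(\<lambda>i. p i + t * (x i - p i)) \<in> rbox n p \<delta>" if "x \<in> rbox n p \<delta>" "t \<in> {0..1}" for x t
    using rbox_starlike[OF p] that by auto
  have cont: "continuous_on (rbox n p \<delta> \<times> cbox 0 1) (\<lambda>(x, t). t ^ j * G (\<lambda>i. p i + t * (x i - p i)))"
    if "continuous_on (rbox n p \<delta>) G" for G and j :: nat
    unfolding case_prod_unfold
  proof (intro continuous_on_mult continuous_intros
      continuous_on_compose2[OF that continuous_on_coordinatewise_then_product])
    show "continuous_on (rbox n p \<delta> \<times> cbox 0 1) (\<lambda>x. fst x i)" for i :: nat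
      by (rule continuous_on_compose2[OF continuous_on_product_coordinates continuous_on_fst[OF continuous_on_id]]) auto
  qed (use seg in auto)
  let ?I = "\<lambda>j F x. integral {0..1} (\<lambda>t. t ^ j * F (\<lambda>i. p i + t * (x i - p i)))"
  show ?thesis
    using assms(2)
  proof (induction k arbitrary: F j)
    case 0
    then have "continuous_on (rbox n p \<delta>) F" by simp
    from integral_continuous_on_param[OF cont[OF this, of j]] show ?case by simp
  next
    case (Suc k)
    have D: "((\<lambda>s. ?I j F (x(i := s))) has_real_derivative ?I (Suc j) (partial i F) x) (at (x i))"
      if i: "i < n" and x: "x \<in> rbox n p \<delta>" for i x
    proof -
      \<comment> \<open>The values of the i-th coordinate for which the modified point remains in
        the cube.\<close>
      let ?S = "ball (p i) \<delta>"
      have xi: "x i \<in> ?S" using x i by (auto simp: rbox_def dist_real_def abs_minus_commute)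
      have xS: "x(i := s) \<in> rbox n p \<delta> \<longleftrightarrow> s \<in> ?S" for s
        using update_in_rbox[OF x i] by (simp add: dist_real_def abs_minus_commute)
      have "((\<lambda>s. integral (cbox 0 1) (\<lambda>t. t ^ j * F (\<lambda>l. p l + t * ((x(i := s)) l - p l)))) has_real_derivative
          integral (cbox 0 1) (\<lambda>t. t ^ Suc j * partial i F (\<lambda>l. p l + t * ((x(i := x i)) l - p l))))
          (at (x i) within ?S)"
      proof (rule leibniz_rule_field_derivative[where U="?S"])
        fix s and t :: real assume s: "s \<in> ?S" and t: "t \<in> cbox 0 1"
        let ?y = "\<lambda>l. p l + t * ((x(i := s)) l - p l)"
        have y: "?y \<in> rbox n p \<delta>" using seg[of "x(i := s)" t] xS[of s] s t
          by (simp only: box_real)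
        have eq: "(\<lambda>u. F (\<lambda>l. p l + t * ((x(i := u)) l - p l))) = (\<lambda>u. F (?y(i := p i + t * (u - p i))))"
          by (intro ext arg_cong[of _ _ F]) auto
        have "((\<lambda>u. F (?y(i := u))) has_real_derivative partial i F ?y) (at (p i + t * (s - p i)))"
          using Ck_on_SucD[OF Suc.prems i y] by (simp only: fun_upd_same)
        moreover have "((\<lambda>u. p i + t * (u - p i)) has_real_derivative t) (at s)"
          by (auto intro!: derivative_eq_intros)
        ultimately have "((\<lambda>u. F (?y(i := p i + t * (u - p i)))) has_real_derivative partial i F ?y * t) (at s)"
          by (rule DERIV_chain2[where f="\<lambda>u. F (?y(i := u))" and g="\<lambda>u. p i + t * (u - p i)"])
        then have "((\<lambda>u. F (\<lambda>l. p l + t * ((x(i := u)) l - p l))) has_real_derivative partial i F ?y * t) (at s)"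
          unfolding eq .
        from DERIV_cmult[OF this, of "t ^ j"]
        have "((\<lambda>u. t ^ j * F (\<lambda>l. p l + t * ((x(i := u)) l - p l))) has_real_derivative t ^ Suc j * partial i F ?y) (at s)"
          by (simp only: power_Suc mult.assoc mult.commute mult.left_commute)
        then show "((\<lambda>u. t ^ j * F (\<lambda>l. p l + t * ((x(i := u)) l - p l))) has_real_derivative t ^ Suc j * partial i F ?y)
            (at s within ?S)"
          by (rule has_field_derivative_at_within)
      next
        fix s assume s: "s \<in> ?S"
        have "continuous_on (cbox 0 1) (\<lambda>t. (\<lambda>(x, t). t ^ j * F (\<lambda>i. p i + t * (x i - p i))) (x(i := s), t))"
          using xS s
          by (intro continuous_on_compose2[OF cont[OF Ck_on_imp_continuous[OF Suc.prems]]] continuous_intros) auto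
        then have "continuous_on (cbox 0 1) (\<lambda>t. t ^ j * F (\<lambda>l. p l + t * ((x(i := s)) l - p l)))"
          by (simp only: prod.case)
        then show "(\<lambda>t. t ^ j * F (\<lambda>l. p l + t * ((x(i := s)) l - p l))) integrable_on cbox 0 1"
          by (rule integrable_continuous)
      next
        have "continuous_on (?S \<times> cbox 0 1) (\<lambda>z. (\<lambda>(x, t). t ^ Suc j * partial i F (\<lambda>i. p i + t * (x i - p i)))
            (x(i := fst z), snd z))"
        proof (rule continuous_on_compose2[OF cont[OF Ck_on_imp_continuous[OF Ck_on_partial[OF Suc.prems i]]]])
          show "continuous_on (?S \<times> cbox 0 1) (\<lambda>z. (x(i := fst z), snd z))"
          proof (rule continuous_on_Pair[OF continuous_on_coordinatewise_then_product])
            show "continuous_on (?S \<times> cbox 0 1) (\<lambda>z. (x(i := fst z)) l)" for l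
              by (cases "l = i") (auto intro!: continuous_intros)
            show "continuous_on (?S \<times> cbox 0 1) (\<lambda>z. snd z)"
              by (rule continuous_on_snd[OF continuous_on_id])
          qed
          show "(\<lambda>z. (x(i := fst z), snd z)) ` (?S \<times> cbox 0 1) \<subseteq> rbox n p \<delta> \<times> cbox 0 1"
            by (intro image_subsetI) (simp only: mem_Times_iff fst_conv snd_conv xS)
        qed
        then show "continuous_on (?S \<times> cbox 0 1)
            (\<lambda>(s, t). t ^ Suc j * partial i F (\<lambda>l. p l + t * ((x(i := s)) l - p l)))"
          by (simp only: prod.case case_prod_unfold fst_conv snd_conv)
      qed (rule xi convex_ball)+
      then show ?thesis
        using at_within_open[OF xi] by (simp only: fun_upd_triv open_ball box_real)
    qed
    have "Ck_on n k (rbox n p \<delta>) (?I (Suc j) (partial i F))" if "i < n" for i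
      by (rule Suc.IH[OF Ck_on_partial[OF Suc.prems that]])
    moreover have "continuous_on (rbox n p \<delta>) (?I j F)"
      using Suc.IH[OF Ck_on_pred[OF Suc.prems]] Ck_on_imp_continuous by blast
    ultimately show ?case
      using D by (intro Ck_on_SucI[OF U, where D="\<lambda>i. ?I (Suc j) (partial i F)"])
  qed
qed

text \<open>The fundamental theorem of calculus along the segment from p to x: f x - f p is the
  integral of the derivative of t \<mapsto> f (p + t (x - p)), and the chain rule pulls the factors
  x i - p i out of it.\<close>

lemma hadamard:
  assumes p: "p \<in> Rn n" "\<delta> > 0" and f: "\<And>k. Ck_on n k (rbox n p \<delta>) f"
  obtains G where "\<And>i k. i < n \<Longrightarrow> Ck_on n k (rbox n p \<delta>) (G i)"
    "\<And>x. x \<in> rbox n p \<delta> \<Longrightarrow> f x = f p + (\<Sum>i<n. (x i - p i) * G i x)"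
    "\<And>i. i < n \<Longrightarrow> G i p = partial i f p"
proof -
  \<comment> \<open>The factor \<open>t ^ 0\<close> only gives the integrand the shape required by
    \<open>Ck_on_integral_segment\<close>.\<close>
  define G where "G i x = integral {0..1} (\<lambda>t. t ^ 0 * partial i f (\<lambda>l. p l + t * (x l - p l)))" for i x
  have "Ck_on n k (rbox n p \<delta>) (G i)" if "i < n" for i k
    unfolding G_def using Ck_on_integral_segment[OF p(1) Ck_on_partial[OF f that]] by blast
  moreover have "f x = f p + (\<Sum>i<n. (x i - p i) * G i x)" if x: "x \<in> rbox n p \<delta>" for x
  proof -
    let ?\<gamma> = "\<lambda>t l. p l + t * (x l - p l)"
    have D: "((\<lambda>t. f (?\<gamma> t)) has_real_derivative (\<Sum>i<n. partial i f (?\<gamma> t) * (x i - p i))) (at t)"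
      if "t \<in> {0..1}" for t
    proof (rule has_real_derivative_along_curve[OF openin_rbox f])
      show "?\<gamma> t \<in> rbox n p \<delta>" using rbox_starlike[OF p(1) x] that by auto
      show "eventually (\<lambda>t. ?\<gamma> t \<in> Rn n) (at t)"
        using p(1) x unfolding rbox_def Rn_iff by auto
    qed (auto intro!: derivative_eq_intros)
    have "((\<lambda>t. \<Sum>i<n. partial i f (?\<gamma> t) * (x i - p i)) has_integral f (?\<gamma> 1) - f (?\<gamma> 0)) {0..1}"
      by (rule fundamental_theorem_of_calculus)
        (use D in \<open>auto simp: has_real_derivative_iff_has_vector_derivative[symmetric]
            intro: has_field_derivative_at_within\<close>)
    then have "f x - f p = integral {0..1} (\<lambda>t. \<Sum>i<n. partial i f (?\<gamma> t) * (x i - p i))"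
      by (auto simp: integral_unique)
    also have "\<dots> = (\<Sum>i<n. integral {0..1} (\<lambda>t. partial i f (?\<gamma> t) * (x i - p i)))"
    proof (rule integral_sum)
      fix i assume i: "i \<in> {..<n}"
      then have "continuous_on (rbox n p \<delta>) (partial i f)"
        using Ck_on_imp_continuous[OF Ck_on_partial[OF f]] by blast
      moreover have "continuous_on {0..1} ?\<gamma>"
        by (intro continuous_on_coordinatewise_then_product continuous_intros)
      moreover have "?\<gamma> ` {0..1} \<subseteq> rbox n p \<delta>"
        using rbox_starlike[OF p(1) x] by (auto simp del: fun_upd_apply)
      ultimately have "continuous_on {0..1} (\<lambda>t. partial i f (?\<gamma> t))"
        by (rule continuous_on_compose2)
      then show "(\<lambda>t. partial i f (?\<gamma> t) * (x i - p i)) integrable_on {0..1}"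
        by (intro integrable_continuous_interval continuous_intros)
    qed simp
    also have "\<dots> = (\<Sum>i<n. (x i - p i) * G i x)"
      unfolding G_def by (simp add: mult.commute)
    finally show ?thesis by simp
  qed
  moreover have "G i p = partial i f p" for i
    unfolding G_def by simp
  ultimately show ?thesis using that by blast
qed

section \<open>Smooth functions on manifolds\<close>

lemma smooth_funD: "smooth_fun M W f \<Longrightarrow> (U, \<phi>) \<in> charts M \<Longrightarrow>
    Ck_on (mdim M) k (\<phi> ` (U \<inter> W)) (f \<circ> inv_into U \<phi>)"
  unfolding smooth_fun_def smooth_on_def by blast

locale smooth_mfd =
  fixes M :: "'m::{t2_space, second_countable_topology} manifold"
  assumes mfd: "smooth_manifold M"
begin

lemma chart_exists: obtains U \<phi> where "(U, \<phi>) \<in> charts M" "x \<in> U"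
proof -
  have "(\<Union>(U, \<phi>) \<in> charts M. U) = UNIV"
    using mfd unfolding smooth_manifold_def by (rule conjunct1)
  then have "x \<in> (\<Union>(U, \<phi>) \<in> charts M. U)" by simp
  then show ?thesis using that by auto
qed

lemma chart_open: "(U, \<phi>) \<in> charts M \<Longrightarrow> open U"
  and chart_image_open: "(U, \<phi>) \<in> charts M \<Longrightarrow> openin (Euclidean_space (mdim M)) (\<phi> ` U)"
  and chart_homeo: "(U, \<phi>) \<in> charts M \<Longrightarrow> homeomorphism U (\<phi> ` U) \<phi> (inv_into U \<phi>)"
  using mfd unfolding smooth_manifold_def by blast+

lemma chart_inverse: "(U, \<phi>) \<in> charts M \<Longrightarrow> x \<in> U \<Longrightarrow> inv_into U \<phi> (\<phi> x) = x"
  using chart_homeo unfolding homeomorphism_def by blast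

lemma chart_Rn: "(U, \<phi>) \<in> charts M \<Longrightarrow> x \<in> U \<Longrightarrow> \<phi> x \<in> Rn (mdim M)"
  using chart_image_open openin_Rn_subset by blast

lemma openin_chart_image:
  assumes "(U, \<phi>) \<in> charts M" "open W"
  shows "openin (Euclidean_space (mdim M)) (\<phi> ` (U \<inter> W))"
proof -
  have "openin (top_of_set U) (U \<inter> W)"
    using assms(2) by auto
  then have "openin (top_of_set (\<phi> ` U)) (\<phi> ` (U \<inter> W))"
    using homeomorphism_imp_open_map[OF chart_homeo[OF assms(1)]] by blast
  then obtain T where T: "open T" "\<phi> ` (U \<inter> W) = \<phi> ` U \<inter> T"
    unfolding openin_open by blast
  obtain T' where T': "open T'" "\<phi> ` U = T' \<inter> Rn (mdim M)"
    using chart_image_open[OF assms(1)] openin_Rn_iff by blast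
  have "\<phi> ` (U \<inter> W) = (T \<inter> T') \<inter> Rn (mdim M)"
    using T T' by blast
  moreover have "open (T \<inter> T')" using T T' by blast
  ultimately show ?thesis unfolding openin_Rn_iff by blast
qed

lemma open_chart_preimage:
  assumes "(U, \<phi>) \<in> charts M" "openin (Euclidean_space (mdim M)) V"
  shows "open {x \<in> U. \<phi> x \<in> V}"
proof -
  obtain T where T: "open T" "V = T \<inter> Rn (mdim M)"
    using assms(2) openin_Rn_iff by blast
  have "{x \<in> U. \<phi> x \<in> V} = U \<inter> \<phi> -` T"
    using T chart_Rn[OF assms(1)] by blast
  moreover have "open (U \<inter> \<phi> -` T)"
    using chart_homeo[OF assms(1)] chart_open[OF assms(1)] T(1)
    unfolding homeomorphism_def by (meson continuous_open_preimage)
  ultimately show ?thesis by simp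
qed

lemma smooth_funI_Ck:
  "(\<And>U \<phi> k. (U, \<phi>) \<in> charts M \<Longrightarrow> Ck_on (mdim M) k (\<phi> ` (U \<inter> W)) (f \<circ> inv_into U \<phi>)) \<Longrightarrow> smooth_fun M W f"
  unfolding smooth_fun_def smooth_on_def by blast

lemma smooth_fun_mono: "smooth_fun M W f \<Longrightarrow> W' \<subseteq> W \<Longrightarrow> smooth_fun M W' f"
  by (rule smooth_funI_Ck) (rule Ck_on_mono[OF smooth_funD], auto)

lemma smooth_fun_cong:
  assumes "open W" "\<And>x. x \<in> W \<Longrightarrow> f x = g x" "smooth_fun M W f"
  shows "smooth_fun M W g"
proof (rule smooth_funI_Ck)
  fix U \<phi> k assume c: "(U, \<phi>) \<in> charts M"
  show "Ck_on (mdim M) k (\<phi> ` (U \<inter> W)) (g \<circ> inv_into U \<phi>)"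
    by (rule Ck_on_cong[OF openin_chart_image[OF c assms(1)] _ smooth_funD[OF assms(3) c]])
      (auto simp: chart_inverse[OF c] assms(2))
qed

lemma smooth_fun_local:
  assumes "\<And>x. x \<in> W \<Longrightarrow> \<exists>V. open V \<and> x \<in> V \<and> smooth_fun M V f"
  shows "smooth_fun M W f"
proof (rule smooth_funI_Ck)
  fix U \<phi> k assume c: "(U, \<phi>) \<in> charts M"
  show "Ck_on (mdim M) k (\<phi> ` (U \<inter> W)) (f \<circ> inv_into U \<phi>)"
  proof (rule Ck_on_local)
    show "\<phi> ` (U \<inter> W) \<subseteq> Rn (mdim M)" using chart_Rn[OF c] by blast
    fix y assume "y \<in> \<phi> ` (U \<inter> W)"
    then obtain x where x: "x \<in> U" "x \<in> W" "y = \<phi> x" by blast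
    obtain V where V: "open V" "x \<in> V" "smooth_fun M V f" using assms[OF x(2)] by blast
    have "Ck_on (mdim M) k (\<phi> ` (U \<inter> V)) (f \<circ> inv_into U \<phi>)" using smooth_funD[OF V(3) c] .
    moreover have "openin (Euclidean_space (mdim M)) (\<phi> ` (U \<inter> V))" using openin_chart_image[OF c V(1)] .
    moreover have "y \<in> \<phi> ` (U \<inter> V)" using x V by blast
    ultimately show "\<exists>V. openin (Euclidean_space (mdim M)) V \<and> y \<in> V \<and> Ck_on (mdim M) k V (f \<circ> inv_into U \<phi>)"
      by blast
  qed
qed

lemma smooth_fun_continuous:
  assumes "open W" "smooth_fun M W f"
  shows "continuous_on W f"
proof (rule continuous_at_imp_continuous_on, rule ballI)
  fix x assume x: "x \<in> W"
  obtain U \<phi> where c: "(U, \<phi>) \<in> charts M" "x \<in> U" using chart_exists .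
  have "continuous_on (\<phi> ` (U \<inter> W)) (f \<circ> inv_into U \<phi>)"
    using smooth_funD[OF assms(2) c(1), of 0] by simp
  moreover have "continuous_on (U \<inter> W) \<phi>"
    using chart_homeo[OF c(1)] unfolding homeomorphism_def by (meson continuous_on_subset inf_le1)
  ultimately have "continuous_on (U \<inter> W) ((f \<circ> inv_into U \<phi>) \<circ> \<phi>)"
    using continuous_on_compose by blast
  then have "continuous_on (U \<inter> W) f"
    by (rule continuous_on_cong[THEN iffD1, OF refl, rotated]) (simp add: chart_inverse[OF c(1)])
  then show "isCont f x"
    using c x assms(1) chart_open[OF c(1)] continuous_on_eq_continuous_at[of "U \<inter> W" f] by blast
qed

section \<open>Algebra of smooth functions on an open set\<close>

lemma smooth_fun_const [intro]: "open W \<Longrightarrow> smooth_fun M W (\<lambda>x. c)"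
  using Ck_on_const[OF openin_chart_image] by (auto intro!: smooth_funI_Ck simp: comp_def)

lemma smooth_fun_add [intro]:
  "open W \<Longrightarrow> smooth_fun M W f \<Longrightarrow> smooth_fun M W g \<Longrightarrow> smooth_fun M W (\<lambda>x. f x + g x)"
  using Ck_on_add[OF openin_chart_image smooth_funD smooth_funD]
  by (auto intro!: smooth_funI_Ck simp: comp_def)

lemma smooth_fun_mult [intro]:
  "open W \<Longrightarrow> smooth_fun M W f \<Longrightarrow> smooth_fun M W g \<Longrightarrow> smooth_fun M W (\<lambda>x. f x * g x)"
  using Ck_on_mult[OF openin_chart_image smooth_funD smooth_funD]
  by (auto intro!: smooth_funI_Ck simp: comp_def)

lemma smooth_fun_minus [intro]: "open W \<Longrightarrow> smooth_fun M W f \<Longrightarrow> smooth_fun M W (\<lambda>x. - f x)"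
  using smooth_fun_mult[OF _ smooth_fun_const[of W "-1"]] by simp

lemma smooth_fun_diff [intro]:
  "open W \<Longrightarrow> smooth_fun M W f \<Longrightarrow> smooth_fun M W g \<Longrightarrow> smooth_fun M W (\<lambda>x. f x - g x)"
  using smooth_fun_add[OF _ _ smooth_fun_minus] by fastforce

lemma smooth_fun_inverse:
  assumes "open W" "smooth_fun M W f" "\<And>x. x \<in> W \<Longrightarrow> f x \<noteq> 0"
  shows "smooth_fun M W (\<lambda>x. inverse (f x))"
proof (rule smooth_funI_Ck)
  fix U \<phi> k assume c: "(U, \<phi>) \<in> charts M"
  have "Ck_on (mdim M) k (\<phi> ` (U \<inter> W)) (\<lambda>x. inverse ((f \<circ> inv_into U \<phi>) x))"
    using assms(3) chart_inverse[OF c]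
    by (intro Ck_on_inverse[OF openin_chart_image[OF c assms(1)] smooth_funD[OF assms(2) c]]) auto
  then show "Ck_on (mdim M) k (\<phi> ` (U \<inter> W)) ((\<lambda>x. inverse (f x)) \<circ> inv_into U \<phi>)"
    by (simp add: comp_def)
qed

lemma smooth_fun_flat: "open W \<Longrightarrow> smooth_fun M W f \<Longrightarrow> smooth_fun M W (\<lambda>x. flat j (f x))"
  using Ck_on_flat[OF openin_chart_image smooth_funD]
  by (auto intro!: smooth_funI_Ck simp: comp_def)

lemma smooth_fun_sum:
  "open W \<Longrightarrow> (\<And>i. i \<in> I \<Longrightarrow> smooth_fun M W (f i)) \<Longrightarrow> smooth_fun M W (\<lambda>x. \<Sum>i\<in>I. f i x)"
  by (induction I rule: infinite_finite_induct) auto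

lemma smooth_fun_prod:
  "open W \<Longrightarrow> (\<And>i. i \<in> I \<Longrightarrow> smooth_fun M W (f i)) \<Longrightarrow> smooth_fun M W (\<lambda>x. \<Prod>i\<in>I. f i x)"
  by (induction I rule: infinite_finite_induct) auto

lemma smooth_fun_chart:
  assumes "(U, \<phi>) \<in> charts M" "i < mdim M"
  shows "smooth_fun M U (\<lambda>x. \<phi> x i)"
proof (rule smooth_funI_Ck)
  fix V \<psi> k assume c: "(V, \<psi>) \<in> charts M"
  have "smooth_on (mdim M) (\<psi> ` (V \<inter> U)) (\<lambda>y. \<phi> (inv_into V \<psi> y) i)"
    using mfd assms c unfolding smooth_manifold_def by blast
  then show "Ck_on (mdim M) k (\<psi> ` (V \<inter> U)) ((\<lambda>x. \<phi> x i) \<circ> inv_into V \<psi>)"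
    by (simp add: smooth_on_def comp_def)
qed

text \<open>\<open>smooth_fun\<close> quantifies over all charts. One chart suffices, because the
  transition maps are smooth and \<open>Ck_on_compose\<close> carries the coordinate expression F to
  any other chart.\<close>

lemma smooth_fun_of_chart:
  assumes c: "(U, \<phi>) \<in> charts M" and W: "open W" "W \<subseteq> U"
    and f: "\<And>k. Ck_on (mdim M) k (\<phi> ` W) F" and eq: "\<And>x. x \<in> W \<Longrightarrow> f x = F (\<phi> x)"
  shows "smooth_fun M W f"
proof (rule smooth_funI_Ck)
  fix V \<psi> k assume d: "(V, \<psi>) \<in> charts M"
  have "Ck_on (mdim M) k (\<psi> ` (V \<inter> W)) (\<lambda>y. F (\<phi> (inv_into V \<psi> y)))"
  proof (rule Ck_on_compose[OF openin_chart_image[OF d W(1)] _ f])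
    have "U \<inter> W = W" using W by blast
    then show "openin (Euclidean_space (mdim M)) (\<phi> ` W)"
      using openin_chart_image[OF c W(1)] by simp
    show "Ck_on (mdim M) k (\<psi> ` (V \<inter> W)) (\<lambda>y. \<phi> (inv_into V \<psi> y) i)" if "i < mdim M" for i
      using smooth_funD[OF smooth_fun_mono[OF smooth_fun_chart[OF c that] W(2)] d, of k]
      by (simp add: comp_def)
  qed (auto simp: chart_inverse[OF d])
  then show "Ck_on (mdim M) k (\<psi> ` (V \<inter> W)) (f \<circ> inv_into V \<psi>)"
    by (rule Ck_on_cong[OF openin_chart_image[OF d W(1)], rotated])
      (auto simp: chart_inverse[OF d] eq)
qed

lemma smooth_fun_partial:
  assumes c: "(U, \<phi>) \<in> charts M" and W: "open W" "W \<subseteq> U" and f: "smooth_fun M W f" and i: "i < mdim M"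
  shows "smooth_fun M W (\<lambda>x. partial i (f \<circ> inv_into U \<phi>) (\<phi> x))"
proof (rule smooth_fun_of_chart[OF c W])
  fix k
  have "U \<inter> W = W" using W by blast
  then show "Ck_on (mdim M) k (\<phi> ` W) (partial i (f \<circ> inv_into U \<phi>))"
    using Ck_on_partial[OF smooth_funD[OF f c] i] by simp
qed simp

subsection \<open>Bump functions\<close>

text \<open>Besides the plateau V, a closed set C inside W outside of which \<eta> vanishes is
  delivered. This is what the extension by 0 of objects defined on W needs: W and the complement of
  C form an open cover of M.\<close>

lemma bump_exists:
  assumes "open W" "p \<in> W"
  obtains \<eta> V C where "smooth_fun M UNIV \<eta>" "open V" "p \<in> V" "V \<subseteq> W" "\<And>x. x \<in> V \<Longrightarrow> \<eta> x = 1"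
    "closed C" "C \<subseteq> W" "\<And>x. x \<notin> C \<Longrightarrow> \<eta> x = 0"
proof -
  obtain U \<phi> where c: "(U, \<phi>) \<in> charts M" and pU: "p \<in> U" using chart_exists .
  let ?n = "mdim M"
  define a where "a = \<phi> p"
  obtain d where d: "d > 0" "rbox ?n a d \<subseteq> \<phi> ` (U \<inter> W)"
    using openin_Rn_rbox[OF openin_chart_image[OF c assms(1)]] pU assms(2) unfolding a_def by blast
  \<comment> \<open>With a third of d, the closed cube of half-width 2 \<delta> that supports \<eta>
    still lies in the open cube of half-width d.\<close>
  define \<delta> where "\<delta> = d / 3"
  have \<delta>: "\<delta> > 0" using d unfolding \<delta>_def by simp
  \<comment> \<open>A smooth step, equal to 1 up to t = 1 and to 0 from t = 2 on. The denominator is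
    positive because 2 - t and t - 1 are never both nonpositive.\<close>
  define g where "g t = flat 0 (2 - t) * inverse (flat 0 (2 - t) + flat 0 (t - 1))" for t :: real
  have pos: "flat 0 (2 - t) + flat 0 (t - 1) > 0" for t
    using flat_pos[of "2 - t" 0] flat_pos[of "t - 1" 0] flat_nonneg[of 0 "2 - t"] flat_nonneg[of 0 "t - 1"]
    by (cases "t < 2") (auto simp: add_pos_nonneg add_nonneg_pos)
  have g1: "g t = 1" if "t \<le> 1" for t
    using that flat_pos[of "2 - t" 0] unfolding g_def by (simp add: flat_zero)
  have g0: "g t = 0" if "t \<ge> 2" for t
    using that unfolding g_def by (simp add: flat_zero)
  \<comment> \<open>Squares in place of absolute values keep the arguments of g smooth.\<close>
  define \<eta> where "\<eta> x = (if x \<in> U then \<Prod>i<?n. g (inverse (\<delta> * \<delta>) * (\<phi> x i - a i) * (\<phi> x i - a i)) else 0)" for x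
  have sq: "inverse (\<delta> * \<delta>) * (\<phi> x i - a i) * (\<phi> x i - a i) = ((\<phi> x i - a i) / \<delta>)\<^sup>2" for x i
    by (simp add: power2_eq_square divide_inverse)
  define V where "V = {x \<in> U. \<phi> x \<in> rbox ?n a \<delta>}"
  \<comment> \<open>Written as a product over all indices, with the factor {0} from n on, so that
    compactness of products applies.\<close>
  define B where "B = {y. \<forall>i. y i \<in> (if i < ?n then {a i - 2 * \<delta> .. a i + 2 * \<delta>} else {0})}"
  define C where "C = inv_into U \<phi> ` B"
  have B: "B \<subseteq> \<phi> ` (U \<inter> W)"
  proof
    fix y assume y: "y \<in> B"
    have "y \<in> Rn ?n"
      unfolding Rn_iff
    proof (intro allI impI)
      fix i assume "?n \<le> i"
      moreover have "y i \<in> (if i < ?n then {a i - 2 * \<delta> .. a i + 2 * \<delta>} else {0})"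
        using y unfolding B_def by blast
      ultimately show "y i = 0" by simp
    qed
    moreover have "\<bar>y i - a i\<bar> < d" if "i < ?n" for i
    proof -
      have "y i \<in> (if i < ?n then {a i - 2 * \<delta> .. a i + 2 * \<delta>} else {0})"
        using y unfolding B_def by blast
      then show ?thesis using that \<delta> unfolding \<delta>_def by auto
    qed
    ultimately show "y \<in> \<phi> ` (U \<inter> W)" using d unfolding rbox_def by blast
  qed
  have CW: "C \<subseteq> U \<inter> W"
    unfolding C_def using B chart_inverse[OF c] by auto
  have "compactin (product_topology (\<lambda>i. euclidean) UNIV) (Pi\<^sub>E UNIV (\<lambda>i. if i < ?n then {a i - 2 * \<delta> .. a i + 2 * \<delta>} else {0}))"
    by (subst compactin_PiE) auto
  moreover have "Pi\<^sub>E UNIV (\<lambda>i. if i < ?n then {a i - 2 * \<delta> .. a i + 2 * \<delta>} else {0}) = B"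
    unfolding B_def by (auto simp: PiE_def Pi_def)
  ultimately have "compact B"
    by (simp add: euclidean_product_topology)
  moreover have "continuous_on B (inv_into U \<phi>)"
    using chart_homeo[OF c] B unfolding homeomorphism_def by (meson continuous_on_subset image_mono inf_le1 subset_trans)
  \<comment> \<open>Here the Hausdorff property of M enters: C is compact, hence closed in M and not
    merely in U.\<close>
  ultimately have "closed C"
    unfolding C_def by (intro compact_imp_closed compact_continuous_image)
  have \<eta>0: "\<eta> x = 0" if x: "x \<notin> C" for x
  proof (cases "x \<in> U")
    case True
    have "\<phi> x \<notin> B" using x chart_inverse[OF c True] unfolding C_def by force
    then obtain i where i: "\<phi> x i \<notin> (if i < ?n then {a i - 2 * \<delta> .. a i + 2 * \<delta>} else {0})"
      unfolding B_def by blast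
    have iN: "i < ?n"
    proof (rule ccontr)
      assume "\<not> i < ?n"
      then show False using i chart_Rn[OF c True] unfolding Rn_iff by auto
    qed
    then have "\<bar>\<phi> x i - a i\<bar> > 2 * \<delta>" using i by (auto simp: abs_if)
    then have "\<bar>(\<phi> x i - a i) / \<delta>\<bar> \<ge> 2" using \<delta> by (simp add: field_simps)
    then have "((\<phi> x i - a i) / \<delta>)\<^sup>2 \<ge> 2"
      using order_trans[of 2 "2 ^ 2" "((\<phi> x i - a i) / \<delta>) ^ 2"] abs_le_square_iff[of 2 "(\<phi> x i - a i) / \<delta>"] by simp
    then have "g (inverse (\<delta> * \<delta>) * (\<phi> x i - a i) * (\<phi> x i - a i)) = 0"
      unfolding sq by (rule g0)
    then show ?thesis
      unfolding \<eta>_def using iN by (auto intro!: prod_zero)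
  qed (simp add: \<eta>_def)
  have sm: "smooth_fun M UNIV \<eta>"
  proof (rule smooth_fun_local)
    fix x :: 'm
    show "\<exists>V. open V \<and> x \<in> V \<and> smooth_fun M V \<eta>"
    proof (cases "x \<in> U")
      case True
      note oU = chart_open[OF c]
      have "smooth_fun M U (\<lambda>x. inverse (\<delta> * \<delta>) * (\<phi> x i - a i) * (\<phi> x i - a i))" if "i < ?n" for i
        by (intro smooth_fun_mult smooth_fun_diff smooth_fun_const smooth_fun_chart[OF c that] oU)
      moreover have "smooth_fun M U (\<lambda>x. g (h x))" if "smooth_fun M U h" for h
        unfolding g_def
        by (intro smooth_fun_mult smooth_fun_flat smooth_fun_inverse smooth_fun_add smooth_fun_diff
            smooth_fun_const oU that less_imp_neq[OF pos, THEN not_sym])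
      ultimately have "smooth_fun M U (\<lambda>x. g (inverse (\<delta> * \<delta>) * (\<phi> x i - a i) * (\<phi> x i - a i)))" if "i < ?n" for i
        using that by blast
      then have "smooth_fun M U (\<lambda>x. \<Prod>i<?n. g (inverse (\<delta> * \<delta>) * (\<phi> x i - a i) * (\<phi> x i - a i)))"
        by (intro smooth_fun_prod oU) auto
      then have "smooth_fun M U \<eta>"
        by (rule smooth_fun_cong[OF oU, rotated]) (simp add: \<eta>_def)
      then show ?thesis using True oU by blast
    next
      case False
      have "smooth_fun M (- C) \<eta>"
        by (rule smooth_fun_cong[of _ "\<lambda>_. 0"]) (use \<open>closed C\<close> \<eta>0 in auto)
      then show ?thesis using False CW \<open>closed C\<close> by (intro exI[of _ "- C"]) auto
    qed
  qed
  have "V \<subseteq> W"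
  proof
    fix x assume x: "x \<in> V"
    then have xU: "x \<in> U" unfolding V_def by blast
    have "\<phi> x \<in> \<phi> ` (U \<inter> W)" using x d rbox_mono[of \<delta> d ?n a] unfolding V_def \<delta>_def by auto
    then obtain x' where x': "x' \<in> U" "x' \<in> W" "\<phi> x = \<phi> x'" by blast
    then have "x = x'" using chart_inverse[OF c] xU by metis
    then show "x \<in> W" using x' by simp
  qed
  moreover have "\<eta> x = 1" if "x \<in> V" for x
  proof -
    have "g (inverse (\<delta> * \<delta>) * (\<phi> x i - a i) * (\<phi> x i - a i)) = 1" if "i < ?n" for i
    proof -
      have "\<bar>\<phi> x i - a i\<bar> < \<delta>" using \<open>x \<in> V\<close> that unfolding V_def rbox_def by blast
      then have "\<bar>(\<phi> x i - a i) / \<delta>\<bar> \<le> 1" using \<delta> by (simp add: field_simps)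
      then have "((\<phi> x i - a i) / \<delta>)\<^sup>2 \<le> 1" by (simp add: abs_square_le_1)
      then show ?thesis unfolding sq by (rule g1)
    qed
    then show ?thesis using that unfolding V_def \<eta>_def by simp
  qed
  moreover have "open V" unfolding V_def using open_chart_preimage[OF c openin_rbox] .
  moreover have "p \<in> V"
    unfolding V_def using pU centre_in_rbox[OF chart_Rn[OF c pU] \<delta>] by (simp add: a_def)
  ultimately show ?thesis
    using that[OF sm, of V C] \<open>closed C\<close> CW \<eta>0 by blast
qed

text \<open>On W this is a product of smooth functions, off C it is 0, and these two open sets cover
  M.\<close>

lemma smooth_fun_extend:
  assumes \<eta>: "smooth_fun M UNIV \<eta>" and C: "closed C" "C \<subseteq> W" "\<And>x. x \<notin> C \<Longrightarrow> \<eta> x = 0"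
    and W: "open W" and f: "smooth_fun M W f"
  shows "smooth_fun M UNIV (\<lambda>x. \<eta> x * f x)"
proof (rule smooth_fun_local)
  fix x :: 'm
  show "\<exists>V. open V \<and> x \<in> V \<and> smooth_fun M V (\<lambda>x. \<eta> x * f x)"
  proof (cases "x \<in> W")
    case True
    then show ?thesis
      using W smooth_fun_mult[OF W smooth_fun_mono[OF \<eta>] f] by blast
  next
    case False
    have "smooth_fun M (- C) (\<lambda>x. \<eta> x * f x)"
      by (rule smooth_fun_cong[of _ "\<lambda>_. 0"]) (use C in auto)
    then show ?thesis using False C by (intro exI[of _ "- C"]) auto
  qed
qed

end

hide_const (open) Matrix.unit_vec

section \<open>Bases of finite-dimensional spaces\<close>

lemma linear_on_set_0: "subspace V \<Longrightarrow> linear_on_set V h \<Longrightarrow> h 0 = 0"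
  unfolding linear_on_set_def by (metis scaleR_zero_left subspace_0)

lemma linear_on_set_add: "linear_on_set V h \<Longrightarrow> u \<in> V \<Longrightarrow> v \<in> V \<Longrightarrow> h (u + v) = h u + h v"
  and linear_on_set_scale: "linear_on_set V h \<Longrightarrow> v \<in> V \<Longrightarrow> h (c *\<^sub>R v) = c *\<^sub>R h v"
  unfolding linear_on_set_def by blast+

lemma linear_on_set_diff:
  assumes "subspace V" "linear_on_set V h" "u \<in> V" "v \<in> V"
  shows "h (u - v) = h u - h v"
proof -
  have "h (u + (-1) *\<^sub>R v) = h u + (-1) *\<^sub>R h v"
    using assms by (simp only: linear_on_set_add linear_on_set_scale subspace_scale)
  then show ?thesis by simp
qed

lemma linear_on_set_sum:
  assumes "subspace V" "linear_on_set V h" "\<And>i. i \<in> I \<Longrightarrow> u i \<in> V"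
  shows "h (\<Sum>i\<in>I. u i) = (\<Sum>i\<in>I. h (u i))"
  using assms(3)
proof (induction I rule: infinite_finite_induct)
  case (insert i I)
  then have "(\<Sum>i\<in>I. u i) \<in> V"
    by (intro subspace_sum assms(1)) auto
  then show ?case using insert linear_on_set_add[OF assms(2)] by simp
qed (use linear_on_set_0[OF assms(1,2)] in simp_all)

lemma sum_fun_apply: "(\<Sum>i\<in>I. f i) x = (\<Sum>i\<in>I. f i x)"
  by (induction I rule: infinite_finite_induct) auto

lemma scaleR_fun_apply [simp]: "(c *\<^sub>R f) x = c *\<^sub>R f x"
  by (simp add: scaleR_fun_def)

lemma subspace_Rn: "subspace (Rn n)"
  unfolding subspace_def by (auto simp: Rn_iff)

lemma unit_vec_Rn: "j < n \<Longrightarrow> unit_vec j \<in> Rn n"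
  unfolding Rn_iff Defs.unit_vec_def by auto

definition lincomb :: "nat \<Rightarrow> (nat \<Rightarrow> 'v::real_vector) \<Rightarrow> (nat \<Rightarrow> real) \<Rightarrow> 'v" where
  "lincomb r b v = (\<Sum>j<r. v j *\<^sub>R b j)"

text \<open>An indexed notion of basis: the indices match those of matrices, and the defining
  isomorphism from \<open>Rn r\<close> is of the same kind as a trivialisation at a point.\<close>

definition is_basis :: "nat \<Rightarrow> (nat \<Rightarrow> 'v::real_vector) \<Rightarrow> 'v set \<Rightarrow> bool" where
  "is_basis r b V \<longleftrightarrow> linear_iso (lincomb r b) (Rn r) V"

text \<open>The same \<open>inv_into\<close> as in \<open>smooth_coords\<close>, so that smoothness
  conditions can be restated for the frame of a trivialisation.\<close>

definition coords :: "nat \<Rightarrow> (nat \<Rightarrow> 'v::real_vector) \<Rightarrow> 'v \<Rightarrow> nat \<Rightarrow> real" where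
  "coords r b = inv_into (Rn r) (lincomb r b)"

lemma lincomb_cong: "(\<And>j. j < r \<Longrightarrow> b j = b' j) \<Longrightarrow> (\<And>j. j < r \<Longrightarrow> v j = v' j) \<Longrightarrow> lincomb r b v = lincomb r b' v'"
  unfolding lincomb_def by (intro sum.cong) auto

lemma lincomb_add: "lincomb r b (u + v) = lincomb r b u + lincomb r b v"
  unfolding lincomb_def by (simp add: scaleR_add_left sum.distrib)

lemma lincomb_scale: "lincomb r b (c *\<^sub>R v) = c *\<^sub>R lincomb r b v"
  unfolding lincomb_def by (simp add: scaleR_sum_right)

lemma lincomb_0: "lincomb r b 0 = 0"
  unfolding lincomb_def by simp

lemma lincomb_unit_vec: "j < r \<Longrightarrow> lincomb r b (unit_vec j) = b j"
  unfolding lincomb_def Defs.unit_vec_def by (simp add: if_distrib[of "\<lambda>c. c *\<^sub>R _"] sum.delta cong: if_cong)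

lemma linear_on_set_lincomb: "linear_on_set V (lincomb r b)"
  unfolding linear_on_set_def using lincomb_add lincomb_scale by blast

lemma lincomb_in: "subspace V \<Longrightarrow> (\<And>j. j < r \<Longrightarrow> b j \<in> V) \<Longrightarrow> lincomb r b v \<in> V"
  unfolding lincomb_def by (intro subspace_sum subspace_scale) auto

lemma Rn_lincomb: "v \<in> Rn n \<Longrightarrow> lincomb n unit_vec v = v"
  unfolding lincomb_def Rn_iff
  by (rule ext) (auto simp: sum_fun_apply Defs.unit_vec_def if_distrib[of "(*) _"] sum.delta' cong: if_cong)

lemma linear_on_set_lincomb_comp:
  assumes "subspace V" "linear_on_set V h" "\<And>j. j < r \<Longrightarrow> b j \<in> V"
  shows "h (lincomb r b v) = lincomb r (\<lambda>j. h (b j)) v"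
  unfolding lincomb_def
  using assms by (subst linear_on_set_sum) (auto intro: subspace_scale simp: linear_on_set_scale)

lemma linear_iso_lincomb:
  assumes "linear_iso \<Phi> (Rn r) V" "v \<in> Rn r"
  shows "\<Phi> v = lincomb r (\<lambda>j. \<Phi> (unit_vec j)) v"
  using linear_on_set_lincomb_comp[of "Rn r" \<Phi> r unit_vec v] assms Rn_lincomb[OF assms(2)]
  unfolding linear_iso_def by (simp add: subspace_Rn unit_vec_Rn)

lemma linear_iso_cong:
  "(\<And>v. v \<in> V \<Longrightarrow> h v = h' v) \<Longrightarrow> subspace V \<Longrightarrow> linear_iso h V W \<longleftrightarrow> linear_iso h' V W"
  unfolding linear_iso_def linear_on_set_def
  using bij_betw_cong[of V h h'] by (simp add: subspace_add subspace_scale)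

lemma is_basis_of_linear_iso:
  assumes "linear_iso \<Phi> (Rn r) V"
  shows "is_basis r (\<lambda>j. \<Phi> (unit_vec j)) V"
  unfolding is_basis_def
  using assms linear_iso_lincomb[OF assms] by (subst linear_iso_cong[OF _ subspace_Rn, symmetric]) auto

text \<open>Valid for every u, even outside V: \<Phi> and \<open>lincomb\<close> agree on
  \<open>Rn r\<close>, so \<open>inv_into\<close> chooses by the same predicate on both
  sides.\<close>

lemma coords_of_linear_iso:
  assumes "linear_iso \<Phi> (Rn r) V"
  shows "inv_into (Rn r) \<Phi> u = coords r (\<lambda>j. \<Phi> (unit_vec j)) u"
  unfolding coords_def inv_into_def using linear_iso_lincomb[OF assms]
  by (intro arg_cong[of _ _ Eps] ext) auto

lemma is_basis_cong: "(\<And>j. j < r \<Longrightarrow> b j = b' j) \<Longrightarrow> is_basis r b V \<longleftrightarrow> is_basis r b' V"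
  unfolding is_basis_def by (intro linear_iso_cong[OF lincomb_cong subspace_Rn]) auto

lemma is_basisI:
  assumes "subspace V" "\<And>j. j < r \<Longrightarrow> b j \<in> V"
    and "\<And>v. v \<in> Rn r \<Longrightarrow> lincomb r b v = 0 \<Longrightarrow> v = 0"
    and "\<And>u. u \<in> V \<Longrightarrow> \<exists>v. v \<in> Rn r \<and> u = lincomb r b v"
  shows "is_basis r b V"
  unfolding is_basis_def linear_iso_def bij_betw_def
proof (intro conjI linear_on_set_lincomb inj_onI)
  fix u v assume uv: "u \<in> Rn r" "v \<in> Rn r" "lincomb r b u = lincomb r b v"
  then have "lincomb r b (u - v) = 0"
    using linear_on_set_diff[OF subspace_Rn linear_on_set_lincomb uv(1,2), of r b] by simp
  then show "u = v" using assms(3)[of "u - v"] subspace_diff[OF subspace_Rn uv(1,2)] by simp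
next
  show "lincomb r b ` Rn r = V"
  proof (intro subset_antisym subsetI)
    show "u \<in> V" if "u \<in> lincomb r b ` Rn r" for u
      using that lincomb_in[OF assms(1,2)] by (elim imageE) simp
    show "u \<in> lincomb r b ` Rn r" if "u \<in> V" for u
      using assms(4)[OF that] by (elim exE conjE) simp
  qed
qed

lemma is_basis_mem: "is_basis r b V \<Longrightarrow> j < r \<Longrightarrow> b j \<in> V"
  unfolding is_basis_def linear_iso_def bij_betw_def
  using lincomb_unit_vec[of j r b] unit_vec_Rn[of j r] by (metis imageI)

lemma is_basis_lincomb_in: "is_basis r b V \<Longrightarrow> lincomb r b v \<in> V"
proof -
  assume b: "is_basis r b V"
  have "(\<lambda>j. if j < r then v j else 0) \<in> Rn r" unfolding Rn_iff by simp
  then have "lincomb r b (\<lambda>j. if j < r then v j else 0) \<in> V"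
    using b unfolding is_basis_def linear_iso_def bij_betw_def by blast
  then show ?thesis using lincomb_cong[of r b b v "\<lambda>j. if j < r then v j else 0"] by simp
qed

lemma lincomb_coords: "is_basis r b V \<Longrightarrow> u \<in> V \<Longrightarrow> lincomb r b (coords r b u) = u"
  unfolding is_basis_def linear_iso_def coords_def bij_betw_def by (metis f_inv_into_f)

lemma coords_Rn: "is_basis r b V \<Longrightarrow> u \<in> V \<Longrightarrow> coords r b u \<in> Rn r"
  unfolding is_basis_def linear_iso_def coords_def bij_betw_def by (metis inv_into_into)

lemma coords_lincomb: "is_basis r b V \<Longrightarrow> v \<in> Rn r \<Longrightarrow> coords r b (lincomb r b v) = v"
  unfolding is_basis_def linear_iso_def coords_def bij_betw_def by (metis inv_into_f_f)

lemma coords_lincomb_nth: "is_basis r b V \<Longrightarrow> j < r \<Longrightarrow> coords r b (lincomb r b v) j = v j"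
proof -
  assume b: "is_basis r b V" "j < r"
  have "lincomb r b v = lincomb r b (\<lambda>j. if j < r then v j else 0)"
    by (rule lincomb_cong) auto
  then show ?thesis using b coords_lincomb[of r b V "\<lambda>j. if j < r then v j else 0"]
    by (simp add: Rn_iff)
qed

lemma is_basis_subspace: "is_basis r b V \<Longrightarrow> subspace V"
proof -
  assume b: "is_basis r b V"
  show ?thesis unfolding subspace_def
  proof (intro conjI ballI allI)
    show "0 \<in> V" using is_basis_lincomb_in[OF b, of 0] by (simp add: lincomb_0)
    show "u + v \<in> V" if "u \<in> V" "v \<in> V" for u v
      using that lincomb_coords[OF b] is_basis_lincomb_in[OF b] lincomb_add by metis
    show "c *\<^sub>R u \<in> V" if "u \<in> V" for c u
      using that lincomb_coords[OF b] is_basis_lincomb_in[OF b] lincomb_scale by metis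
  qed
qed

lemma is_basis_eq_0: "is_basis r b V \<Longrightarrow> lincomb r b v = 0 \<Longrightarrow> j < r \<Longrightarrow> v j = 0"
  using coords_lincomb_nth[of r b V j v] coords_lincomb_nth[of r b V j 0] by (simp add: lincomb_0)

lemma linear_on_set_coords:
  assumes b: "is_basis r b V"
  shows "linear_on_set V (coords r b)"
  unfolding linear_on_set_def
proof (intro conjI ballI allI)
  show "coords r b (u + v) = coords r b u + coords r b v" if "u \<in> V" "v \<in> V" for u v
    using coords_lincomb[OF b, of "coords r b u + coords r b v"] lincomb_add[of r b]
      lincomb_coords[OF b] coords_Rn[OF b] subspace_add[OF subspace_Rn] that by metis
  show "coords r b (c *\<^sub>R u) = c *\<^sub>R coords r b u" if "u \<in> V" for c u
    using coords_lincomb[OF b, of "c *\<^sub>R coords r b u"] lincomb_scale[of r b]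
      lincomb_coords[OF b] coords_Rn[OF b] subspace_scale[OF subspace_Rn] that by metis
qed

text \<open>The link to the library's \<open>dim\<close>. It shows that two bases of a fibre have
  the same length, which makes transition matrices square.\<close>

lemma is_basis_dim:
  assumes b: "is_basis r b V"
  shows "r = dim V"
proof -
  have inj: "inj_on b {..<r}"
  proof (rule inj_onI)
    fix i j assume ij: "i \<in> {..<r}" "j \<in> {..<r}" "b i = b j"
    then have "unit_vec i = unit_vec j"
      using coords_lincomb[OF b unit_vec_Rn] by (metis lessThan_iff lincomb_unit_vec)
    then show "i = j" unfolding Defs.unit_vec_def by (metis zero_neq_one)
  qed
  have "independent (b ` {..<r})"
    unfolding dependent_finite[OF finite_imageI[OF finite_lessThan]]
  proof (rule notI, elim exE conjE bexE imageE)
    fix u v j assume u: "(\<Sum>v\<in>b ` {..<r}. u v *\<^sub>R v) = 0" and j: "u v \<noteq> 0" "v = b j" "j \<in> {..<r}"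
    have "lincomb r b (u \<circ> b) = 0"
      using u inj by (simp add: sum.reindex lincomb_def)
    then show False using is_basis_eq_0[OF b, of "u \<circ> b" j] j by simp
  qed
  moreover have "span (b ` {..<r}) = V"
  proof
    show "span (b ` {..<r}) \<subseteq> V"
      using is_basis_mem[OF b] is_basis_subspace[OF b] by (intro span_minimal) auto
    show "V \<subseteq> span (b ` {..<r})"
    proof
      fix u assume "u \<in> V"
      then have "u = lincomb r b (coords r b u)" using lincomb_coords[OF b] by simp
      also have "\<dots> \<in> span (b ` {..<r})"
        by (intro lincomb_in subspace_span span_base) auto
      finally show "u \<in> span (b ` {..<r})" .
    qed
  qed
  ultimately have "dim V = card (b ` {..<r})"
    by (metis dim_eq_card_independent dim_span)
  then show ?thesis using inj by (simp add: card_image)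
qed

text \<open>A maximal independent subset of K is finite because V is spanned by r vectors;
  enumerating it gives the basis.\<close>

lemma is_basis_exists:
  assumes b: "is_basis r b V" and K: "subspace K" "K \<subseteq> V"
  obtains m c where "is_basis m c K"
proof -
  obtain B where B: "B \<subseteq> K" "independent B" "K \<subseteq> span B"
    using maximal_independent_subset[of K] by blast
  have "V \<subseteq> span (b ` {..<r})"
  proof
    fix u assume "u \<in> V"
    then have "u = lincomb r b (coords r b u)" using lincomb_coords[OF b] by simp
    also have "\<dots> \<in> span (b ` {..<r})"
      by (intro lincomb_in subspace_span span_base) auto
    finally show "u \<in> span (b ` {..<r})" .
  qed
  then have fin: "finite B"
    using independent_span_bound[of "b ` {..<r}" B] B K by auto
  obtain c where c: "bij_betw c {0..<card B} B"
    using ex_bij_betw_nat_finite[OF fin] by blast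
  have c': "inj_on c {..<card B}" "c ` {..<card B} = B"
    using c by (auto simp: bij_betw_def atLeast0LessThan)
  have sum: "(\<Sum>v\<in>B. u v *\<^sub>R v) = lincomb (card B) c (\<lambda>j. u (c j))" for u
    using sum.reindex[OF c'(1), of "\<lambda>v. u v *\<^sub>R v"] c'(2) by (simp add: lincomb_def)
  have "is_basis (card B) c K"
  proof (rule is_basisI[OF K(1)])
    show "c j \<in> K" if "j < card B" for j using that c'(2) B(1) by blast
    show "v = 0" if v: "v \<in> Rn (card B)" "lincomb (card B) c v = 0" for v
    proof
      fix j
      show "v j = 0 j"
      proof (cases "j < card B")
        case True
        define u where "u = v \<circ> inv_into {..<card B} c"
        have u: "u (c j) = v j" if "j < card B" for j
          using c'(1) that unfolding u_def by simp
        have "(\<Sum>v\<in>B. u v *\<^sub>R v) = 0"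
          unfolding sum using lincomb_cong[of "card B" c c "\<lambda>j. u (c j)" v] u v(2) by simp
        then have "u (c j) = 0"
          using B(2) fin c'(2) True unfolding dependent_finite[OF fin] by blast
        then show ?thesis using u[OF True] by simp
      qed (use v(1) in \<open>simp add: Rn_iff\<close>)
    qed
    show "\<exists>v. v \<in> Rn (card B) \<and> u = lincomb (card B) c v" if "u \<in> K" for u
    proof -
      have "u \<in> span B" using B(3) that by blast
      then obtain w where w: "u = (\<Sum>v\<in>B. w v *\<^sub>R v)"
        using span_finite[OF fin] by auto
      have "u = lincomb (card B) c (\<lambda>j. if j < card B then w (c j) else 0)"
        unfolding w sum by (rule lincomb_cong) auto
      moreover have "(\<lambda>j. if j < card B then w (c j) else 0) \<in> Rn (card B)"
        unfolding Rn_iff by simp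
      ultimately show ?thesis by blast
    qed
  qed
  then show ?thesis using that by blast
qed

section \<open>Completing a basis of the kernel by lifts\<close>

definition append_frame :: "nat \<Rightarrow> (nat \<Rightarrow> 'v) \<Rightarrow> (nat \<Rightarrow> 'v) \<Rightarrow> nat \<Rightarrow> 'v" where
  "append_frame n a c = (\<lambda>j. if j < n then a j else c (j - n))"

lemma lincomb_append:
  "lincomb (n + m) (append_frame n a c) v = lincomb n a v + lincomb m c (\<lambda>j. v (n + j))"
proof (induction m)
  case 0
  show ?case unfolding lincomb_def append_frame_def by simp
next
  case (Suc m)
  have "lincomb (n + Suc m) (append_frame n a c) v
      = lincomb (n + m) (append_frame n a c) v + v (n + m) *\<^sub>R c m"
    by (simp add: lincomb_def append_frame_def)
  then show ?case using Suc by (simp add: lincomb_def)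
qed

text \<open>The vectors \<open>a i\<close> lift a basis of T, so V is the direct sum of their span
  and the kernel of R; applying R reads off the coefficients of the lifts. The equivalence moves the
  question whether e is a frame of the kernel to the ambient bundle and back, and the second claim
  does the same for coefficients.\<close>

lemma is_basis_append_kernel:
  assumes V: "subspace V" and R: "linear_on_set V R" "R ` V \<subseteq> T" and t: "is_basis n t T"
    and a: "\<And>i. i < n \<Longrightarrow> a i \<in> V" "\<And>i. i < n \<Longrightarrow> R (a i) = t i"
    and e: "\<And>j. j < m \<Longrightarrow> e j \<in> V" "\<And>j. j < m \<Longrightarrow> R (e j) = 0"
  shows "is_basis (n + m) (append_frame n a e) V \<longleftrightarrow> is_basis m e {v \<in> V. R v = 0}"
    and "is_basis m e {v \<in> V. R v = 0} \<Longrightarrow> u \<in> V \<Longrightarrow> R u = 0 \<Longrightarrow> j < m \<Longrightarrow>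
      coords (n + m) (append_frame n a e) u (n + j) = coords m e u j"
proof -
  let ?K = "{v \<in> V. R v = 0}"
  let ?f = "append_frame n a e"
  have K: "subspace ?K"
    unfolding subspace_def using V R(1) linear_on_set_0[OF V R(1)]
    by (auto simp: subspace_0 subspace_add subspace_scale linear_on_set_add linear_on_set_scale)
  have f: "?f j \<in> V" if "j < n + m" for j
    using that a e unfolding append_frame_def by auto
  have aV: "lincomb n a v \<in> V" for v by (rule lincomb_in[OF V]) (rule a(1))
  have eV: "lincomb m e v \<in> V" for v by (rule lincomb_in[OF V]) (rule e(1))
  have Ra: "R (lincomb n a v) = lincomb n t v" for v
    using linear_on_set_lincomb_comp[OF V R(1) a(1)] lincomb_cong[of n "\<lambda>j. R (a j)" t v v] a(2) by simp
  have eK: "R (lincomb m e v) = 0" for v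
    using lincomb_in[OF K, of m e v] e by simp
  have Rf: "R (lincomb (n + m) ?f v) = lincomb n t v" for v
    unfolding lincomb_append using linear_on_set_add[OF R(1) aV eV] Ra eK by simp
  show main: "is_basis (n + m) ?f V \<longleftrightarrow> is_basis m e ?K"
  proof
    assume b: "is_basis (n + m) ?f V"
    show "is_basis m e ?K"
    proof (rule is_basisI[OF K])
      show "e j \<in> ?K" if "j < m" for j using e that by blast
    next
      fix v assume v: "v \<in> Rn m" "lincomb m e v = 0"
      define w where "w = (\<lambda>j. if j < n then 0 else v (j - n))"
      have "lincomb n a w = lincomb n a 0" by (rule lincomb_cong) (auto simp: w_def)
      then have "lincomb (n + m) ?f w = 0"
        unfolding lincomb_append using v(2) by (simp add: w_def lincomb_0)
      from is_basis_eq_0[OF b this] have "v j = 0" if "j < m" for j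
        using that unfolding w_def by (metis add_diff_cancel_left' nat_add_left_cancel_less not_add_less1)
      then show "v = 0" using v(1) unfolding Rn_iff by (auto simp: fun_eq_iff not_less[symmetric])
    next
      fix u assume u: "u \<in> ?K"
      define v where "v = coords (n + m) ?f u"
      have uv: "u = lincomb (n + m) ?f v" unfolding v_def using lincomb_coords[OF b] u by simp
      then have "lincomb n t v = 0" using u Rf by simp
      then have "v j = 0" if "j < n" for j using is_basis_eq_0[OF t _ that] by blast
      then have "lincomb n a v = lincomb n a 0" by (intro lincomb_cong) auto
      then have "u = lincomb m e (\<lambda>j. v (n + j))"
        using uv unfolding lincomb_append by (simp add: lincomb_0)
      moreover have "(\<lambda>j. v (n + j)) \<in> Rn m"
        using coords_Rn[OF b] u unfolding v_def Rn_iff by simp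
      ultimately show "\<exists>v. v \<in> Rn m \<and> u = lincomb m e v" by blast
    qed
  next
    assume b: "is_basis m e ?K"
    show "is_basis (n + m) ?f V"
    proof (rule is_basisI[OF V f])
      fix v assume v: "v \<in> Rn (n + m)" "lincomb (n + m) ?f v = 0"
      then have "lincomb n t v = 0" using Rf linear_on_set_0[OF V R(1)] by metis
      then have v1: "v j = 0" if "j < n" for j using is_basis_eq_0[OF t _ that] by blast
      then have "lincomb n a v = lincomb n a 0" by (intro lincomb_cong) auto
      then have "lincomb m e (\<lambda>j. v (n + j)) = 0"
        using v(2) unfolding lincomb_append by (simp add: lincomb_0)
      then have v2: "v (n + j) = 0" if "j < m" for j using is_basis_eq_0[OF b _ that] by blast
      show "v = 0"
      proof
        fix j
        consider "j < n" | "n \<le> j" "j < n + m" | "n + m \<le> j" by linarith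
        then show "v j = 0 j"
        proof cases
          case 2
          then show ?thesis using v2[of "j - n"] by simp
        qed (use v v1 in \<open>auto simp: Rn_iff\<close>)
      qed
    next
      fix u assume u: "u \<in> V"
      define w where "w = coords n t (R u)"
      have "R u \<in> T" using R(2) u by blast
      then have w: "w \<in> Rn n" "lincomb n t w = R u"
        unfolding w_def using coords_Rn[OF t] lincomb_coords[OF t] by auto
      define k where "k = u - lincomb n a w"
      have "R k = 0" unfolding k_def using linear_on_set_diff[OF V R(1) u aV] Ra w by simp
      then have k: "k \<in> ?K" unfolding k_def using subspace_diff[OF V u aV] by simp
      define v where "v = (\<lambda>j. if j < n then w j else coords m e k (j - n))"
      have "lincomb n a v = lincomb n a w" by (rule lincomb_cong) (auto simp: v_def)
      moreover have "lincomb m e (\<lambda>j. v (n + j)) = k"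
        using lincomb_coords[OF b k] by (simp add: v_def)
      ultimately have "u = lincomb (n + m) ?f v" unfolding lincomb_append by (simp add: k_def)
      moreover have "v \<in> Rn (n + m)" using coords_Rn[OF b k] unfolding v_def Rn_iff by auto
      ultimately show "\<exists>v. v \<in> Rn (n + m) \<and> u = lincomb (n + m) ?f v" by blast
    qed
  qed
  show "coords (n + m) ?f u (n + j) = coords m e u j"
    if b: "is_basis m e ?K" and u: "u \<in> V" "R u = 0" and j: "j < m"
  proof -
    define v where "v = coords (n + m) ?f u"
    have b': "is_basis (n + m) ?f V" using main b by blast
    have uv: "u = lincomb (n + m) ?f v" unfolding v_def using lincomb_coords[OF b' u(1)] by simp
    then have "lincomb n t v = 0" using u Rf by simp
    then have "v j = 0" if "j < n" for j using is_basis_eq_0[OF t _ that] by blast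
    then have "lincomb n a v = lincomb n a 0" by (intro lincomb_cong) auto
    then have "u = lincomb m e (\<lambda>j. v (n + j))"
      using uv unfolding lincomb_append by (simp add: lincomb_0)
    then show ?thesis using coords_lincomb_nth[OF b j] unfolding v_def by metis
  qed
qed

section \<open>Smooth families of invertible matrices\<close>

context smooth_mfd
begin

text \<open>By the Leibniz formula the determinant is a polynomial in the entries.\<close>

lemma smooth_fun_det:
  assumes W: "open W" and f: "\<And>i j. i < r \<Longrightarrow> j < r \<Longrightarrow> smooth_fun M W (\<lambda>x. f x i j)"
  shows "smooth_fun M W (\<lambda>x. det (mat r r (\<lambda>(i, j). f x i j)))"
proof -
  have pl: "p i < r" if "p permutes {0..<r}" "i < r" for p i
    using permutes_in_image[OF that(1), of i] that(2) by simp
  have "smooth_fun M W (\<lambda>x. \<Sum>p\<in>{p. p permutes {0..<r}}. signof p * (\<Prod>i = 0..<r. f x i (p i)))"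
    by (intro smooth_fun_sum smooth_fun_mult smooth_fun_const smooth_fun_prod W f)
      (auto simp: pl)
  moreover have "(\<Sum>p\<in>{p. p permutes {0..<r}}. signof p * (\<Prod>i = 0..<r. f x i (p i)))
      = det (mat r r (\<lambda>(i, j). f x i j))" for x
    by (subst det_def'[of _ r]) (auto intro!: sum.cong prod.cong simp: pl)
  ultimately show ?thesis by simp
qed

text \<open>Cramer's rule: the inverse is the adjugate divided by the determinant, both polynomial
  in the entries. The set W' is the part of W where the determinant does not vanish; injectivity at
  x0 puts x0 into it.\<close>

lemma smooth_matrix_inverse:
  assumes W: "open W" "x0 \<in> W" and S: "\<And>i j. i < r \<Longrightarrow> j < r \<Longrightarrow> smooth_fun M W (\<lambda>x. S x i j)"
    and inj: "\<And>v. v \<in> Rn r \<Longrightarrow> (\<And>i. i < r \<Longrightarrow> (\<Sum>j<r. S x0 i j * v j) = 0) \<Longrightarrow> v = 0"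
  obtains W' Q where "open W'" "x0 \<in> W'" "W' \<subseteq> W"
    "\<And>i j. i < r \<Longrightarrow> j < r \<Longrightarrow> smooth_fun M W' (\<lambda>x. Q x i j)"
    "\<And>x i k. x \<in> W' \<Longrightarrow> i < r \<Longrightarrow> k < r \<Longrightarrow> (\<Sum>j<r. Q x i j * S x j k) = (if i = k then 1 else 0)"
    "\<And>x i k. x \<in> W' \<Longrightarrow> i < r \<Longrightarrow> k < r \<Longrightarrow> (\<Sum>j<r. S x i j * Q x j k) = (if i = k then 1 else 0)"
proof -
  define A where "A x = mat r r (\<lambda>(i, j). S x i j)" for x
  have A: "A x \<in> carrier_mat r r" for x unfolding A_def by simp
  have sd: "smooth_fun M W (\<lambda>x. det (A x))"
    unfolding A_def by (rule smooth_fun_det[OF W(1) S])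
  have "det (A x0) \<noteq> 0"
  proof
    assume "det (A x0) = 0"
    then obtain v where v: "v \<in> carrier_vec r" "v \<noteq> 0\<^sub>v r" "A x0 *\<^sub>v v = 0\<^sub>v r"
      using det_0_iff_vec_prod_zero_field[OF A] by blast
    define w where "w = (\<lambda>i. if i < r then v $ i else 0)"
    have "w = 0"
    proof (rule inj)
      show "w \<in> Rn r" unfolding w_def Rn_iff by simp
      fix i assume i: "i < r"
      have "(A x0 *\<^sub>v v) $ i = (\<Sum>j<r. S x0 i j * w j)"
        using i v(1) unfolding A_def w_def by (auto simp: scalar_prod_def atLeast0LessThan)
      then show "(\<Sum>j<r. S x0 i j * w j) = 0" using v(3) i by simp
    qed
    have "v $ i = 0" if "i < r" for i
    proof -
      have "w i = 0" using \<open>w = 0\<close> by simp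
      then show ?thesis using that by (simp add: w_def)
    qed
    then have "v = 0\<^sub>v r" using v(1) by (intro eq_vecI) auto
    then show False using v(2) by blast
  qed
  define W' where "W' = W \<inter> (\<lambda>x. det (A x)) -` (- {0})"
  have oW': "open W'"
    unfolding W'_def using smooth_fun_continuous[OF W(1) sd] W(1) by (intro continuous_open_preimage) auto
  \<comment> \<open>The indices of the cofactor are swapped, since the adjugate is the transposed
    cofactor matrix.\<close>
  define Q where "Q x i j = inverse (det (A x)) * cofactor (A x) j i" for x i j
  have sub: "W' \<subseteq> W" unfolding W'_def by blast
  have cof: "smooth_fun M W' (\<lambda>x. cofactor (A x) i j)" if "i < r" "j < r" for i j
  proof -
    have "cofactor (A x) i j = (- 1) ^ (i + j) *
      det (mat (r - 1) (r - 1) (\<lambda>(i', j'). S x (if i' < i then i' else Suc i') (if j' < j then j' else Suc j')))" for x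
    proof -
      have "mat_delete (A x) i j
          = mat (r - 1) (r - 1) (\<lambda>(i', j'). S x (if i' < i then i' else Suc i') (if j' < j then j' else Suc j'))"
        unfolding mat_delete_def A_def by (rule eq_matI) auto
      then show ?thesis unfolding cofactor_def by simp
    qed
    moreover have "smooth_fun M W' (\<lambda>x. (- 1) ^ (i + j) *
      det (mat (r - 1) (r - 1) (\<lambda>(i', j'). S x (if i' < i then i' else Suc i') (if j' < j then j' else Suc j'))))"
      by (intro smooth_fun_mult smooth_fun_const smooth_fun_det oW' smooth_fun_mono[OF S sub]) auto
    ultimately show ?thesis by simp
  qed
  have "smooth_fun M W' (\<lambda>x. Q x i j)" if "i < r" "j < r" for i j
    unfolding Q_def
    by (intro smooth_fun_mult oW' smooth_fun_inverse smooth_fun_mono[OF sd sub] cof that) (simp add: W'_def)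
  moreover have "(\<Sum>j<r. Q x i j * S x j k) = (if i = k then 1 else 0)" if "x \<in> W'" "i < r" "k < r" for x i k
  proof -
    have "(adj_mat (A x) * A x) $$ (i, k) = (det (A x) \<cdot>\<^sub>m 1\<^sub>m r) $$ (i, k)"
      using adj_mat(3)[OF A, of x] by simp
    then have "(\<Sum>j<r. cofactor (A x) j i * S x j k) = (if i = k then det (A x) else 0)"
      using that unfolding adj_mat_def by (simp add: A_def scalar_prod_def atLeast0LessThan)
    then have "inverse (det (A x)) * (\<Sum>j<r. cofactor (A x) j i * S x j k) = (if i = k then 1 else 0)"
      using that unfolding W'_def by simp
    then show ?thesis unfolding Q_def by (simp add: sum_distrib_left mult.assoc)
  qed
  moreover have "(\<Sum>j<r. S x i j * Q x j k) = (if i = k then 1 else 0)" if "x \<in> W'" "i < r" "k < r" for x i k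
  proof -
    have "(A x * adj_mat (A x)) $$ (i, k) = (det (A x) \<cdot>\<^sub>m 1\<^sub>m r) $$ (i, k)"
      using adj_mat(2)[OF A, of x] by simp
    then have "(\<Sum>j<r. S x i j * cofactor (A x) k j) = (if i = k then det (A x) else 0)"
      using that unfolding adj_mat_def by (simp add: A_def scalar_prod_def atLeast0LessThan)
    then have "inverse (det (A x)) * (\<Sum>j<r. S x i j * cofactor (A x) k j) = (if i = k then 1 else 0)"
      using that unfolding W'_def by simp
    then show ?thesis unfolding Q_def by (simp add: sum_distrib_left mult.left_commute)
  qed
  ultimately show ?thesis
    using that[OF oW' _ sub, of Q] W(2) \<open>det (A x0) \<noteq> 0\<close> unfolding W'_def by blast
qed

end

section \<open>Tangent vectors\<close>

context smooth_mfd
begin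

text \<open>The i-th coordinate field applied to f. Unlike \<open>coord_vector\<close>, which is 0
  on functions that are not globally smooth, it is meaningful for functions smooth only near x, such
  as chart coordinates and structure constants.\<close>

definition pd :: "'m set \<Rightarrow> ('m \<Rightarrow> nat \<Rightarrow> real) \<Rightarrow> nat \<Rightarrow> ('m \<Rightarrow> real) \<Rightarrow> 'm \<Rightarrow> real" where
  "pd U \<phi> i f x = partial i (f \<circ> inv_into U \<phi>) (\<phi> x)"

context
  fixes U \<phi>
  assumes c: "(U, \<phi>) \<in> charts M"
begin

lemma pd_DERIV:
  assumes "smooth_fun M W f" "x \<in> W" "x \<in> U" "i < mdim M"
  shows "((\<lambda>t. f (inv_into U \<phi> ((\<phi> x)(i := t)))) has_real_derivative pd U \<phi> i f x) (at (\<phi> x i))"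
  using Ck_on_SucD[OF smooth_funD[OF assms(1) c, of "Suc 0"] assms(4), of "\<phi> x"] assms
  by (simp add: pd_def comp_def del: fun_upd_apply)

lemma pd_eqI:
  assumes "((\<lambda>t. f (inv_into U \<phi> ((\<phi> x)(i := t)))) has_real_derivative d) (at (\<phi> x i))"
  shows "pd U \<phi> i f x = d"
  unfolding pd_def by (rule partial_eqI) (simp only: comp_def assms)

lemma pd_cong:
  assumes "open W" "\<And>x. x \<in> W \<Longrightarrow> f x = g x" "x \<in> W" "x \<in> U" "i < mdim M"
  shows "pd U \<phi> i f x = pd U \<phi> i g x"
  unfolding pd_def
  by (rule partial_cong[OF openin_chart_image[OF c assms(1)]])
    (use assms chart_inverse[OF c] in auto)

lemma inv_chart_upd: "x \<in> U \<Longrightarrow> inv_into U \<phi> ((\<phi> x)(i := \<phi> x i)) = x"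
  using chart_inverse[OF c] by (simp only: fun_upd_triv)

lemma pd_add:
  assumes "smooth_fun M W f" "smooth_fun M W g" "x \<in> W" "x \<in> U" "i < mdim M"
  shows "pd U \<phi> i (\<lambda>x. f x + g x) x = pd U \<phi> i f x + pd U \<phi> i g x"
  by (rule pd_eqI, rule DERIV_add) (rule pd_DERIV assms)+

lemma pd_mult:
  assumes "smooth_fun M W f" "smooth_fun M W g" "x \<in> W" "x \<in> U" "i < mdim M"
  shows "pd U \<phi> i (\<lambda>x. f x * g x) x = f x * pd U \<phi> i g x + g x * pd U \<phi> i f x"
proof -
  have "pd U \<phi> i (\<lambda>x. f x * g x) x = pd U \<phi> i f x * g x + pd U \<phi> i g x * f x"
    by (rule pd_eqI, rule DERIV_cong[OF DERIV_mult[OF pd_DERIV pd_DERIV]])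
      (rule assms | simp only: inv_chart_upd[OF assms(4)])+
  then show ?thesis by simp
qed

lemma pd_const: "pd U \<phi> i (\<lambda>x. k) x = 0"
  by (rule pd_eqI) simp

lemma pd_coordinate:
  assumes "x \<in> U" "i < mdim M"
  shows "pd U \<phi> i (\<lambda>x. \<phi> x j) x = (if i = j then 1 else 0)"
proof -
  have "pd U \<phi> i (\<lambda>x. \<phi> x j) x = partial i (\<lambda>y. y j) (\<phi> x)"
    unfolding pd_def
    by (rule partial_cong[OF chart_image_open[OF c]]) (use assms chart_inverse[OF c] in auto)
  also have "\<dots> = (if i = j then 1 else 0)"
    by (rule partial_eqI) auto
  finally show ?thesis .
qed

lemma smooth_fun_pd:
  "open W \<Longrightarrow> W \<subseteq> U \<Longrightarrow> smooth_fun M W f \<Longrightarrow> i < mdim M \<Longrightarrow> smooth_fun M W (pd U \<phi> i f)"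
  using smooth_fun_partial[OF c] unfolding pd_def by blast

end

lemma C_infinityD: "f \<in> C_infinity M \<Longrightarrow> smooth_fun M W f"
  unfolding C_infinity_def using smooth_fun_mono by blast

lemma C_infinityI: "smooth_fun M UNIV f \<Longrightarrow> f \<in> C_infinity M"
  unfolding C_infinity_def by blast

lemma C_infinity_const: "(\<lambda>x. k) \<in> C_infinity M"
  by (intro C_infinityI smooth_fun_const) simp

lemma C_infinity_mult: "f \<in> C_infinity M \<Longrightarrow> g \<in> C_infinity M \<Longrightarrow> f * g \<in> C_infinity M"
  unfolding times_fun_def
  by (rule C_infinityI, rule smooth_fun_mult[OF open_UNIV C_infinityD C_infinityD])

lemma subspace_C_infinity: "subspace (C_infinity M)"
  unfolding subspace_def
proof (intro conjI ballI allI)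
  show "0 \<in> C_infinity M" using C_infinity_const[of 0] by (simp add: zero_fun_def)
  show "f + g \<in> C_infinity M" if "f \<in> C_infinity M" "g \<in> C_infinity M" for f g
    unfolding plus_fun_def
    by (rule C_infinityI, rule smooth_fun_add[OF open_UNIV C_infinityD[OF that(1)] C_infinityD[OF that(2)]])
  show "k *\<^sub>R f \<in> C_infinity M" if "f \<in> C_infinity M" for k f
    unfolding scaleR_fun_def real_scaleR_def
    by (rule C_infinityI, rule smooth_fun_mult[OF open_UNIV smooth_fun_const[OF open_UNIV] C_infinityD[OF that]])
qed

lemma tangentD:
  assumes "D \<in> tangent_space M p"
  shows "linear_on_set (C_infinity M) D"
    and "f \<in> C_infinity M \<Longrightarrow> g \<in> C_infinity M \<Longrightarrow> D (f * g) = f p * D g + g p * D f"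
    and "f \<notin> C_infinity M \<Longrightarrow> D f = 0"
  using assms unfolding tangent_space_def mem_Collect_eq by blast+

lemma subspace_tangent_space: "subspace (tangent_space M p)"
  unfolding subspace_def
  by (auto simp: tangent_space_def linear_on_set_def algebra_simps)

text \<open>The Leibniz rule for 1 * 1 gives D 1 = 2 D 1, so D 1 = 0; constants are multiples of
  1.\<close>

lemma tangent_const:
  assumes D: "D \<in> tangent_space M p"
  shows "D (\<lambda>x. k) = 0"
proof -
  have one: "(\<lambda>x. 1) \<in> C_infinity M" by (rule C_infinity_const)
  have "(\<lambda>x. 1) * (\<lambda>x. 1) = (\<lambda>x::'m. 1::real)" by (simp add: times_fun_def)
  then have "D (\<lambda>x. 1) = D (\<lambda>x. 1) + D (\<lambda>x. 1)"
    using tangentD(2)[OF D one one] by simp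
  then have "D (\<lambda>x. 1) = 0" by simp
  moreover have "(\<lambda>x. k) = k *\<^sub>R (\<lambda>x::'m. 1::real)" by (simp add: scaleR_fun_def)
  ultimately show ?thesis
    using linear_on_set_scale[OF tangentD(1)[OF D] one, of k] by simp
qed

lemma coord_vector_apply: "f \<in> C_infinity M \<Longrightarrow> coord_vector M U \<phi> i x f = pd U \<phi> i f x"
  unfolding coord_vector_def pd_def by simp

lemma coord_vector_tangent:
  assumes c: "(U, \<phi>) \<in> charts M" "x \<in> U" "i < mdim M"
  shows "coord_vector M U \<phi> i x \<in> tangent_space M x"
proof -
  have "coord_vector M U \<phi> i x (f + g) = coord_vector M U \<phi> i x f + coord_vector M U \<phi> i x g"
    if "f \<in> C_infinity M" "g \<in> C_infinity M" for f g
    using that pd_add[OF c(1) C_infinityD[OF that(1)] C_infinityD[OF that(2)] UNIV_I c(2,3)]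
      subspace_add[OF subspace_C_infinity]
    by (simp add: coord_vector_apply) (simp add: plus_fun_def)
  moreover have "coord_vector M U \<phi> i x (k *\<^sub>R f) = k *\<^sub>R coord_vector M U \<phi> i x f"
    if "f \<in> C_infinity M" for f k
    using that pd_mult[OF c(1) C_infinityD[OF C_infinity_const[of k]] C_infinityD[OF that] UNIV_I c(2,3)]
      subspace_scale[OF subspace_C_infinity] pd_const[OF c(1)]
    by (simp add: coord_vector_apply) (simp add: scaleR_fun_def)
  moreover have "coord_vector M U \<phi> i x (f * g) = f x * coord_vector M U \<phi> i x g + g x * coord_vector M U \<phi> i x f"
    if "f \<in> C_infinity M" "g \<in> C_infinity M" for f g
    using that pd_mult[OF c(1) C_infinityD[OF that(1)] C_infinityD[OF that(2)] UNIV_I c(2,3)]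
      C_infinity_mult
    by (simp add: coord_vector_apply) (simp add: times_fun_def)
  moreover have "coord_vector M U \<phi> i x f = 0" if "f \<notin> C_infinity M" for f
    using that unfolding coord_vector_def by simp
  ultimately show ?thesis unfolding tangent_space_def linear_on_set_def by blast
qed

text \<open>By Hadamard's lemma, near \<open>p\<close> every smooth function differs from a constant by a combination of the
  functions \<open>x\<^sub>i - p\<^sub>i\<close>, so a derivation at \<open>p\<close> is determined by its values on (cut off) coordinates.\<close>

lemma tangent_vector_coordinates:
  assumes c: "(U, \<phi>) \<in> charts M" "p \<in> U" and D: "D \<in> tangent_space M p"
  obtains v where "v \<in> Rn (mdim M)" "D = lincomb (mdim M) (\<lambda>i. coord_vector M U \<phi> i p) v"
proof -
  let ?n = "mdim M"
  obtain \<delta> where \<delta>: "\<delta> > 0" "rbox ?n (\<phi> p) \<delta> \<subseteq> \<phi> ` U"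
    using openin_Rn_rbox[OF chart_image_open[OF c(1)]] c(2) by blast
  define W where "W = {x \<in> U. \<phi> x \<in> rbox ?n (\<phi> p) \<delta>}"
  have W: "open W" "p \<in> W" "W \<subseteq> U"
    using open_chart_preimage[OF c(1) openin_rbox] c(2) centre_in_rbox[OF chart_Rn[OF c] \<delta>(1)]
    unfolding W_def by auto
  have \<phi>W: "\<phi> ` W \<subseteq> rbox ?n (\<phi> p) \<delta>" unfolding W_def by blast
  obtain \<eta> V C where \<eta>: "smooth_fun M UNIV \<eta>" "open V" "p \<in> V" "\<And>x. x \<in> V \<Longrightarrow> \<eta> x = 1"
    "closed C" "C \<subseteq> W" "\<And>x. x \<notin> C \<Longrightarrow> \<eta> x = 0"
    using bump_exists[OF W(1,2)] by metis
  \<comment> \<open>Coordinates centred at p and cut off to global functions, as D accepts only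
    these. The components of D will be the values \<open>D (h i)\<close>.\<close>
  define h where "h i = (\<lambda>x. \<eta> x * (\<phi> x i - \<phi> p i))" for i
  have h: "h i \<in> C_infinity M" if "i < ?n" for i
    unfolding h_def
    by (intro C_infinityI smooth_fun_extend[OF \<eta>(1,5,6,7) W(1)] smooth_fun_diff smooth_fun_const W(1)
        smooth_fun_mono[OF smooth_fun_chart[OF c(1) that] W(3)])
  have main: "D f = (\<Sum>i<?n. D (h i) * pd U \<phi> i f p)" if f: "f \<in> C_infinity M" for f
  proof -
    have "Ck_on ?n k (rbox ?n (\<phi> p) \<delta>) (f \<circ> inv_into U \<phi>)" for k
      using Ck_on_mono[OF smooth_funD[OF C_infinityD[OF f, of UNIV] c(1)]] \<delta>(2) by simp
    from hadamard[OF chart_Rn[OF c] \<delta>(1) this]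
    obtain G where G: "\<And>i k. i < ?n \<Longrightarrow> Ck_on ?n k (rbox ?n (\<phi> p) \<delta>) (G i)"
      "\<And>y. y \<in> rbox ?n (\<phi> p) \<delta> \<Longrightarrow> (f \<circ> inv_into U \<phi>) y = (f \<circ> inv_into U \<phi>) (\<phi> p) + (\<Sum>i<?n. (y i - \<phi> p i) * G i y)"
      "\<And>i. i < ?n \<Longrightarrow> G i (\<phi> p) = partial i (f \<circ> inv_into U \<phi>) (\<phi> p)"
      by blast
    define g where "g i = (\<lambda>x. \<eta> x * G i (\<phi> x))" for i
    have g: "g i \<in> C_infinity M" if "i < ?n" for i
      unfolding g_def
      by (intro C_infinityI smooth_fun_extend[OF \<eta>(1,5,6,7) W(1)] smooth_fun_of_chart[where F="G i", OF c(1) W(1,3) Ck_on_mono[OF G(1)[OF that] \<phi>W]] refl)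
    have \<eta>C: "\<eta> \<in> C_infinity M" using \<eta>(1) by (rule C_infinityI)
    have \<eta>1: "\<eta> p = 1" using \<eta>(3,4) by blast
    define k where "k = (\<lambda>x::'m. - f p)"
    have k: "k \<in> C_infinity M" unfolding k_def by (rule C_infinity_const)
    have fk: "f + k \<in> C_infinity M" using subspace_add[OF subspace_C_infinity f k] .
    \<comment> \<open>The cut-off occurs squared because \<open>h i\<close> and \<open>g i\<close>
      carry one factor each. On the left, D gives just D f: the square is 1 at p, and f + k vanishes
      there.\<close>
    have "(\<eta> * \<eta>) * (f + k) = (\<Sum>i<?n. h i * g i)"
    proof
      fix x
      show "((\<eta> * \<eta>) * (f + k)) x = (\<Sum>i<?n. h i * g i) x"
      proof (cases "x \<in> W")
        case True
        then have "f x = f p + (\<Sum>i<?n. (\<phi> x i - \<phi> p i) * G i (\<phi> x))"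
          using G(2)[of "\<phi> x"] chart_inverse[OF c(1)] W c(2) unfolding W_def by auto
        then show ?thesis
          unfolding sum_fun_apply h_def g_def k_def times_fun_apply plus_fun_apply
          by (simp add: sum_distrib_left algebra_simps)
      next
        case False
        then have "\<eta> x = 0" using \<eta>(6,7) by blast
        then show ?thesis unfolding sum_fun_apply h_def g_def by simp
      qed
    qed
    moreover have "D ((\<eta> * \<eta>) * (f + k)) = D f"
      using tangentD(2)[OF D C_infinity_mult[OF \<eta>C \<eta>C] fk] linear_on_set_add[OF tangentD(1)[OF D] f k]
        tangent_const[OF D, of "- f p"] \<eta>1 by (simp add: k_def)
    moreover have "D (\<Sum>i<?n. h i * g i) = (\<Sum>i<?n. D (h i * g i))"
      by (rule linear_on_set_sum[OF subspace_C_infinity tangentD(1)[OF D]]) (use C_infinity_mult h g in auto)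
    moreover have "D (h i * g i) = D (h i) * pd U \<phi> i f p" if "i < ?n" for i
      using tangentD(2)[OF D h[OF that] g[OF that]] G(3)[OF that] \<eta>1
      by (simp add: h_def[of i] g_def[of i] pd_def)
    ultimately show ?thesis by simp
  qed
  define v where "v i = (if i < ?n then D (h i) else 0)" for i
  have "D = lincomb ?n (\<lambda>i. coord_vector M U \<phi> i p) v"
  proof
    fix f
    show "D f = lincomb ?n (\<lambda>i. coord_vector M U \<phi> i p) v f"
    proof (cases "f \<in> C_infinity M")
      case True
      then show ?thesis unfolding lincomb_def sum_fun_apply v_def
        using main[OF True] by (simp add: coord_vector_apply)
    next
      case False
      then show ?thesis unfolding lincomb_def sum_fun_apply
        using tangentD(3)[OF D False] by (simp add: coord_vector_def)
    qed
  qed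
  moreover have "v \<in> Rn ?n" unfolding v_def Rn_iff by simp
  ultimately show ?thesis using that by blast
qed

text \<open>Independence is tested on cut-off coordinate functions, which agree with the coordinates
  near x and thus have the expected partial derivatives at x. Spanning is
  \<open>tangent_vector_coordinates\<close>.\<close>

lemma coord_vector_basis:
  assumes c: "(U, \<phi>) \<in> charts M" "x \<in> U"
  shows "is_basis (mdim M) (\<lambda>i. coord_vector M U \<phi> i x) (tangent_space M x)"
proof (rule is_basisI[OF subspace_tangent_space coord_vector_tangent[OF c]])
  fix v assume v: "v \<in> Rn (mdim M)" "lincomb (mdim M) (\<lambda>i. coord_vector M U \<phi> i x) v = 0"
  obtain \<eta> V C where \<eta>: "smooth_fun M UNIV \<eta>" "open V" "x \<in> V" "\<And>x. x \<in> V \<Longrightarrow> \<eta> x = 1"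
    "closed C" "C \<subseteq> U" "\<And>x. x \<notin> C \<Longrightarrow> \<eta> x = 0"
    using bump_exists[OF chart_open[OF c(1)] c(2)] by metis
  have "v j = 0" if j: "j < mdim M" for j
  proof -
    define f where "f y = \<eta> y * \<phi> y j" for y
    have f: "f \<in> C_infinity M"
      unfolding f_def
      by (intro C_infinityI smooth_fun_extend[OF \<eta>(1,5,6,7) chart_open[OF c(1)]] smooth_fun_chart[OF c(1) j])
    have "pd U \<phi> i f x = (if i = j then 1 else 0)" if "i < mdim M" for i
      using pd_coordinate[OF c that, of j] pd_cong[OF c(1) \<eta>(2), of f "\<lambda>x. \<phi> x j" x i] \<eta>(3,4) c(2) that
      by (simp add: f_def)
    then have "lincomb (mdim M) (\<lambda>i. coord_vector M U \<phi> i x) v f = v j"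
      unfolding lincomb_def sum_fun_apply using f j
      by (simp add: coord_vector_apply if_distrib[of "(*) _"] sum.delta' cong: if_cong)
    then show "v j = 0" using v(2) by simp
  qed
  then show "v = 0" using v(1) unfolding Rn_iff by (auto simp: fun_eq_iff not_less[symmetric])
next
  fix D assume "D \<in> tangent_space M x"
  from tangent_vector_coordinates[OF c this]
  show "\<exists>v. v \<in> Rn (mdim M) \<and> D = lincomb (mdim M) (\<lambda>i. coord_vector M U \<phi> i x) v" by blast
qed

end

section \<open>Smooth sections and frames\<close>

lemma inverse_matrix_apply:
  fixes r :: nat
  assumes "\<And>i k. i < r \<Longrightarrow> k < r \<Longrightarrow> (\<Sum>j<r. A i j * B j k) = (if i = k then 1 else (0::real))" "i < r"
  shows "(\<Sum>j<r. A i j * (\<Sum>k<r. B j k * c k)) = c i"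
proof -
  have "(\<Sum>j<r. A i j * (\<Sum>k<r. B j k * c k)) = (\<Sum>k<r. (\<Sum>j<r. A i j * B j k) * c k)"
    unfolding sum_distrib_left sum_distrib_right by (subst sum.swap) (simp add: mult.assoc)
  also have "\<dots> = (\<Sum>k<r. if i = k then c k else 0)"
    using assms by (intro sum.cong) auto
  finally show ?thesis using assms(2) by (simp add: sum.delta')
qed

locale smooth_vb = smooth_mfd M for M :: "'m::{t2_space, second_countable_topology} manifold" +
  fixes E :: "('m, 'v::real_vector) vbundle"
  assumes vb: "vector_bundle M E"
begin

section \<open>Trivialisations as local frames\<close>

lemma fibre_subspace: "subspace (fibre E x)"
  using vb unfolding vector_bundle_def by (elim conjE) (erule spec)

lemma triv_exists: obtains U r \<Phi> where "(U, r, \<Phi>) \<in> trivs E" "x \<in> U"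
proof -
  have "(\<Union>(U, r, \<Phi>) \<in> trivs E. U) = UNIV"
    using vb unfolding vector_bundle_def by (elim conjE)
  then have "x \<in> (\<Union>(U, r, \<Phi>) \<in> trivs E. U)" by simp
  then show ?thesis using that by auto
qed

lemma triv_open: "(U, r, \<Phi>) \<in> trivs E \<Longrightarrow> open U"
  and triv_linear_iso: "(U, r, \<Phi>) \<in> trivs E \<Longrightarrow> x \<in> U \<Longrightarrow> linear_iso (\<Phi> x) (Rn r) (fibre E x)"
  using vb unfolding vector_bundle_def by fast+

lemma triv_basis: "(U, r, \<Phi>) \<in> trivs E \<Longrightarrow> x \<in> U \<Longrightarrow> is_basis r (\<lambda>j. \<Phi> x (unit_vec j)) (fibre E x)"
  by (rule is_basis_of_linear_iso[OF triv_linear_iso])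

text \<open>Stated for an arbitrary family of target spaces F, so that it also serves for the kernel
  fibres.\<close>

lemma smooth_coords_iff:
  assumes "open W" "\<And>x. x \<in> W \<Longrightarrow> linear_iso (\<Phi> x) (Rn r) (F x)"
  shows "smooth_coords M W r \<Phi> s \<longleftrightarrow> (\<forall>i<r. smooth_fun M W (\<lambda>x. coords r (\<lambda>j. \<Phi> x (unit_vec j)) (s x) i))"
proof -
  have "smooth_fun M W (\<lambda>x. inv_into (Rn r) (\<Phi> x) (s x) i) \<longleftrightarrow>
      smooth_fun M W (\<lambda>x. coords r (\<lambda>j. \<Phi> x (unit_vec j)) (s x) i)" for i
  proof -
    have eq: "inv_into (Rn r) (\<Phi> x) (s x) i = coords r (\<lambda>j. \<Phi> x (unit_vec j)) (s x) i" if "x \<in> W" for x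
      using coords_of_linear_iso[OF assms(2)[OF that]] by (rule fun_cong)
    show ?thesis
      using smooth_fun_cong[OF assms(1) eq] smooth_fun_cong[OF assms(1) eq[symmetric]] by (rule iffI)
  qed
  then show ?thesis unfolding smooth_coords_def by blast
qed

lemma section_in_fibre: "smooth_section M E W s \<Longrightarrow> x \<in> W \<Longrightarrow> s x \<in> fibre E x"
  unfolding smooth_section_def by blast

lemma section_coords:
  assumes "smooth_section M E W s" "open W" "(U, r, \<Phi>) \<in> trivs E" "i < r"
  shows "smooth_fun M (W \<inter> U) (\<lambda>x. coords r (\<lambda>j. \<Phi> x (unit_vec j)) (s x) i)"
proof -
  have "smooth_coords M (W \<inter> U) r \<Phi> s"
    using assms(1,3) unfolding smooth_section_def by fast
  then show ?thesis
    using smooth_coords_iff[of "W \<inter> U" \<Phi> r "fibre E"] triv_linear_iso[OF assms(3)] triv_open[OF assms(3)] assms(2,4)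
    by auto
qed

lemma smooth_sectionI:
  assumes "open W" "\<And>x. x \<in> W \<Longrightarrow> s x \<in> fibre E x"
    and "\<And>U r \<Phi> i. (U, r, \<Phi>) \<in> trivs E \<Longrightarrow> i < r \<Longrightarrow> smooth_fun M (W \<inter> U) (\<lambda>x. coords r (\<lambda>j. \<Phi> x (unit_vec j)) (s x) i)"
  shows "smooth_section M E W s"
  unfolding smooth_section_def
proof (intro conjI ballI, rule assms(2), assumption, clarify)
  fix U r \<Phi> assume t: "(U, r, \<Phi>) \<in> trivs E"
  show "smooth_coords M (W \<inter> U) r \<Phi> s"
    using smooth_coords_iff[of "W \<inter> U" \<Phi> r "fibre E"] triv_linear_iso[OF t] triv_open[OF t] assms(1) assms(3)[OF t]
    by auto
qed

lemma smooth_section_triv: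
  assumes t: "(U, r, \<Phi>) \<in> trivs E" "j < r"
  shows "smooth_section M E U (\<lambda>x. \<Phi> x (unit_vec j))"
  unfolding smooth_section_def
proof (intro conjI ballI)
  show "\<Phi> x (unit_vec j) \<in> fibre E x" if "x \<in> U" for x
    using is_basis_mem[OF triv_basis[OF t(1) that] t(2)] .
  show "case tr of (V, s, \<Psi>) \<Rightarrow> smooth_coords M (U \<inter> V) s \<Psi> (\<lambda>x. \<Phi> x (unit_vec j))" if "tr \<in> trivs E" for tr
    using vb t that unfolding vector_bundle_def by fast
qed

section \<open>Operations on smooth sections\<close>

lemma smooth_section_mono: "smooth_section M E W s \<Longrightarrow> open W \<Longrightarrow> open V \<Longrightarrow> V \<subseteq> W \<Longrightarrow> smooth_section M E V s"
  by (rule smooth_sectionI) (auto intro: section_in_fibre smooth_fun_mono[OF section_coords])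

lemma smooth_section_cong:
  assumes "open W" "\<And>x. x \<in> W \<Longrightarrow> s x = t x" "smooth_section M E W s"
  shows "smooth_section M E W t"
proof (rule smooth_sectionI[OF assms(1)])
  show "t x \<in> fibre E x" if "x \<in> W" for x using section_in_fibre[OF assms(3) that] assms(2)[OF that] by simp
  fix U r \<Phi> i assume t: "(U, r, \<Phi>) \<in> trivs E" "i < r"
  show "smooth_fun M (W \<inter> U) (\<lambda>x. coords r (\<lambda>j. \<Phi> x (unit_vec j)) (t x) i)"
    by (rule smooth_fun_cong[OF _ _ section_coords[OF assms(3,1) t]])
      (use assms(1,2) triv_open[OF t(1)] in auto)
qed

lemma smooth_section_local:
  assumes "open W" "\<And>x. x \<in> W \<Longrightarrow> \<exists>V. open V \<and> x \<in> V \<and> smooth_section M E V s"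
  shows "smooth_section M E W s"
proof (rule smooth_sectionI[OF assms(1)])
  show "s x \<in> fibre E x" if "x \<in> W" for x using assms(2)[OF that] section_in_fibre by blast
  fix U r \<Phi> i assume t: "(U, r, \<Phi>) \<in> trivs E" "i < r"
  show "smooth_fun M (W \<inter> U) (\<lambda>x. coords r (\<lambda>j. \<Phi> x (unit_vec j)) (s x) i)"
  proof (rule smooth_fun_local)
    fix x assume x: "x \<in> W \<inter> U"
    then obtain V where "open V" "x \<in> V" "smooth_section M E V s" using assms(2) by blast
    then show "\<exists>V. open V \<and> x \<in> V \<and> smooth_fun M V (\<lambda>x. coords r (\<lambda>j. \<Phi> x (unit_vec j)) (s x) i)"
      using x section_coords[OF _ _ t] triv_open[OF t(1)] by (intro exI[of _ "V \<inter> U"]) auto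
  qed
qed

lemma smooth_section_zero: "open W \<Longrightarrow> smooth_section M E W (\<lambda>x. 0)"
proof (rule smooth_sectionI)
  assume W: "open W"
  fix U r \<Phi> i assume t: "(U, r, \<Phi>) \<in> trivs E" "i < r"
  have "coords r (\<lambda>j. \<Phi> x (unit_vec j)) 0 i = 0" if "x \<in> U" for x
    using linear_on_set_0[OF fibre_subspace linear_on_set_coords[OF triv_basis[OF t(1) that]]] by simp
  then show "smooth_fun M (W \<inter> U) (\<lambda>x. coords r (\<lambda>j. \<Phi> x (unit_vec j)) 0 i)"
    using W triv_open[OF t(1)] by (intro smooth_fun_cong[OF _ _ smooth_fun_const[of _ 0]]) auto
qed (simp_all add: subspace_0 fibre_subspace)

lemma smooth_section_add:
  assumes "open W" "smooth_section M E W s" "smooth_section M E W t"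
  shows "smooth_section M E W (\<lambda>x. s x + t x)"
proof (rule smooth_sectionI[OF assms(1)])
  show "s x + t x \<in> fibre E x" if "x \<in> W" for x
    using that assms(2,3) by (intro subspace_add fibre_subspace section_in_fibre)
  fix U r \<Phi> i assume tr: "(U, r, \<Phi>) \<in> trivs E" "i < r"
  have o: "open (W \<inter> U)" using assms(1) triv_open[OF tr(1)] by auto
  have "coords r (\<lambda>j. \<Phi> x (unit_vec j)) (s x) i + coords r (\<lambda>j. \<Phi> x (unit_vec j)) (t x) i
      = coords r (\<lambda>j. \<Phi> x (unit_vec j)) (s x + t x) i" if "x \<in> W \<inter> U" for x
    using that linear_on_set_add[OF linear_on_set_coords[OF triv_basis[OF tr(1)]]]
      section_in_fibre[OF assms(2)] section_in_fibre[OF assms(3)] by simp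
  from smooth_fun_cong[OF o this smooth_fun_add[OF o section_coords[OF assms(2,1) tr] section_coords[OF assms(3,1) tr]]]
  show "smooth_fun M (W \<inter> U) (\<lambda>x. coords r (\<lambda>j. \<Phi> x (unit_vec j)) (s x + t x) i)" .
qed

lemma smooth_section_scale:
  assumes "open W" "smooth_fun M W f" "smooth_section M E W s"
  shows "smooth_section M E W (\<lambda>x. f x *\<^sub>R s x)"
proof (rule smooth_sectionI[OF assms(1)])
  show "f x *\<^sub>R s x \<in> fibre E x" if "x \<in> W" for x
    using that assms(3) by (intro subspace_scale fibre_subspace section_in_fibre)
  fix U r \<Phi> i assume tr: "(U, r, \<Phi>) \<in> trivs E" "i < r"
  have o: "open (W \<inter> U)" using assms(1) triv_open[OF tr(1)] by auto
  have "f x * coords r (\<lambda>j. \<Phi> x (unit_vec j)) (s x) i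
      = coords r (\<lambda>j. \<Phi> x (unit_vec j)) (f x *\<^sub>R s x) i" if "x \<in> W \<inter> U" for x
    using that linear_on_set_scale[OF linear_on_set_coords[OF triv_basis[OF tr(1)]]]
      section_in_fibre[OF assms(3)] by simp
  from smooth_fun_cong[OF o this smooth_fun_mult[OF o smooth_fun_mono[OF assms(2)] section_coords[OF assms(3,1) tr]]]
  show "smooth_fun M (W \<inter> U) (\<lambda>x. coords r (\<lambda>j. \<Phi> x (unit_vec j)) (f x *\<^sub>R s x) i)" by blast
qed

lemma smooth_section_lincomb:
  assumes "open W" "\<And>j. j < r \<Longrightarrow> smooth_fun M W (\<lambda>x. f x j)" "\<And>j. j < r \<Longrightarrow> smooth_section M E W (\<lambda>x. b x j)"
  shows "smooth_section M E W (\<lambda>x. lincomb r (b x) (f x))"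
  using assms(2,3)
proof (induction r)
  case 0
  then show ?case using smooth_section_zero[OF assms(1)] by (simp add: lincomb_def)
next
  case (Suc r)
  then show ?case
    using smooth_section_add[OF assms(1) _ smooth_section_scale[OF assms(1)]] by (simp add: lincomb_def)
qed

text \<open>The source of global sections: the bracket can be applied to local data only after such
  a cut-off.\<close>

lemma smooth_section_extend:
  assumes \<eta>: "smooth_fun M UNIV \<eta>" and C: "closed C" "C \<subseteq> W" "\<And>x. x \<notin> C \<Longrightarrow> \<eta> x = 0"
    and W: "open W" and s: "smooth_section M E W s"
  shows "(\<lambda>x. \<eta> x *\<^sub>R s x) \<in> sections M E"
  unfolding sections_def mem_Collect_eq
proof (rule smooth_section_local)
  fix x :: 'm
  show "\<exists>V. open V \<and> x \<in> V \<and> smooth_section M E V (\<lambda>x. \<eta> x *\<^sub>R s x)"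
  proof (cases "x \<in> W")
    case True
    then show ?thesis
      using W smooth_section_scale[OF W smooth_fun_mono[OF \<eta>] s] by blast
  next
    case False
    have "smooth_section M E (- C) (\<lambda>x. \<eta> x *\<^sub>R s x)"
      by (rule smooth_section_cong[OF _ _ smooth_section_zero]) (use C in auto)
    then show ?thesis using False C by (intro exI[of _ "- C"]) auto
  qed
qed simp

text \<open>The matrix S of the sections b in a trivialisation is smooth and invertible at x0, hence
  invertible nearby with smooth inverse Q. Coordinates with respect to b are Q applied to
  coordinates in the trivialisation, which gives both the frame property and the smoothness of
  coefficients.\<close>

lemma frame_nearby:
  assumes W: "open W" "x0 \<in> W" and b: "\<And>j. j < r \<Longrightarrow> smooth_section M E W (\<lambda>x. b x j)"
    and b0: "is_basis r (b x0) (fibre E x0)"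
  obtains W' where "open W'" "x0 \<in> W'" "W' \<subseteq> W" "\<And>x. x \<in> W' \<Longrightarrow> is_basis r (b x) (fibre E x)"
    "\<And>V s i. open V \<Longrightarrow> V \<subseteq> W' \<Longrightarrow> smooth_section M E V s \<Longrightarrow> i < r \<Longrightarrow> smooth_fun M V (\<lambda>x. coords r (b x) (s x) i)"
proof -
  obtain U r' \<Phi> where t': "(U, r', \<Phi>) \<in> trivs E" "x0 \<in> U" using triv_exists .
  \<comment> \<open>A dimension count at x0 makes S a square matrix.\<close>
  have "r' = r" using is_basis_dim[OF b0] is_basis_dim[OF triv_basis[OF t']] by simp
  then have t: "(U, r, \<Phi>) \<in> trivs E" using t' by simp
  define cf where "cf x = coords r (\<lambda>j. \<Phi> x (unit_vec j))" for x
  define S where "S x i j = cf x (b x j) i" for x i j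
  have o: "open (W \<inter> U)" using W triv_open[OF t] by auto
  have bW: "b x j \<in> fibre E x" if "x \<in> W" "j < r" for x j using section_in_fibre[OF b] that by blast
  have cf_lincomb: "cf x (lincomb r (b x) v) i = (\<Sum>j<r. S x i j * v j)" if "x \<in> W \<inter> U" for x v i
    using linear_on_set_lincomb_comp[OF fibre_subspace linear_on_set_coords[OF triv_basis[OF t]], of x r "b x" v] that bW
    unfolding cf_def S_def lincomb_def by (simp add: sum_fun_apply mult.commute)
  have cf_inj: "u = w" if "x \<in> U" "u \<in> fibre E x" "w \<in> fibre E x" "\<And>i. i < r \<Longrightarrow> cf x u i = cf x w i" for x u w
    using that lincomb_coords[OF triv_basis[OF t that(1)]] lincomb_cong[of r "\<lambda>j. \<Phi> x (unit_vec j)" "\<lambda>j. \<Phi> x (unit_vec j)" "cf x u" "cf x w"]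
    unfolding cf_def by metis
  have cf0: "cf x 0 i = 0" if "x \<in> U" for x i
    unfolding cf_def using linear_on_set_0[OF fibre_subspace linear_on_set_coords[OF triv_basis[OF t that]]] by simp
  have S: "smooth_fun M (W \<inter> U) (\<lambda>x. S x i j)" if "i < r" "j < r" for i j
    unfolding S_def cf_def using section_coords[OF b[OF that(2)] W(1) t that(1)] .
  have inj0: "v = 0" if v: "v \<in> Rn r" "\<And>i. i < r \<Longrightarrow> (\<Sum>j<r. S x0 i j * v j) = 0" for v
  proof -
    have "lincomb r (b x0) v = 0"
      using cf_lincomb[of x0 v] W(2) t'(2) v(2) lincomb_in[OF fibre_subspace bW[OF W(2)]] cf0[OF t'(2)]
      by (intro cf_inj[OF t'(2)]) (auto simp: subspace_0 fibre_subspace)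
    then have "v j = 0" if "j < r" for j using is_basis_eq_0[OF b0 _ that] by blast
    then show "v = 0" using v(1) unfolding Rn_iff by (auto simp: fun_eq_iff not_less[symmetric])
  qed
  have x0: "x0 \<in> W \<inter> U" using W(2) t'(2) by blast
  obtain W' Q where Q: "open W'" "x0 \<in> W'" "W' \<subseteq> W \<inter> U"
    "\<And>i j. i < r \<Longrightarrow> j < r \<Longrightarrow> smooth_fun M W' (\<lambda>x. Q x i j)"
    "\<And>x i k. x \<in> W' \<Longrightarrow> i < r \<Longrightarrow> k < r \<Longrightarrow> (\<Sum>j<r. Q x i j * S x j k) = (if i = k then 1 else 0)"
    "\<And>x i k. x \<in> W' \<Longrightarrow> i < r \<Longrightarrow> k < r \<Longrightarrow> (\<Sum>j<r. S x i j * Q x j k) = (if i = k then 1 else 0)"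
  proof (rule smooth_matrix_inverse[where S=S, OF o x0 S inj0])
    fix W' Q
    assume a: "open W'" "x0 \<in> W'" "W' \<subseteq> W \<inter> U"
      "\<And>i j. i < r \<Longrightarrow> j < r \<Longrightarrow> smooth_fun M W' (\<lambda>x. Q x i j)"
      "\<And>x i k. x \<in> W' \<Longrightarrow> i < r \<Longrightarrow> k < r \<Longrightarrow> (\<Sum>j<r. Q x i j * S x j k) = (if i = k then 1 else 0)"
      "\<And>x i k. x \<in> W' \<Longrightarrow> i < r \<Longrightarrow> k < r \<Longrightarrow> (\<Sum>j<r. S x i j * Q x j k) = (if i = k then 1 else 0)"
    show thesis by (rule that[OF a])
  qed
  \<comment> \<open>S Q = 1 shows that both sides have the same coordinates in the trivialisation;
    the value 0 from r on only keeps the coefficient vector in \<open>Rn r\<close>.\<close>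
  have rep: "u = lincomb r (b x) (\<lambda>j. if j < r then \<Sum>k<r. Q x j k * cf x u k else 0)"
    if x: "x \<in> W'" and u: "u \<in> fibre E x" for x u
  proof (rule cf_inj)
    show "x \<in> U" using x Q(3) by blast
    show "lincomb r (b x) (\<lambda>j. if j < r then \<Sum>k<r. Q x j k * cf x u k else 0) \<in> fibre E x"
      using x Q(3) bW by (intro lincomb_in fibre_subspace) auto
    fix i assume "i < r"
    have "cf x (lincomb r (b x) (\<lambda>j. if j < r then \<Sum>k<r. Q x j k * cf x u k else 0)) i
        = (\<Sum>j<r. S x i j * (\<Sum>k<r. Q x j k * cf x u k))"
      by (subst cf_lincomb) (use x Q(3) in \<open>auto intro!: sum.cong\<close>)
    also have "\<dots> = cf x u i" by (rule inverse_matrix_apply[OF Q(6)[OF x] \<open>i < r\<close>])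
    finally show "cf x u i = cf x (lincomb r (b x) (\<lambda>j. if j < r then \<Sum>k<r. Q x j k * cf x u k else 0)) i"
      by simp
  qed (rule u)
  have basis: "is_basis r (b x) (fibre E x)" if x: "x \<in> W'" for x
  proof (rule is_basisI[OF fibre_subspace])
    show "b x j \<in> fibre E x" if "j < r" for j using bW that x Q(3) by blast
    fix v assume v: "v \<in> Rn r" "lincomb r (b x) v = 0"
    have "(\<Sum>j<r. S x i j * v j) = 0" for i
      using cf_lincomb[of x v i] cf0[of x i] v(2) x Q(3) by auto
    then have "v i = 0" if "i < r" for i
      using inverse_matrix_apply[OF Q(5)[OF x] that, of v] by simp
    then show "v = 0" using v(1) unfolding Rn_iff by (auto simp: fun_eq_iff not_less[symmetric])
  next
    fix u assume "u \<in> fibre E x"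
    then have "u = lincomb r (b x) (\<lambda>j. if j < r then \<Sum>k<r. Q x j k * cf x u k else 0)" using rep[OF x] by blast
    moreover have "(\<lambda>j. if j < r then \<Sum>k<r. Q x j k * cf x u k else 0) \<in> Rn r" unfolding Rn_iff by simp
    ultimately show "\<exists>v. v \<in> Rn r \<and> u = lincomb r (b x) v" by blast
  qed
  have "smooth_fun M V (\<lambda>x. coords r (b x) (s x) i)"
    if V: "open V" "V \<subseteq> W'" and s: "smooth_section M E V s" and i: "i < r" for V s i
  proof (rule smooth_fun_cong[OF V(1)])
    fix x assume x: "x \<in> V"
    then show "(\<Sum>k<r. Q x i k * cf x (s x) k) = coords r (b x) (s x) i"
      using coords_lincomb_nth[OF basis i, of x "\<lambda>j. if j < r then \<Sum>k<r. Q x j k * cf x (s x) k else 0"]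
        rep[of x "s x"] section_in_fibre[OF s x] V(2) i by auto
  next
    have "V \<inter> U = V" using V(2) Q(3) by blast
    then show "smooth_fun M V (\<lambda>x. \<Sum>k<r. Q x i k * cf x (s x) k)"
      unfolding cf_def using section_coords[OF s V(1) t] i
      by (intro smooth_fun_sum smooth_fun_mult V(1) smooth_fun_mono[OF Q(4) V(2)]) auto
  qed
  moreover have "W' \<subseteq> W" using Q(3) by blast
  ultimately show ?thesis using that[OF Q(1,2) _ basis] by simp
qed

end

section \<open>Transitive Lie algebroids\<close>

locale transitive_la = smooth_vb M A
  for M :: "'m::{t2_space, second_countable_topology} manifold"
    and A :: "('m, 'v::real_vector) vbundle" +
  fixes \<rho> :: "'m \<Rightarrow> 'v \<Rightarrow> ('m \<Rightarrow> real) \<Rightarrow> real"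
    and br :: "('m \<Rightarrow> 'v) \<Rightarrow> ('m \<Rightarrow> 'v) \<Rightarrow> 'm \<Rightarrow> 'v"
  assumes tla: "transitive_lie_algebroid M A \<rho> br"
begin

abbreviation "n \<equiv> mdim M"

section \<open>The anchor in local coordinates\<close>

lemma la: "lie_algebroid M A \<rho> br" and anchor_surj: "\<rho> x ` fibre A x = tangent_space M x"
  using tla unfolding transitive_lie_algebroid_def by blast+

lemma anchor_morphism: "bundle_morphism M A (tangent_bundle M) \<rho>"
  and br_lie_algebra: "lie_algebra (sections M A) br"
  using la unfolding lie_algebroid_def by blast+

lemma anchor_linear: "linear_on_set (fibre A x) (\<rho> x)"
  using anchor_morphism unfolding bundle_morphism_def by (elim conjE allE[of _ x])

lemma anchor_in: "v \<in> fibre A x \<Longrightarrow> \<rho> x v \<in> tangent_space M x"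
  using anchor_surj by blast

lemma anchor_0: "\<rho> x 0 = 0"
  using linear_on_set_0[OF fibre_subspace anchor_linear] .

text \<open>The components of the vector field \<rho>(s) in the chart.\<close>

definition acoef :: "'m set \<Rightarrow> ('m \<Rightarrow> nat \<Rightarrow> real) \<Rightarrow> ('m \<Rightarrow> 'v) \<Rightarrow> 'm \<Rightarrow> nat \<Rightarrow> real" where
  "acoef U \<phi> s x = coords n (\<lambda>i. coord_vector M U \<phi> i x) (\<rho> x (s x))"

text \<open>\<open>bundle_morphism\<close> controls the anchor only on trivialising frames;
  linearity of the anchor and of coordinates transfers this to any smooth section.\<close>

lemma smooth_fun_acoef:
  assumes c: "(U, \<phi>) \<in> charts M" and W: "open W" and s: "smooth_section M A W s" and i: "i < n"
  shows "smooth_fun M (W \<inter> U) (\<lambda>x. acoef U \<phi> s x i)"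
proof (rule smooth_fun_local)
  fix x assume x: "x \<in> W \<inter> U"
  obtain V r \<Phi> where t: "(V, r, \<Phi>) \<in> trivs A" "x \<in> V" using triv_exists .
  let ?cf = "\<lambda>y. coords n (\<lambda>i. coord_vector M U \<phi> i y)"
  let ?O = "W \<inter> (V \<inter> U)"
  have O: "open ?O" using W triv_open[OF t(1)] chart_open[OF c] by auto
  have tb: "(U, n, \<lambda>x v. \<Sum>i<n. v i *\<^sub>R coord_vector M U \<phi> i x) \<in> trivs (tangent_bundle M)"
    using c unfolding tangent_bundle_def by auto
  have sm: "smooth_fun M (V \<inter> U) (\<lambda>y. ?cf y (\<rho> y (\<Phi> y (unit_vec j))) i)" if "j < r" for j
  proof -
    have "smooth_coords M (V \<inter> U) n (\<lambda>x v. \<Sum>i<n. v i *\<^sub>R coord_vector M U \<phi> i x) (\<lambda>x. \<rho> x (\<Phi> x (unit_vec j)))"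
      using anchor_morphism t(1) tb that unfolding bundle_morphism_def by fast
    then show ?thesis using i unfolding smooth_coords_def coords_def lincomb_def by blast
  qed
  have "smooth_fun M ?O (\<lambda>x. \<Sum>j<r. coords r (\<lambda>j. \<Phi> x (unit_vec j)) (s x) j * ?cf x (\<rho> x (\<Phi> x (unit_vec j))) i)"
  proof (rule smooth_fun_sum[OF O], rule smooth_fun_mult[OF O])
    fix j assume "j \<in> {..<r}"
    then have j: "j < r" by simp
    show "smooth_fun M ?O (\<lambda>x. coords r (\<lambda>j. \<Phi> x (unit_vec j)) (s x) j)"
      by (rule smooth_fun_mono[OF section_coords[OF s W t(1) j]]) blast
    show "smooth_fun M ?O (\<lambda>x. ?cf x (\<rho> x (\<Phi> x (unit_vec j))) i)"
      by (rule smooth_fun_mono[OF sm[OF j]]) blast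
  qed
  moreover have "(\<Sum>j<r. coords r (\<lambda>j. \<Phi> y (unit_vec j)) (s y) j * ?cf y (\<rho> y (\<Phi> y (unit_vec j))) i) = acoef U \<phi> s y i"
    if y: "y \<in> ?O" for y
  proof -
    have yV: "y \<in> V" "y \<in> U" "y \<in> W" using y by auto
    note b = triv_basis[OF t(1) yV(1)]
    let ?v = "coords r (\<lambda>j. \<Phi> y (unit_vec j)) (s y)"
    have "s y = lincomb r (\<lambda>j. \<Phi> y (unit_vec j)) ?v"
      using lincomb_coords[OF b section_in_fibre[OF s yV(3)]] by simp
    then have "\<rho> y (s y) = lincomb r (\<lambda>j. \<rho> y (\<Phi> y (unit_vec j))) ?v"
      using linear_on_set_lincomb_comp[OF fibre_subspace anchor_linear is_basis_mem[OF b], of r "\<lambda>j. j" ?v] by simp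
    moreover have "?cf y (lincomb r (\<lambda>j. \<rho> y (\<Phi> y (unit_vec j))) ?v) = lincomb r (\<lambda>j. ?cf y (\<rho> y (\<Phi> y (unit_vec j)))) ?v"
      by (rule linear_on_set_lincomb_comp[OF subspace_tangent_space
            linear_on_set_coords[OF coord_vector_basis[OF c yV(2)]] anchor_in[OF is_basis_mem[OF b]]])
    ultimately show ?thesis unfolding acoef_def by (simp add: lincomb_def sum_fun_apply)
  qed
  ultimately have "smooth_fun M ?O (\<lambda>x. acoef U \<phi> s x i)"
    by (rule smooth_fun_cong[OF O, rotated])
  then show "\<exists>V. open V \<and> x \<in> V \<and> smooth_fun M V (\<lambda>x. acoef U \<phi> s x i)"
    using O x t(2) by blast
qed

lemma anchor_acoef:
  assumes "(U, \<phi>) \<in> charts M" "x \<in> U" "s x \<in> fibre A x"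
  shows "\<rho> x (s x) = lincomb n (\<lambda>i. coord_vector M U \<phi> i x) (acoef U \<phi> s x)"
  unfolding acoef_def using lincomb_coords[OF coord_vector_basis[OF assms(1,2)] anchor_in[OF assms(3)]] by simp

lemma sections_smooth: "s \<in> sections M A \<Longrightarrow> open W \<Longrightarrow> smooth_section M A W s"
  unfolding sections_def using smooth_section_mono[of UNIV s W] by simp

lemma sections_in: "s \<in> sections M A \<Longrightarrow> s x \<in> fibre A x"
  using section_in_fibre[OF sections_smooth[OF _ open_UNIV]] by blast

lemma sectionsI: "smooth_section M A UNIV s \<Longrightarrow> s \<in> sections M A"
  unfolding sections_def by blast

lemma anchor_fun_smooth:
  assumes s: "s \<in> sections M A" and f: "f \<in> C_infinity M"
  shows "(\<lambda>x. \<rho> x (s x) f) \<in> C_infinity M"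
proof (rule C_infinityI, rule smooth_fun_local)
  fix x :: 'm
  obtain U \<phi> where c: "(U, \<phi>) \<in> charts M" "x \<in> U" using chart_exists .
  note oU = chart_open[OF c(1)]
  have "smooth_fun M U (\<lambda>x. acoef U \<phi> s x i)" if "i < n" for i
    using smooth_fun_acoef[OF c(1) open_UNIV sections_smooth[OF s open_UNIV] that] by simp
  then have "smooth_fun M U (\<lambda>x. \<Sum>i<n. acoef U \<phi> s x i * pd U \<phi> i f x)"
    by (intro smooth_fun_sum smooth_fun_mult oU smooth_fun_pd[OF c(1) oU order_refl C_infinityD[OF f]]) auto
  moreover have "(\<Sum>i<n. acoef U \<phi> s y i * pd U \<phi> i f y) = \<rho> y (s y) f" if "y \<in> U" for y
    using anchor_acoef[of U \<phi> y s, OF c(1) that sections_in[OF s]] f by (simp add: lincomb_def sum_fun_apply coord_vector_apply)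
  ultimately have "smooth_fun M U (\<lambda>x. \<rho> x (s x) f)"
    by (rule smooth_fun_cong[OF oU, rotated])
  then show "\<exists>V. open V \<and> x \<in> V \<and> smooth_fun M V (\<lambda>x. \<rho> x (s x) f)" using oU c(2) by blast
qed

subsection \<open>Properties of the bracket\<close>

lemma sections_subspace: "subspace (sections M A)"
  and br_in: "a \<in> sections M A \<Longrightarrow> b \<in> sections M A \<Longrightarrow> br a b \<in> sections M A"
  and br_linear_right: "a \<in> sections M A \<Longrightarrow> linear_on_set (sections M A) (br a)"
  and br_linear_left: "b \<in> sections M A \<Longrightarrow> linear_on_set (sections M A) (\<lambda>a. br a b)"
  and br_self: "a \<in> sections M A \<Longrightarrow> br a a = 0"
  and br_jacobi: "a \<in> sections M A \<Longrightarrow> b \<in> sections M A \<Longrightarrow> c \<in> sections M A \<Longrightarrow>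
    br a (br b c) + br b (br c a) + br c (br a b) = 0"
  using br_lie_algebra unfolding lie_algebra_def by blast+

lemma br_anti:
  assumes "a \<in> sections M A" "b \<in> sections M A"
  shows "br a b x = - br b a x"
proof -
  have "br (a + b) (a + b) = br a a + br a b + (br b a + br b b)"
    using assms linear_on_set_add[OF br_linear_left] linear_on_set_add[OF br_linear_right]
      subspace_add[OF sections_subspace] by simp
  then have "br a b + br b a = 0"
    using br_self assms subspace_add[OF sections_subspace] by simp
  then have "(br a b + br b a) x = 0" by simp
  then show ?thesis by (simp add: eq_neg_iff_add_eq_0)
qed

lemma br_jacobi_left:
  assumes "a \<in> sections M A" "b \<in> sections M A" "c \<in> sections M A"
  shows "br a (br b c) x = br (br a b) c x + br b (br a c) x"
proof -
  have "(br a (br b c) + br b (br c a) + br c (br a b)) x = 0"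
    using br_jacobi[OF assms] by simp
  moreover have "br c (br a b) x = - br (br a b) c x"
    using br_anti assms br_in by blast
  moreover have "br c a = - br a c" using br_anti[OF assms(3,1)] by (auto simp: fun_eq_iff)
  then have "br b (br c a) x = - br b (br a c) x"
    using linear_on_set_scale[OF br_linear_right[OF assms(2)] br_in[OF assms(1,3)], of "-1"] by simp
  ultimately show ?thesis by (simp add: algebra_simps add_eq_0_iff)
qed

lemma section_scale: "f \<in> C_infinity M \<Longrightarrow> a \<in> sections M A \<Longrightarrow> (\<lambda>x. f x *\<^sub>R a x) \<in> sections M A"
  by (rule sectionsI, rule smooth_section_scale[OF open_UNIV C_infinityD sections_smooth[OF _ open_UNIV]])

lemma leibniz_right:
  assumes "a \<in> sections M A" "b \<in> sections M A" "f \<in> C_infinity M"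
  shows "br a (\<lambda>x. f x *\<^sub>R b x) x = f x *\<^sub>R br a b x + \<rho> x (a x) f *\<^sub>R b x"
proof -
  have "br a (\<lambda>x. f x *\<^sub>R b x) = (\<lambda>x. f x *\<^sub>R br a b x + \<rho> x (a x) f *\<^sub>R b x)"
    using la assms unfolding lie_algebroid_def by blast
  then show ?thesis by (rule fun_cong)
qed

text \<open>Locality of the bracket: for a bump function \<eta> supported in V and equal to 1 near
  x, b = (1 - \<eta>) b, and both terms of the Leibniz rule vanish at x, since 1 - \<eta> and b
  do.\<close>

lemma br_zero_near:
  assumes "a \<in> sections M A" "b \<in> sections M A" "open V" "x \<in> V" "\<And>y. y \<in> V \<Longrightarrow> b y = 0"
  shows "br a b x = 0"
proof -
  obtain \<eta> V' C where \<eta>: "smooth_fun M UNIV \<eta>" "open V'" "x \<in> V'" "V' \<subseteq> V" "\<And>y. y \<in> V' \<Longrightarrow> \<eta> y = 1"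
    "closed C" "C \<subseteq> V" "\<And>y. y \<notin> C \<Longrightarrow> \<eta> y = 0"
    using bump_exists[OF assms(3,4)] by metis
  define f where "f y = 1 - \<eta> y" for y
  have f: "f \<in> C_infinity M"
    unfolding f_def by (intro C_infinityI smooth_fun_diff smooth_fun_const open_UNIV \<eta>(1))
  have "b = (\<lambda>y. f y *\<^sub>R b y)"
  proof
    fix y show "b y = f y *\<^sub>R b y"
    proof (cases "y \<in> V")
      case False
      then have "\<eta> y = 0" using \<eta>(7,8) by blast
      then show ?thesis by (simp add: f_def)
    qed (simp add: assms(5))
  qed
  then have "br a b x = f x *\<^sub>R br a b x + \<rho> x (a x) f *\<^sub>R b x"
    using leibniz_right[OF assms(1,2) f, of x] by metis
  moreover have "f x = 0" using \<eta>(3,5) by (simp add: f_def)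
  ultimately show ?thesis using assms(4,5) by simp
qed

lemma br_cong_right:
  assumes "a \<in> sections M A" "b \<in> sections M A" "b' \<in> sections M A" "open V" "x \<in> V" "\<And>y. y \<in> V \<Longrightarrow> b y = b' y"
  shows "br a b x = br a b' x"
proof -
  have "br a (b - b') x = 0"
    using assms by (intro br_zero_near[OF _ subspace_diff[OF sections_subspace]]) auto
  then show ?thesis
    using linear_on_set_diff[OF sections_subspace br_linear_right assms(2,3)] assms(1) by simp
qed

lemma section_lincomb:
  assumes "\<And>j. j < m \<Longrightarrow> f j \<in> C_infinity M" "\<And>j. j < m \<Longrightarrow> b j \<in> sections M A"
  shows "(\<lambda>x. lincomb m (\<lambda>j. b j x) (\<lambda>j. f j x)) \<in> sections M A"
  by (rule sectionsI, rule smooth_section_lincomb[OF open_UNIV C_infinityD sections_smooth[OF _ open_UNIV]])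
    (rule assms, assumption)+

lemma leibniz_lincomb:
  assumes "a \<in> sections M A" "\<And>j. j < m \<Longrightarrow> f j \<in> C_infinity M" "\<And>j. j < m \<Longrightarrow> b j \<in> sections M A"
  shows "br a (\<lambda>x. lincomb m (\<lambda>j. b j x) (\<lambda>j. f j x)) x
    = lincomb m (\<lambda>j. br a (b j) x) (\<lambda>j. f j x) + lincomb m (\<lambda>j. b j x) (\<lambda>j. \<rho> x (a x) (f j))"
  using assms(2,3)
proof (induction m)
  case 0
  have "br a 0 = 0" using linear_on_set_0[OF sections_subspace br_linear_right[OF assms(1)]] .
  then show ?case by (simp add: lincomb_def zero_fun_def)
next
  case (Suc m)
  have eq: "(\<lambda>x. lincomb (Suc m) (\<lambda>j. b j x) (\<lambda>j. f j x))
      = (\<lambda>x. lincomb m (\<lambda>j. b j x) (\<lambda>j. f j x)) + (\<lambda>x. f m x *\<^sub>R b m x)"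
    by (simp add: lincomb_def plus_fun_def)
  have "br a (\<lambda>x. lincomb (Suc m) (\<lambda>j. b j x) (\<lambda>j. f j x)) x
      = br a (\<lambda>x. lincomb m (\<lambda>j. b j x) (\<lambda>j. f j x)) x + br a (\<lambda>x. f m x *\<^sub>R b m x) x"
    unfolding eq
    by (subst linear_on_set_add[OF br_linear_right[OF assms(1)] section_lincomb section_scale])
      (use Suc.prems in auto)
  then show ?case
    using Suc leibniz_right[OF assms(1), of "b m" "f m" x] by (simp add: lincomb_def)
qed

text \<open>The definition of a Lie algebroid does not require the anchor to preserve brackets: this follows
  by expanding the Jacobi identity of \<open>a\<close>, \<open>b\<close> and \<open>f c\<close>.\<close>

lemma anchor_br:
  assumes a: "a \<in> sections M A" and b: "b \<in> sections M A" and f: "f \<in> C_infinity M"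
  shows "\<rho> x (br a b x) f = \<rho> x (a x) (\<lambda>y. \<rho> y (b y) f) - \<rho> x (b x) (\<lambda>y. \<rho> y (a y) f)"
proof (cases "fibre A x = {0}")
  case True
  have "br a b x = 0" "a x = 0" "b x = 0"
    using sections_in[OF br_in[OF a b], of x] sections_in[OF a, of x] sections_in[OF b, of x] True by auto
  then show ?thesis by (simp add: anchor_0)
next
  case False
  \<comment> \<open>The comparison below only shows that a number times \<open>c x\<close> is 0. A
    section c with nonzero value u at x allows the cancellation.\<close>
  then obtain u where u: "u \<in> fibre A x" "u \<noteq> 0"
    using subspace_0[OF fibre_subspace[of x]] by blast
  obtain V r \<Phi> where t: "(V, r, \<Phi>) \<in> trivs A" "x \<in> V" using triv_exists .
  obtain \<eta> V' C where \<eta>: "smooth_fun M UNIV \<eta>" "open V'" "x \<in> V'" "V' \<subseteq> V" "\<And>y. y \<in> V' \<Longrightarrow> \<eta> y = 1"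
    "closed C" "C \<subseteq> V" "\<And>y. y \<notin> C \<Longrightarrow> \<eta> y = 0"
    using bump_exists[OF triv_open[OF t(1)] t(2)] by metis
  define v where "v = coords r (\<lambda>j. \<Phi> x (unit_vec j)) u"
  define c where "c y = \<eta> y *\<^sub>R lincomb r (\<lambda>j. \<Phi> y (unit_vec j)) v" for y
  have "smooth_section M A V (\<lambda>y. lincomb r (\<lambda>j. \<Phi> y (unit_vec j)) v)"
    by (intro smooth_section_lincomb triv_open[OF t(1)] smooth_fun_const smooth_section_triv[OF t(1)])
  from smooth_section_extend[OF \<eta>(1,6,7,8) triv_open[OF t(1)] this]
  have c: "c \<in> sections M A" unfolding c_def .
  have cx: "c x = u"
    unfolding c_def v_def using lincomb_coords[OF triv_basis[OF t] u(1)] \<eta>(3,5) by simp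
  have bf: "(\<lambda>y. \<rho> y (b y) f) \<in> C_infinity M" (is "?bf \<in> _") using anchor_fun_smooth[OF b f] .
  have af: "(\<lambda>y. \<rho> y (a y) f) \<in> C_infinity M" (is "?af \<in> _") using anchor_fun_smooth[OF a f] .
  let ?fc = "\<lambda>y. f y *\<^sub>R c y"
  note fc = section_scale[OF f c]
  \<comment> \<open>The two middle terms are symmetric in d and e. They cancel in the difference for
    (a, b) and (b, a), leaving only second-order terms in f.\<close>
  have J: "br d (br e ?fc) x = f x *\<^sub>R br d (br e c) x + \<rho> x (d x) f *\<^sub>R br e c x
      + \<rho> x (e x) f *\<^sub>R br d c x + \<rho> x (d x) (\<lambda>y. \<rho> y (e y) f) *\<^sub>R c x"
    if d: "d \<in> sections M A" and e: "e \<in> sections M A" for d e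
  proof -
    have ef: "(\<lambda>y. \<rho> y (e y) f) \<in> C_infinity M" using anchor_fun_smooth[OF e f] .
    have "br e ?fc = (\<lambda>y. f y *\<^sub>R br e c y) + (\<lambda>y. \<rho> y (e y) f *\<^sub>R c y)"
      using leibniz_right[OF e c f] by (auto simp: fun_eq_iff)
    then have "br d (br e ?fc) = br d (\<lambda>y. f y *\<^sub>R br e c y) + br d (\<lambda>y. \<rho> y (e y) f *\<^sub>R c y)"
      using linear_on_set_add[OF br_linear_right[OF d] section_scale[OF f br_in[OF e c]] section_scale[OF ef c]] by simp
    then show ?thesis
      using leibniz_right[OF d br_in[OF e c] f, of x] leibniz_right[OF d c ef, of x] by simp
  qed
  have "br a (br b ?fc) x = br (br a b) ?fc x + br b (br a ?fc) x"
    by (rule br_jacobi_left[OF a b fc])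
  moreover have "br (br a b) ?fc x = f x *\<^sub>R br (br a b) c x + \<rho> x (br a b x) f *\<^sub>R c x"
    by (rule leibniz_right[OF br_in[OF a b] c f])
  moreover have "br a (br b c) x = br (br a b) c x + br b (br a c) x"
    by (rule br_jacobi_left[OF a b c])
  ultimately have "\<rho> x (a x) ?bf *\<^sub>R c x = \<rho> x (br a b x) f *\<^sub>R c x + \<rho> x (b x) ?af *\<^sub>R c x"
    using J[OF a b] J[OF b a] by (simp add: algebra_simps)
  then have "(\<rho> x (a x) ?bf - \<rho> x (b x) ?af - \<rho> x (br a b x) f) *\<^sub>R c x = 0"
    by (simp add: algebra_simps)
  then show ?thesis using cx u(2) by simp
qed

subsection \<open>The kernel of the anchor\<close>

definition kfibre :: "'m \<Rightarrow> 'v set" where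
  "kfibre x = {v \<in> fibre A x. \<rho> x v = 0}"

lemma kfibre_subspace: "subspace (kfibre x)"
  unfolding subspace_def kfibre_def
  using fibre_subspace anchor_linear anchor_0
  by (auto simp: subspace_0 subspace_add subspace_scale linear_on_set_add[OF anchor_linear] linear_on_set_scale[OF anchor_linear])

text \<open>Surjectivity of the anchor gives lifts at x0 only. Any smooth extensions have anchor
  components forming a matrix that is the identity at x0; multiplying by its smooth inverse makes
  them lifts nearby.\<close>

lemma local_lifts:
  assumes c: "(U, \<phi>) \<in> charts M" "x0 \<in> U"
  shows "\<exists>W s. open W \<and> x0 \<in> W \<and> W \<subseteq> U \<and> (\<forall>i<n. smooth_section M A W (s i)) \<and>
    (\<forall>i<n. \<forall>x\<in>W. \<rho> x (s i x) = coord_vector M U \<phi> i x)"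
proof -
  have "\<exists>u. u \<in> fibre A x0 \<and> \<rho> x0 u = coord_vector M U \<phi> i x0" if "i < n" for i
    using anchor_surj[of x0] coord_vector_tangent[OF c that] by (metis imageE)
  then obtain \<alpha> where \<alpha>: "\<And>i. i < n \<Longrightarrow> \<alpha> i \<in> fibre A x0" "\<And>i. i < n \<Longrightarrow> \<rho> x0 (\<alpha> i) = coord_vector M U \<phi> i x0"
    by metis
  obtain V r \<Phi> where t: "(V, r, \<Phi>) \<in> trivs A" "x0 \<in> V" using triv_exists .
  note oV = triv_open[OF t(1)]
  \<comment> \<open>Extension of the vector \<open>\<alpha> i\<close> with constant coordinates in
    the trivialisation.\<close>
  define a where "a i x = lincomb r (\<lambda>j. \<Phi> x (unit_vec j)) (coords r (\<lambda>j. \<Phi> x0 (unit_vec j)) (\<alpha> i))" for i x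
  have a: "smooth_section M A V (a i)" for i
    unfolding a_def by (intro smooth_section_lincomb oV smooth_fun_const smooth_section_triv[OF t(1)])
  have a0: "a i x0 = \<alpha> i" if "i < n" for i
    unfolding a_def using lincomb_coords[OF triv_basis[OF t] \<alpha>(1)[OF that]] .
  have o: "open (V \<inter> U)" using oV chart_open[OF c(1)] by auto
  have x0: "x0 \<in> V \<inter> U" using t(2) c(2) by blast
  have P: "smooth_fun M (V \<inter> U) (\<lambda>x. acoef U \<phi> (a i) x l)" if "l < n" "i < n" for l i
    using smooth_fun_acoef[OF c(1) oV a that(1)] .
  have P0: "acoef U \<phi> (a i) x0 l = (if l = i then 1 else 0)" if "l < n" "i < n" for l i
  proof -
    have "coords n (\<lambda>i. coord_vector M U \<phi> i x0) (coord_vector M U \<phi> i x0) = unit_vec i"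
      using coords_lincomb[OF coord_vector_basis[OF c] unit_vec_Rn[OF that(2)]] unfolding lincomb_unit_vec[OF that(2)] .
    then show ?thesis
      unfolding acoef_def a0[OF that(2)] \<alpha>(2)[OF that(2)] by (simp add: Defs.unit_vec_def)
  qed
  have inj: "v = 0" if v: "v \<in> Rn n" "\<And>l. l < n \<Longrightarrow> (\<Sum>i<n. acoef U \<phi> (a i) x0 l * v i) = 0" for v
  proof -
    have "v l = 0" if "l < n" for l
    proof -
      have "(\<Sum>i<n. acoef U \<phi> (a i) x0 l * v i) = (\<Sum>i<n. if l = i then v i else 0)"
        using P0[OF that] by (intro sum.cong) auto
      then show ?thesis using v(2)[OF that] that by simp
    qed
    then show "v = 0" using v(1) unfolding Rn_iff by (auto simp: fun_eq_iff not_less[symmetric])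
  qed
  obtain W Q where Q: "open W" "x0 \<in> W" "W \<subseteq> V \<inter> U"
    "\<And>i j. i < n \<Longrightarrow> j < n \<Longrightarrow> smooth_fun M W (\<lambda>x. Q x i j)"
    "\<And>x i k. x \<in> W \<Longrightarrow> i < n \<Longrightarrow> k < n \<Longrightarrow> (\<Sum>j<n. acoef U \<phi> (a j) x i * Q x j k) = (if i = k then 1 else 0)"
  proof (rule smooth_matrix_inverse[where S="\<lambda>x l i. acoef U \<phi> (a i) x l", OF o x0 P inj])
    fix W Q
    assume q: "open W" "x0 \<in> W" "W \<subseteq> V \<inter> U"
      "\<And>i j. i < n \<Longrightarrow> j < n \<Longrightarrow> smooth_fun M W (\<lambda>x. Q x i j)"
      "\<And>x i k. x \<in> W \<Longrightarrow> i < n \<Longrightarrow> k < n \<Longrightarrow> (\<Sum>j<n. acoef U \<phi> (a j) x i * Q x j k) = (if i = k then 1 else 0)"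
    show thesis by (rule that[OF q])
  qed
  \<comment> \<open>The inverse matrix acts on the frame index, so that the anchor components of
    \<open>s i\<close> become those of the i-th unit vector.\<close>
  define s where "s i x = lincomb n (\<lambda>k. a k x) (\<lambda>k. Q x k i)" for i x
  have WV: "W \<subseteq> V" using Q(3) by blast
  have "smooth_section M A W (s i)" if "i < n" for i
    unfolding s_def by (intro smooth_section_lincomb Q(1,4) that smooth_section_mono[OF a oV Q(1) WV])
  moreover have "\<rho> x (s i x) = coord_vector M U \<phi> i x" if i: "i < n" and x: "x \<in> W" for i x
  proof -
    have xU: "x \<in> U" "x \<in> V" using x Q(3) by auto
    note ax = section_in_fibre[OF a xU(2)]
    have "\<rho> x (s i x) = lincomb n (\<lambda>k. \<rho> x (a k x)) (\<lambda>k. Q x k i)"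
      unfolding s_def by (rule linear_on_set_lincomb_comp[OF fibre_subspace anchor_linear ax])
    also have "\<dots> = lincomb n (\<lambda>k. lincomb n (\<lambda>l. coord_vector M U \<phi> l x) (acoef U \<phi> (a k) x)) (\<lambda>k. Q x k i)"
      using anchor_acoef[of U \<phi> x "a _", OF c(1) xU(1) ax] by simp
    also have "\<dots> = (\<Sum>k<n. \<Sum>l<n. (Q x k i * acoef U \<phi> (a k) x l) *\<^sub>R coord_vector M U \<phi> l x)"
      unfolding lincomb_def by (simp add: scaleR_sum_right)
    also have "\<dots> = (\<Sum>l<n. (\<Sum>k<n. acoef U \<phi> (a k) x l * Q x k i) *\<^sub>R coord_vector M U \<phi> l x)"
      by (subst sum.swap) (simp add: scaleR_sum_left mult.commute)
    also have "\<dots> = lincomb n (\<lambda>l. coord_vector M U \<phi> l x) (unit_vec i)"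
      unfolding lincomb_def using Q(5)[OF x _ i] by (intro sum.cong) (auto simp: Defs.unit_vec_def)
    also have "\<dots> = coord_vector M U \<phi> i x" by (rule lincomb_unit_vec[OF i])
    finally show ?thesis .
  qed
  ultimately show ?thesis using Q(1,2,3) by blast
qed

text \<open>Together with the lifts s, the sections e form a frame of A at x0, so
  \<open>frame_nearby\<close> applies to A. \<open>is_basis_append_kernel\<close> translates its
  conclusions back: the e are bases of the kernel nearby, and kernel coefficients are the last m
  coefficients in the big frame.\<close>

lemma kernel_frame_nearby:
  assumes c: "(U, \<phi>) \<in> charts M" and W: "open W" "x0 \<in> W" "W \<subseteq> U"
    and s: "\<And>i. i < n \<Longrightarrow> smooth_section M A W (s i)"
      "\<And>i x. i < n \<Longrightarrow> x \<in> W \<Longrightarrow> \<rho> x (s i x) = coord_vector M U \<phi> i x"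
    and e: "\<And>j. j < m \<Longrightarrow> smooth_section M A W (e j)" "\<And>j x. j < m \<Longrightarrow> x \<in> W \<Longrightarrow> \<rho> x (e j x) = 0"
    and e0: "is_basis m (\<lambda>j. e j x0) (kfibre x0)"
  shows "\<exists>W'. open W' \<and> x0 \<in> W' \<and> W' \<subseteq> W \<and> (\<forall>x\<in>W'. is_basis m (\<lambda>j. e j x) (kfibre x)) \<and>
    (\<forall>V \<sigma> j. open V \<and> V \<subseteq> W' \<and> smooth_section M A V \<sigma> \<and> (\<forall>x\<in>V. \<rho> x (\<sigma> x) = 0) \<and> j < m \<longrightarrow>
      smooth_fun M V (\<lambda>x. coords m (\<lambda>j. e j x) (\<sigma> x) j))"
proof -
  define b where "b x = append_frame n (\<lambda>i. s i x) (\<lambda>j. e j x)" for x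
  have b: "smooth_section M A W (\<lambda>x. b x j)" if "j < n + m" for j
    using s(1) e(1) that unfolding b_def append_frame_def by (cases "j < n") auto
  have app: "is_basis (n + m) (b x) (fibre A x) \<longleftrightarrow> is_basis m (\<lambda>j. e j x) (kfibre x)"
    "is_basis m (\<lambda>j. e j x) (kfibre x) \<Longrightarrow> u \<in> fibre A x \<Longrightarrow> \<rho> x u = 0 \<Longrightarrow> j < m \<Longrightarrow>
      coords (n + m) (b x) u (n + j) = coords m (\<lambda>j. e j x) u j" if x: "x \<in> W" for x u j
  proof -
    have xU: "x \<in> U" using x W by blast
    have im: "\<rho> x ` fibre A x \<subseteq> tangent_space M x" using anchor_in by blast
    note ap = is_basis_append_kernel[OF fibre_subspace anchor_linear im coord_vector_basis[OF c xU],
      of "\<lambda>i. s i x" m "\<lambda>j. e j x"]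
    show "is_basis (n + m) (b x) (fibre A x) \<longleftrightarrow> is_basis m (\<lambda>j. e j x) (kfibre x)"
      unfolding b_def kfibre_def
      by (rule ap(1)) (use s(2) e(2) x section_in_fibre[OF s(1)] section_in_fibre[OF e(1)] in auto)
    show "is_basis m (\<lambda>j. e j x) (kfibre x) \<Longrightarrow> u \<in> fibre A x \<Longrightarrow> \<rho> x u = 0 \<Longrightarrow> j < m \<Longrightarrow>
      coords (n + m) (b x) u (n + j) = coords m (\<lambda>j. e j x) u j"
      unfolding b_def kfibre_def
      by (rule ap(2)) (use s(2) e(2) x section_in_fibre[OF s(1)] section_in_fibre[OF e(1)] in auto)
  qed
  have b0: "is_basis (n + m) (b x0) (fibre A x0)" using app(1)[OF W(2)] e0 by blast
  obtain W' where W': "open W'" "x0 \<in> W'" "W' \<subseteq> W" "\<And>x. x \<in> W' \<Longrightarrow> is_basis (n + m) (b x) (fibre A x)"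
    "\<And>V s i. open V \<Longrightarrow> V \<subseteq> W' \<Longrightarrow> smooth_section M A V s \<Longrightarrow> i < n + m \<Longrightarrow>
      smooth_fun M V (\<lambda>x. coords (n + m) (b x) (s x) i)"
  proof (rule frame_nearby[OF W(1,2) b b0])
    fix W' assume w: "open W'" "x0 \<in> W'" "W' \<subseteq> W" "\<And>x. x \<in> W' \<Longrightarrow> is_basis (n + m) (b x) (fibre A x)"
      "\<And>V s i. open V \<Longrightarrow> V \<subseteq> W' \<Longrightarrow> smooth_section M A V s \<Longrightarrow> i < n + m \<Longrightarrow>
        smooth_fun M V (\<lambda>x. coords (n + m) (b x) (s x) i)"
    show thesis by (rule that[OF w])
  qed
  have basis: "is_basis m (\<lambda>j. e j x) (kfibre x)" if "x \<in> W'" for x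
    using app(1)[of x] W'(3,4) that by blast
  have sm: "smooth_fun M V (\<lambda>x. coords m (\<lambda>j. e j x) (\<sigma> x) j)"
    if V: "open V" "V \<subseteq> W'" "smooth_section M A V \<sigma>" "\<forall>x\<in>V. \<rho> x (\<sigma> x) = 0" and j: "j < m" for V \<sigma> j
  proof (rule smooth_fun_cong[OF V(1)])
    show "smooth_fun M V (\<lambda>x. coords (n + m) (b x) (\<sigma> x) (n + j))"
      by (rule W'(5)[OF V(1-3)]) (use j in simp)
    fix x assume x: "x \<in> V"
    have "x \<in> W'" using x V(2) by blast
    moreover have "x \<in> W" using \<open>x \<in> W'\<close> W'(3) by blast
    ultimately show "coords (n + m) (b x) (\<sigma> x) (n + j) = coords m (\<lambda>j. e j x) (\<sigma> x) j"
      using app(2)[of x "\<sigma> x" j] basis section_in_fibre[OF V(3) x] V(4) x j by blast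
  qed
  show ?thesis
  proof (intro exI[of _ W'] conjI allI impI ballI W'(1-3))
    show "is_basis m (\<lambda>j. e j x) (kfibre x)" if "x \<in> W'" for x using basis[OF that] .
    fix V \<sigma> j
    assume "open V \<and> V \<subseteq> W' \<and> smooth_section M A V \<sigma> \<and> (\<forall>x\<in>V. \<rho> x (\<sigma> x) = 0) \<and> j < m"
    then show "smooth_fun M V (\<lambda>x. coords m (\<lambda>j. e j x) (\<sigma> x) j)"
      by (elim conjE) (rule sm)
  qed
qed

text \<open>A basis of the kernel at x0 is extended to sections of A, which may leave the kernel
  away from x0. Subtracting the lift of their anchor projects them back into the kernel and changes
  nothing at x0.\<close>

lemma kernel_frame_exists:
  assumes c: "(U, \<phi>) \<in> charts M" and W: "open W" "x0 \<in> W" "W \<subseteq> U"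
    and s: "\<And>i. i < n \<Longrightarrow> smooth_section M A W (s i)"
      "\<And>i x. i < n \<Longrightarrow> x \<in> W \<Longrightarrow> \<rho> x (s i x) = coord_vector M U \<phi> i x"
  shows "\<exists>V m e. open V \<and> x0 \<in> V \<and> V \<subseteq> W \<and> (\<forall>j<m. smooth_section M A V (e j)) \<and>
    (\<forall>j<m. \<forall>x\<in>V. \<rho> x (e j x) = 0) \<and> is_basis m (\<lambda>j. e j x0) (kfibre x0)"
proof -
  obtain V r \<Phi> where t: "(V, r, \<Phi>) \<in> trivs A" "x0 \<in> V" using triv_exists .
  note oV = triv_open[OF t(1)]
  have "kfibre x0 \<subseteq> fibre A x0" unfolding kfibre_def by blast
  then obtain m \<kappa> where \<kappa>: "is_basis m \<kappa> (kfibre x0)"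
    using is_basis_exists[OF triv_basis[OF t] kfibre_subspace] by blast
  have \<kappa>A: "\<kappa> j \<in> fibre A x0" "\<rho> x0 (\<kappa> j) = 0" if "j < m" for j
    using is_basis_mem[OF \<kappa> that] unfolding kfibre_def by auto
  define k where "k j x = lincomb r (\<lambda>i. \<Phi> x (unit_vec i)) (coords r (\<lambda>i. \<Phi> x0 (unit_vec i)) (\<kappa> j))" for j x
  have k: "smooth_section M A V (k j)" for j
    unfolding k_def by (intro smooth_section_lincomb oV smooth_fun_const smooth_section_triv[OF t(1)])
  have k0: "k j x0 = \<kappa> j" if "j < m" for j
    unfolding k_def using lincomb_coords[OF triv_basis[OF t] \<kappa>A(1)[OF that]] .
  \<comment> \<open>The combination of the lifts has anchor minus that of
    \<open>k j\<close>.\<close>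
  define e where "e j x = k j x + lincomb n (\<lambda>i. s i x) (\<lambda>i. (-1) * acoef U \<phi> (k j) x i)" for j x
  let ?V = "V \<inter> W"
  have o: "open ?V" using oV W by auto
  have kV: "smooth_fun M ?V (\<lambda>x. acoef U \<phi> (k j) x i)" if "i < n" for i j
    by (rule smooth_fun_mono[OF smooth_fun_acoef[OF c oV k that]]) (use W(3) in blast)
  have "smooth_section M A ?V (e j)" for j
    unfolding e_def
    by (intro smooth_section_add o smooth_section_lincomb smooth_fun_mult smooth_fun_const kV
        smooth_section_mono[OF k oV o] smooth_section_mono[OF s(1) W(1) o]) auto
  moreover have "\<rho> x (e j x) = 0" if x: "x \<in> ?V" for j x
  proof -
    have xx: "x \<in> V" "x \<in> W" "x \<in> U" using x W(3) by auto
    have kx: "k j x \<in> fibre A x" using section_in_fibre[OF k xx(1)] .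
    have sx: "s i x \<in> fibre A x" if "i < n" for i using section_in_fibre[OF s(1)[OF that] xx(2)] .
    have "\<rho> x (e j x) = \<rho> x (k j x) + lincomb n (\<lambda>i. \<rho> x (s i x)) (\<lambda>i. (-1) * acoef U \<phi> (k j) x i)"
      unfolding e_def
      using linear_on_set_add[OF anchor_linear kx lincomb_in[OF fibre_subspace sx]]
        linear_on_set_lincomb_comp[OF fibre_subspace anchor_linear sx] by simp
    also have "lincomb n (\<lambda>i. \<rho> x (s i x)) (\<lambda>i. (-1) * acoef U \<phi> (k j) x i)
        = lincomb n (\<lambda>i. coord_vector M U \<phi> i x) ((-1) *\<^sub>R acoef U \<phi> (k j) x)"
      by (rule lincomb_cong) (use s(2) xx in auto)
    also have "\<dots> = - \<rho> x (k j x)"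
      unfolding lincomb_scale using anchor_acoef[of U \<phi> x "k j", OF c xx(3)] kx by simp
    finally show ?thesis by (simp add: zero_fun_def)
  qed
  moreover have "e j x0 = \<kappa> j" if j: "j < m" for j
  proof -
    have "acoef U \<phi> (k j) x0 = 0"
      unfolding acoef_def k0[OF j] \<kappa>A(2)[OF j]
      using linear_on_set_0[OF subspace_tangent_space linear_on_set_coords[OF coord_vector_basis[OF c]]] W by blast
    then have "lincomb n (\<lambda>i. s i x0) (\<lambda>i. (-1) * acoef U \<phi> (k j) x0 i) = lincomb n (\<lambda>i. s i x0) 0"
      by (intro lincomb_cong) auto
    then show ?thesis unfolding e_def k0[OF j] by (simp add: lincomb_0)
  qed
  then have "is_basis m (\<lambda>j. e j x0) (kfibre x0)"
    using is_basis_cong[of m "\<lambda>j. e j x0" \<kappa>] \<kappa> by blast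
  ultimately show ?thesis using o t(2) W(2) by (intro exI[of _ ?V] exI[of _ m] exI[of _ e]) auto
qed

text \<open>The bracket is defined on global sections only, so the local lifts \<open>S i\<close> of the coordinate vector fields
  and the local frame \<open>E j\<close> of the kernel are cut off to global sections.\<close>

definition adapted_frame ::
  "'m set \<Rightarrow> ('m \<Rightarrow> nat \<Rightarrow> real) \<Rightarrow> 'm set \<Rightarrow> (nat \<Rightarrow> 'm \<Rightarrow> 'v) \<Rightarrow> nat \<Rightarrow> (nat \<Rightarrow> 'm \<Rightarrow> 'v) \<Rightarrow> bool" where
  "adapted_frame U \<phi> W S m E \<longleftrightarrow> (U, \<phi>) \<in> charts M \<and> open W \<and> W \<subseteq> U \<and>
    (\<forall>i<n. S i \<in> sections M A \<and> (\<forall>x\<in>W. \<rho> x (S i x) = coord_vector M U \<phi> i x)) \<and>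
    (\<forall>j<m. E j \<in> sections M A \<and> (\<forall>x. \<rho> x (E j x) = 0)) \<and>
    (\<forall>x\<in>W. is_basis m (\<lambda>j. E j x) (kfibre x)) \<and>
    (\<forall>V \<sigma> j. open V \<and> V \<subseteq> W \<and> smooth_section M A V \<sigma> \<and> (\<forall>x\<in>V. \<rho> x (\<sigma> x) = 0) \<and> j < m \<longrightarrow>
      smooth_fun M V (\<lambda>x. coords m (\<lambda>j. E j x) (\<sigma> x) j))"

text \<open>After multiplication by a bump function the sections \<open>E j\<close> stay in the
  kernel everywhere, but \<open>S i\<close> lifts a coordinate field only where the bump function is
  1. The domain of the adapted frame is therefore this plateau.\<close>

lemma adapted_frame_exists:
  obtains U \<phi> W S m E where "x0 \<in> W" "adapted_frame U \<phi> W S m E"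
proof -
  obtain U \<phi> where c: "(U, \<phi>) \<in> charts M" "x0 \<in> U" using chart_exists .
  from local_lifts[OF c] obtain W s where W: "open W" "x0 \<in> W" "W \<subseteq> U"
    and s: "\<And>i. i < n \<Longrightarrow> smooth_section M A W (s i)"
      "\<And>i x. i < n \<Longrightarrow> x \<in> W \<Longrightarrow> \<rho> x (s i x) = coord_vector M U \<phi> i x"
    by blast
  from kernel_frame_exists[OF c(1) W s] obtain V m e where V: "open V" "x0 \<in> V" "V \<subseteq> W"
    and e: "\<And>j. j < m \<Longrightarrow> smooth_section M A V (e j)" "\<And>j x. j < m \<Longrightarrow> x \<in> V \<Longrightarrow> \<rho> x (e j x) = 0"
      "is_basis m (\<lambda>j. e j x0) (kfibre x0)"
    by blast
  have sV: "smooth_section M A V (s i)" if "i < n" for i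
    using smooth_section_mono[OF s(1)[OF that] W(1) V(1,3)] .
  have VU: "V \<subseteq> U" using V W by blast
  have sV2: "\<rho> x (s i x) = coord_vector M U \<phi> i x" if "i < n" "x \<in> V" for i x
    using s(2) that V(3) by blast
  from kernel_frame_nearby[OF c(1) V(1,2) VU sV sV2 e]
  obtain W' where W': "open W'" "x0 \<in> W'" "W' \<subseteq> V" "\<forall>x\<in>W'. is_basis m (\<lambda>j. e j x) (kfibre x)"
    "\<forall>V \<sigma> j. open V \<and> V \<subseteq> W' \<and> smooth_section M A V \<sigma> \<and> (\<forall>x\<in>V. \<rho> x (\<sigma> x) = 0) \<and> j < m \<longrightarrow>
      smooth_fun M V (\<lambda>x. coords m (\<lambda>j. e j x) (\<sigma> x) j)"
    by blast
  obtain \<eta> Y C where \<eta>: "smooth_fun M UNIV \<eta>" "open Y" "x0 \<in> Y" "Y \<subseteq> W'" "\<And>y. y \<in> Y \<Longrightarrow> \<eta> y = 1"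
    "closed C" "C \<subseteq> W'" "\<And>y. y \<notin> C \<Longrightarrow> \<eta> y = 0"
    using bump_exists[OF W'(1,2)] by metis
  have CV: "C \<subseteq> V" using \<eta>(7) W'(3) by blast
  define S where "S i x = \<eta> x *\<^sub>R s i x" for i x
  define E where "E j x = \<eta> x *\<^sub>R e j x" for j x
  have S: "S i \<in> sections M A" if "i < n" for i
    unfolding S_def by (rule smooth_section_extend[OF \<eta>(1,6) CV \<eta>(8) V(1) sV[OF that]])
  have E: "E j \<in> sections M A" if "j < m" for j
    unfolding E_def by (rule smooth_section_extend[OF \<eta>(1,6) CV \<eta>(8) V(1) e(1)[OF that]])
  have SO: "S i x = s i x" and EO: "E j x = e j x" if "x \<in> Y" for i j x
    using \<eta>(5)[OF that] unfolding S_def E_def by auto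
  have OV: "Y \<subseteq> V" using \<eta>(4) W'(3) by blast
  have ES: "\<rho> x (E j x) = 0" if "j < m" for j x
  proof (cases "x \<in> V")
    case True
    then show ?thesis
      unfolding E_def using linear_on_set_scale[OF anchor_linear section_in_fibre[OF e(1)[OF that] True]] e(2)[OF that True]
      by simp
  next
    case False
    then have "\<eta> x = 0" using \<eta>(8) CV by blast
    then show ?thesis unfolding E_def by (simp add: anchor_0)
  qed
  have sm: "smooth_fun M Y' (\<lambda>x. coords m (\<lambda>j. E j x) (\<sigma> x) j)"
    if Y': "open Y'" "Y' \<subseteq> Y" "smooth_section M A Y' \<sigma>" "\<forall>x\<in>Y'. \<rho> x (\<sigma> x) = 0" "j < m" for Y' \<sigma> j
  proof -
    have eq: "coords m (\<lambda>j. e j x) (\<sigma> x) j = coords m (\<lambda>j. E j x) (\<sigma> x) j" if "x \<in> Y'" for x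
    proof -
      have "x \<in> Y" using that Y'(2) by blast
      then have "(\<lambda>j. E j x) = (\<lambda>j. e j x)" using EO by blast
      then show ?thesis by simp
    qed
    have "Y' \<subseteq> W'" using Y'(2) \<eta>(4) by blast
    then have "smooth_fun M Y' (\<lambda>x. coords m (\<lambda>j. e j x) (\<sigma> x) j)" using W'(5) Y' by blast
    from smooth_fun_cong[OF Y'(1) eq this] show ?thesis .
  qed
  have basis: "is_basis m (\<lambda>j. E j x) (kfibre x)" if "x \<in> Y" for x
    using W'(4) \<eta>(4) that is_basis_cong[of m "\<lambda>j. E j x" "\<lambda>j. e j x"] EO by blast
  have \<rho>S: "\<rho> x (S i x) = coord_vector M U \<phi> i x" if "i < n" "x \<in> Y" for i x
    using sV2[OF that(1)] that(2) OV SO[OF that(2)] by auto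
  have YU: "Y \<subseteq> U" using OV VU by blast
  have "adapted_frame U \<phi> Y S m E"
    unfolding adapted_frame_def
  proof (intro conjI allI impI ballI c(1) \<eta>(2) YU S E ES basis \<rho>S)
    fix Y' \<sigma> j
    assume "open Y' \<and> Y' \<subseteq> Y \<and> smooth_section M A Y' \<sigma> \<and> (\<forall>x\<in>Y'. \<rho> x (\<sigma> x) = 0) \<and> j < m"
    then show "smooth_fun M Y' (\<lambda>x. coords m (\<lambda>j. E j x) (\<sigma> x) j)"
      by (elim conjE) (rule sm)
  qed
  then show ?thesis using that \<eta>(3) by blast
qed

end

section \<open>Linear differential equations with small coefficients\<close>

text \<open>The system w' = B w on [0,1]. Components form an indexed family because their number m
  is a variable; derivatives at the end points are one-sided.\<close>

definition solves_ode :: "nat \<Rightarrow> (nat \<Rightarrow> nat \<Rightarrow> real \<Rightarrow> real) \<Rightarrow> (nat \<Rightarrow> real \<Rightarrow> real) \<Rightarrow> bool" where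
  "solves_ode m B w \<longleftrightarrow> (\<forall>k<m. \<forall>t\<in>{0..1}.
    (w k has_real_derivative (\<Sum>l<m. B k l t * w l t)) (at t within {0..1}))"

text \<open>A bound b on a solution vanishing at t0 bounds its derivative by b/2, hence, on an
  interval of length 1, the solution itself by b/2. Iteration forces it to vanish. The point t0 is
  arbitrary, so this gives uniqueness from either end.\<close>

lemma solves_ode_bound:
  assumes w: "solves_ode m B w" and B: "\<And>k l t. k < m \<Longrightarrow> l < m \<Longrightarrow> t \<in> {0..1} \<Longrightarrow> \<bar>B k l t\<bar> \<le> \<beta>"
    and \<beta>: "real m * \<beta> \<le> 1 / 2" and t0: "t0 \<in> {0..1}" "\<And>k. k < m \<Longrightarrow> w k t0 = 0"
    and k: "k < m" and t: "t \<in> {0..1}"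
  shows "w k t = 0"
proof -
  have cont: "continuous_on {0..1} (w k)" if "k < m" for k
    using w that unfolding solves_ode_def by (auto intro!: DERIV_continuous_on)
  have "\<exists>c. \<forall>t\<in>{0..1}. \<bar>w k t\<bar> \<le> c" if "k < m" for k
    using compact_imp_bounded[OF compact_continuous_image[OF cont[OF that] compact_Icc]]
    unfolding bounded_iff by auto
  then obtain c where c: "\<And>k t. k < m \<Longrightarrow> t \<in> {0..1} \<Longrightarrow> \<bar>w k t\<bar> \<le> c k" by metis
  have \<beta>0: "\<beta> \<ge> 0" using B[OF k k t] by linarith
  have step: "\<forall>k<m. \<forall>t\<in>{0..1}. \<bar>w k t\<bar> \<le> b / 2" if b: "\<forall>k<m. \<forall>t\<in>{0..1}. \<bar>w k t\<bar> \<le> b" for b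
  proof (intro allI impI ballI)
    fix k t assume k: "k < m" and t: "t \<in> {0..1::real}"
    have b0: "b \<ge> 0" using b k t by fastforce
    have "norm (w k t - w k t0) \<le> (b / 2) * norm (t - t0)"
    proof (rule field_differentiable_bound[where f'="\<lambda>t. \<Sum>l<m. B k l t * w l t" and S="{0..1}"])
      fix z :: real assume z: "z \<in> {0..1}"
      show "(w k has_field_derivative (\<Sum>l<m. B k l z * w l z)) (at z within {0..1})"
        using w k z unfolding solves_ode_def by blast
      have "\<bar>\<Sum>l<m. B k l z * w l z\<bar> \<le> (\<Sum>l<m. \<bar>B k l z * w l z\<bar>)" by (rule sum_abs)
      also have "\<dots> \<le> (\<Sum>l<m. \<beta> * b)"
        unfolding abs_mult using b z \<beta>0 by (intro sum_mono mult_mono B k) auto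
      also have "\<dots> = (real m * \<beta>) * b" by simp
      also have "\<dots> \<le> 1 / 2 * b" using \<beta> b0 by (intro mult_right_mono)
      finally show "norm (\<Sum>l<m. B k l z * w l z) \<le> b / 2" by simp
    qed (use t t0 in auto)
    also have "\<dots> \<le> (b / 2) * 1" using t t0(1) b0 by (intro mult_left_mono) auto
    finally show "\<bar>w k t\<bar> \<le> b / 2" using t0(2)[OF k] by simp
  qed
  define b where "b = (\<Sum>k<m. \<bar>c k\<bar>)"
  have "\<forall>k<m. \<forall>t\<in>{0..1}. \<bar>w k t\<bar> \<le> b / 2 ^ i" for i
  proof (induction i)
    case 0
    have "\<bar>w k t\<bar> \<le> b" if "k < m" "t \<in> {0..1}" for k t
    proof -
      have "\<bar>c k\<bar> \<le> b" unfolding b_def using that(1) by (intro member_le_sum) auto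
      then show ?thesis using c[OF that] by linarith
    qed
    then show ?case by simp
  next
    case (Suc i)
    from step[OF this] show ?case by (simp add: mult.commute)
  qed
  then have "\<bar>w k t\<bar> \<le> b / 2 ^ i" for i using k t by blast
  moreover have "(\<lambda>i. b / 2 ^ i) \<longlonglongrightarrow> 0"
    using tendsto_mult[OF tendsto_const[of b] LIMSEQ_realpow_zero[of "1/2"]] by (simp add: power_divide)
  ultimately have "\<bar>w k t\<bar> \<le> 0"
    by (intro LIMSEQ_le_const[of "\<lambda>i. b / 2 ^ i"]) auto
  then show ?thesis by simp
qed

lemma solves_ode_linear:
  assumes "solves_ode m B w" "solves_ode m B w'"
  shows "solves_ode m B (\<lambda>k t. a * w k t + c * w' k t)"
  unfolding solves_ode_def
proof (intro allI impI ballI)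
  fix k t assume "k < m" "t \<in> {0..1::real}"
  then have d: "(w k has_real_derivative (\<Sum>l<m. B k l t * w l t)) (at t within {0..1})"
    "(w' k has_real_derivative (\<Sum>l<m. B k l t * w' l t)) (at t within {0..1})"
    using assms unfolding solves_ode_def by blast+
  have "a * (\<Sum>l<m. B k l t * w l t) + c * (\<Sum>l<m. B k l t * w' l t)
      = (\<Sum>l<m. B k l t * (a * w l t + c * w' l t))"
    by (simp add: sum_distrib_left sum.distrib[symmetric] algebra_simps)
  from DERIV_cong[OF DERIV_add[OF DERIV_cmult[OF d(1), of a] DERIV_cmult[OF d(2), of c]] this]
  show "((\<lambda>t. a * w k t + c * w' k t) has_real_derivative (\<Sum>l<m. B k l t * (a * w l t + c * w' l t))) (at t within {0..1})" .
qed

lemma solves_ode_unique: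
  assumes "solves_ode m B w" "solves_ode m B w'" and B: "\<And>k l t. k < m \<Longrightarrow> l < m \<Longrightarrow> t \<in> {0..1} \<Longrightarrow> \<bar>B k l t\<bar> \<le> \<beta>"
    and \<beta>: "real m * \<beta> \<le> 1 / 2" and t0: "t0 \<in> {0..1}" "\<And>k. k < m \<Longrightarrow> w k t0 = w' k t0"
    and k: "k < m" and t: "t \<in> {0..1}"
  shows "w k t = w' k t"
proof -
  have "1 * w k t + (-1) * w' k t = 0"
    by (rule solves_ode_bound[OF solves_ode_linear[OF assms(1,2)] B \<beta> t0(1) _ k t]) (simp_all add: t0(2))
  then show ?thesis by simp
qed

text \<open>A solution is a fixed point of the Picard operator. A tuple of functions on \<open>[0,1]\<close> is regarded as
  one bounded continuous function on \<open>nat discrete \<times> real\<close>, extended constantly beyond \<open>[0,1]\<close>.\<close>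

lemma solves_ode_exists:
  assumes cont: "\<And>k l. k < m \<Longrightarrow> l < m \<Longrightarrow> continuous_on {0..1} (B k l)"
    and B: "\<And>k l t. k < m \<Longrightarrow> l < m \<Longrightarrow> t \<in> {0..1} \<Longrightarrow> \<bar>B k l t\<bar> \<le> \<beta>"
    and \<beta>: "real m * \<beta> \<le> 1 / 2"
  shows "\<exists>w. solves_ode m B w \<and> (\<forall>k<m. w k 0 = u k)"
proof -
  define cl where "cl t = max 0 (min 1 t)" for t :: real
  have cl: "cl t \<in> {0..1}" "t \<in> {0..1} \<Longrightarrow> cl t = t" for t unfolding cl_def by auto
  have cl_cont: "continuous_on UNIV cl" unfolding cl_def by (intro continuous_intros)
  define I where "I f k t = (\<Sum>l<m. B k l t * apply_bcontfun f (discrete l, t))" for f :: "(nat discrete \<times> real) \<Rightarrow>\<^sub>C real" and k t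
  have I_cont: "continuous_on {0..1} (I f k)" if "k < m" for f k
  proof -
    have "continuous_on {0..1} (\<lambda>t. apply_bcontfun f (discrete l, t))" for l
      by (rule continuous_on_compose2[OF continuous_on_apply_bcontfun[of UNIV f]]) (auto intro!: continuous_intros)
    then show ?thesis unfolding I_def by (intro continuous_on_sum continuous_on_mult cont that) auto
  qed
  have I_int: "I f k integrable_on {0..t}" if "k < m" "t \<in> {0..1}" for f k t
    using that(2) by (intro integrable_continuous_interval continuous_on_subset[OF I_cont[OF that(1)]]) auto
  define F where "F f x = (if of_discrete (fst x) < m
    then u (of_discrete (fst x)) + integral {0..cl (snd x)} (I f (of_discrete (fst x))) else 0)" for f x
  have F_cont: "continuous_on UNIV (F f)" for f
  proof -
    \<comment> \<open>The first factor is discrete, so continuity may be checked on each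
      slice.\<close>
    have "continuous_on ({discrete k} \<times> UNIV) (F f)" for k
    proof (cases "k < m")
      case True
      have "continuous_on {0..1} (\<lambda>t. integral {0..t} (I f k))"
        using I_int[OF True, of 1] by (intro indefinite_integral_continuous_1) auto
      then have "continuous_on UNIV (\<lambda>t. u k + integral {0..cl t} (I f k))"
        using cl(1) by (intro continuous_intros continuous_on_compose2[OF _ cl_cont]) auto
      then have "continuous_on ({discrete k} \<times> UNIV) (\<lambda>x. u k + integral {0..cl (snd x)} (I f k))"
        by (rule continuous_on_compose2) (auto intro!: continuous_intros)
      then show ?thesis
        by (rule continuous_on_cong[THEN iffD1, OF refl, rotated]) (use True in \<open>auto simp: F_def discrete_inverse\<close>)
    next
      case False
      have "continuous_on ({discrete k} \<times> UNIV) (\<lambda>x::nat discrete \<times> real. 0::real)" by simp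
      then show ?thesis
        by (rule continuous_on_cong[THEN iffD1, OF refl, rotated]) (use False in \<open>auto simp: F_def discrete_inverse\<close>)
    qed
    then have "continuous_on (\<Union>k. {discrete k} \<times> UNIV) (F f)"
      by (intro continuous_on_open_UN) (auto intro!: open_Times simp: open_discrete)
    moreover have "(\<Union>k. {discrete k} \<times> UNIV) = (UNIV :: (nat discrete \<times> real) set)"
      by (auto intro: discrete_cases)
    ultimately show ?thesis by simp
  qed
  \<comment> \<open>The contraction estimate: m terms with coefficients at most \<beta> give the
    factor 1/2, and the interval of integration has length at most 1.\<close>
  have F_diff: "\<bar>F f x - F g x\<bar> \<le> 1 / 2 * dist f g" for f g x
  proof -
    obtain k t where x: "x = (discrete k, t)" by (metis discrete_cases surj_pair)
    show ?thesis
    proof (cases "k < m")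
      case True
      have "F f x - F g x = integral {0..cl t} (\<lambda>s. I f k s - I g k s)"
        unfolding F_def x using True integral_diff[OF I_int[OF True cl(1)[of t], of f] I_int[OF True cl(1)[of t], of g]]
        by (simp add: discrete_inverse)
      also have "\<bar>\<dots>\<bar> \<le> (1 / 2 * dist f g) * (cl t - 0)"
      proof (rule integral_bound[where f="\<lambda>s. I f k s - I g k s", simplified real_norm_def])
        show "0 \<le> cl t" using cl(1)[of t] by simp
        show "continuous_on {0..cl t} (\<lambda>s. I f k s - I g k s)"
          using cl(1)[of t]
          by (intro continuous_on_diff continuous_on_subset[OF I_cont[OF True]]) auto
        fix s assume "s \<in> {0..cl t}"
        then have s: "s \<in> {0..1}" using cl(1)[of t] by auto
        have "I f k s - I g k s = (\<Sum>l<m. B k l s * (apply_bcontfun f (discrete l, s) - apply_bcontfun g (discrete l, s)))"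
          unfolding I_def by (simp add: sum_subtractf algebra_simps)
        also have "\<bar>\<dots>\<bar> \<le> (\<Sum>l<m. \<bar>B k l s * (apply_bcontfun f (discrete l, s) - apply_bcontfun g (discrete l, s))\<bar>)" by (rule sum_abs)
        also have "\<dots> \<le> (\<Sum>l<m. \<beta> * dist f g)"
          unfolding abs_mult
        proof (intro sum_mono mult_mono)
          fix l assume "l \<in> {..<m}"
          then have "\<bar>B k l s\<bar> \<le> \<beta>" using B[OF True _ s] by simp
          then show "\<bar>B k l s\<bar> \<le> \<beta>" "0 \<le> \<beta>" by auto
          show "\<bar>apply_bcontfun f (discrete l, s) - apply_bcontfun g (discrete l, s)\<bar> \<le> dist f g"
            using dist_bounded[of f "(discrete l, s)" g] by (simp add: dist_real_def)
        qed auto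
        also have "\<dots> = (real m * \<beta>) * dist f g" by simp
        also have "\<dots> \<le> 1 / 2 * dist f g" using \<beta> by (intro mult_right_mono) auto
        finally show "\<bar>I f k s - I g k s\<bar> \<le> 1 / 2 * dist f g" .
      qed
      also have "\<dots> \<le> (1 / 2 * dist f g) * 1" using cl(1)[of t] by (intro mult_left_mono) auto
      finally show ?thesis by simp
    qed (simp add: F_def discrete_inverse x)
  qed
  \<comment> \<open>For f = 0 the integrals vanish and F is bounded by the initial values; by the
    contraction estimate \<open>F f\<close> stays within a bounded distance of
    \<open>F 0\<close>.\<close>
  have F_b: "F f \<in> bcontfun" for f
  proof -
    have F0: "\<bar>F 0 x\<bar> \<le> (\<Sum>k<m. \<bar>u k\<bar>)" for x
    proof -
      obtain k t where x: "x = (discrete k, t)" by (metis discrete_cases surj_pair)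
      have "I 0 k = (\<lambda>_. 0)" for k unfolding I_def by auto
      then have "F 0 x = (if k < m then u k else 0)" unfolding F_def x by (auto simp: discrete_inverse)
      then show ?thesis by (auto intro!: member_le_sum sum_nonneg)
    qed
    have "norm (F f x) \<le> (\<Sum>k<m. \<bar>u k\<bar>) + 1 / 2 * dist f 0" for x
      unfolding real_norm_def
      using F0[of x] F_diff[of f x 0] abs_triangle_ineq2[of "F f x" "F 0 x"] by linarith
    then show ?thesis by (rule bcontfun_normI[OF F_cont])
  qed
  have "\<exists>!f. Bcontfun (F f) = f"
  proof (rule banach_fix_type[where c="1 / 2"])
    show "\<forall>x y. dist (Bcontfun (F x)) (Bcontfun (F y)) \<le> 1 / 2 * dist x y"
    proof (intro allI dist_bound)
      fix f g x
      show "dist (apply_bcontfun (Bcontfun (F f)) x) (apply_bcontfun (Bcontfun (F g)) x) \<le> 1 / 2 * dist f g"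
        using F_diff[of f x g] by (simp add: Bcontfun_inverse F_b dist_real_def)
    qed
  qed auto
  then obtain f where f: "Bcontfun (F f) = f" by blast
  then have fF: "apply_bcontfun f x = F f x" for x by (metis Bcontfun_inverse F_b)
  define w where "w k t = apply_bcontfun f (discrete k, t)" for k t
  have w: "w k t = u k + integral {0..t} (I f k)" if "k < m" "t \<in> {0..1}" for k t
    unfolding w_def fF using that cl(2)[OF that(2)] by (simp add: F_def discrete_inverse)
  have "solves_ode m B w"
    unfolding solves_ode_def
  proof (intro allI impI ballI)
    fix k t assume k: "k < m" and t: "t \<in> {0..1::real}"
    have "((\<lambda>t. integral {0..t} (I f k)) has_real_derivative I f k t) (at t within {0..1})"
      by (rule integral_has_real_derivative[OF I_cont[OF k] t])
    from DERIV_add[OF DERIV_const[of "u k"] this]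
    have "((\<lambda>t. u k + integral {0..t} (I f k)) has_real_derivative I f k t) (at t within {0..1})" by simp
    then have "(w k has_real_derivative I f k t) (at t within {0..1})"
      by (rule has_field_derivative_transform_within[of _ _ _ _ 1]) (use w k t in auto)
    then show "(w k has_real_derivative (\<Sum>l<m. B k l t * w l t)) (at t within {0..1})"
      unfolding I_def w_def .
  qed
  moreover have "w k 0 = u k" if "k < m" for k using w[OF that, of 0] by simp
  ultimately show ?thesis by blast
qed

text \<open>Time reversal t \<mapsto> 1 - t, which changes the sign of the coefficients. Prescribing
  the end value yields surjectivity of parallel transport.\<close>

lemma solves_ode_exists_end:
  assumes cont: "\<And>k l. k < m \<Longrightarrow> l < m \<Longrightarrow> continuous_on {0..1} (B k l)"
    and B: "\<And>k l t. k < m \<Longrightarrow> l < m \<Longrightarrow> t \<in> {0..1} \<Longrightarrow> \<bar>B k l t\<bar> \<le> \<beta>"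
    and \<beta>: "real m * \<beta> \<le> 1 / 2"
  shows "\<exists>w. solves_ode m B w \<and> (\<forall>k<m. w k 1 = u k)"
proof -
  have "\<exists>w. solves_ode m (\<lambda>k l t. - B k l (1 - t)) w \<and> (\<forall>k<m. w k 0 = u k)"
  proof (rule solves_ode_exists[OF _ _ \<beta>])
    show "continuous_on {0..1} (\<lambda>t. - B k l (1 - t))" if "k < m" "l < m" for k l
      by (intro continuous_on_minus continuous_on_compose2[OF cont[OF that]]) (auto intro!: continuous_intros)
    show "\<bar>- B k l (1 - t)\<bar> \<le> \<beta>" if "k < m" "l < m" "t \<in> {0..1}" for k l t
      using B[OF that(1,2), of "1 - t"] that(3) by simp
  qed
  then obtain w where w: "solves_ode m (\<lambda>k l t. - B k l (1 - t)) w" "\<forall>k<m. w k 0 = u k" by blast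
  have "solves_ode m B (\<lambda>k t. w k (1 - t))"
    unfolding solves_ode_def
  proof (intro allI impI ballI)
    fix k t assume k: "k < m" and t: "t \<in> {0..1::real}"
    have "(w k has_real_derivative (\<Sum>l<m. - B k l (1 - (1 - t)) * w l (1 - t))) (at (1 - t) within (\<lambda>t. 1 - t) ` {0..1})"
    proof -
      have img: "(\<lambda>t. 1 - t) ` {0..1} = {0..1::real}"
        by (auto simp: image_iff intro!: bexI[of _ "1 - _"])
      have "1 - t \<in> {0..1}" using t by auto
      then show ?thesis unfolding img using w(1) k unfolding solves_ode_def by blast
    qed
    moreover have "((\<lambda>t. 1 - t) has_real_derivative - 1) (at t within {0..1})"
      by (auto intro!: derivative_eq_intros)
    ultimately have "(w k \<circ> (\<lambda>t. 1 - t) has_real_derivative (\<Sum>l<m. - B k l (1 - (1 - t)) * w l (1 - t)) * - 1) (at t within {0..1})"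
      by (rule DERIV_image_chain)
    then show "((\<lambda>t. w k (1 - t)) has_real_derivative (\<Sum>l<m. B k l t * w l (1 - t))) (at t within {0..1})"
      by (simp add: comp_def sum_negf)
  qed
  then show ?thesis using w(2) by (intro exI[of _ "\<lambda>k t. w k (1 - t)"]) simp
qed

section \<open>Parallel transport of structure constants\<close>

definition struct_bracket :: "nat \<Rightarrow> (nat \<Rightarrow> nat \<Rightarrow> nat \<Rightarrow> real) \<Rightarrow> (nat \<Rightarrow> real) \<Rightarrow> (nat \<Rightarrow> real) \<Rightarrow> nat \<Rightarrow> real" where
  "struct_bracket m c u v = (\<lambda>k. if k < m then \<Sum>i<m. \<Sum>j<m. u i * v j * c i j k else 0)"

text \<open>The equation for \<open>c\<close> says that the bracket with structure constants \<open>c t\<close> is parallel for the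
  connection with coefficients \<open>B\<close>, so brackets of solutions of the transport equation
  \<open>w' = - B w\<close> are again solutions.\<close>

lemma struct_bracket_transport:
  assumes cont: "\<And>k l. k < m \<Longrightarrow> l < m \<Longrightarrow> continuous_on {0..1} (B k l)"
    and B: "\<And>k l t. k < m \<Longrightarrow> l < m \<Longrightarrow> t \<in> {0..1} \<Longrightarrow> \<bar>B k l t\<bar> \<le> \<beta>" and \<beta>: "real m * \<beta> \<le> 1 / 2"
    and c: "\<And>i j k t. i < m \<Longrightarrow> j < m \<Longrightarrow> k < m \<Longrightarrow> t \<in> {0..1} \<Longrightarrow>
      ((\<lambda>t. c t i j k) has_real_derivative
        (\<Sum>l<m. B i l t * c t l j k) + (\<Sum>l<m. B j l t * c t i l k) - (\<Sum>l<m. c t i j l * B l k t)) (at t within {0..1})"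
  shows "\<exists>T. linear_iso T (Rn m) (Rn m) \<and>
    (\<forall>u\<in>Rn m. \<forall>v\<in>Rn m. T (struct_bracket m (c 0) u v) = struct_bracket m (c 1) (T u) (T v))"
proof -
  \<comment> \<open>B acts on frame vectors, with the derivative of the i-th being the sum of B i l
    times the l-th. For the coefficients of a parallel section this becomes the negative
    transpose.\<close>
  define B' where "B' k l t = - B l k t" for k l t
  have cont': "continuous_on {0..1} (B' k l)" if "k < m" "l < m" for k l
    using continuous_on_minus[OF cont[OF that(2,1)]] by (simp add: B'_def[abs_def])
  have B': "\<bar>B' k l t\<bar> \<le> \<beta>" if "k < m" "l < m" "t \<in> {0..1}" for k l t
    using B[OF that(2,1,3)] by (simp add: B'_def)
  have "\<exists>w. solves_ode m B' w \<and> (\<forall>k<m. w k 0 = u k)" for u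
    by (rule solves_ode_exists[OF cont' B' \<beta>])
  then obtain w where w: "\<And>u. solves_ode m B' (w u)" "\<And>u k. k < m \<Longrightarrow> w u k 0 = u k" by metis
  define T where "T u = (\<lambda>k. if k < m then w u k 1 else 0)" for u
  \<comment> \<open>Any solution with initial value u computes T u at time 1. Linearity of T and its
    compatibility with the brackets both reduce to exhibiting a suitable solution.\<close>
  have uniq: "T u k = w' k 1" if "solves_ode m B' w'" "\<And>k. k < m \<Longrightarrow> w' k 0 = u k" "k < m" for u w' k
    unfolding T_def
    using solves_ode_unique[OF w(1)[of u] that(1) B' \<beta>, of 0 k 1] w(2) that(2,3) by simp
  have TR: "T u \<in> Rn m" for u unfolding T_def Rn_iff by simp
  have Teq: "T u = v" if "v \<in> Rn m" "\<And>k. k < m \<Longrightarrow> T u k = v k" for u v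
    using that unfolding T_def Rn_iff by (auto simp: fun_eq_iff)
  have "linear_on_set (Rn m) T"
    unfolding linear_on_set_def
  proof (intro conjI ballI allI)
    fix u v
    have "T (u + v) k = 1 * w u k 1 + 1 * w v k 1" if "k < m" for k
      by (rule uniq[OF solves_ode_linear[OF w(1) w(1)] _ that]) (simp add: w(2))
    then show "T (u + v) = T u + T v"
      by (intro Teq subspace_add[OF subspace_Rn TR TR]) (simp add: T_def)
  next
    fix a u
    have "T (a *\<^sub>R u) k = a * w u k 1 + 0 * w u k 1" if "k < m" for k
      by (rule uniq[OF solves_ode_linear[OF w(1) w(1)] _ that]) (simp add: w(2))
    then show "T (a *\<^sub>R u) = a *\<^sub>R T u"
      by (intro Teq subspace_scale[OF subspace_Rn TR]) (simp add: T_def)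
  qed
  moreover have "bij_betw T (Rn m) (Rn m)"
    unfolding bij_betw_def
  proof (intro conjI inj_onI subset_antisym subsetI)
    fix u v assume uv: "u \<in> Rn m" "v \<in> Rn m" "T u = T v"
    have "u k = v k" for k
    proof (cases "k < m")
      case True
      have "w u k 1 = w v k 1" if "k < m" for k using fun_cong[OF uv(3), of k] that by (simp add: T_def)
      then have "w u k 0 = w v k 0"
        using solves_ode_unique[OF w(1)[of u] w(1)[of v] B' \<beta>, of 1 k 0] True by simp
      then show ?thesis using w(2) True by simp
    qed (use uv(1,2) in \<open>simp add: Rn_iff\<close>)
    then show "u = v" by blast
  next
    fix v assume v: "v \<in> Rn m"
    have "\<exists>w'. solves_ode m B' w' \<and> (\<forall>k<m. w' k 1 = v k)"
      by (rule solves_ode_exists_end[OF cont' B' \<beta>])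
    then obtain w' where w': "solves_ode m B' w'" "\<forall>k<m. w' k 1 = v k" by blast
    have "T (\<lambda>k. if k < m then w' k 0 else 0) = v"
      using uniq[OF w'(1)] w'(2) by (intro Teq v) auto
    moreover have "(\<lambda>k. if k < m then w' k 0 else 0) \<in> Rn m" unfolding Rn_iff by simp
    ultimately show "v \<in> T ` Rn m" by blast
  qed (use TR in blast)
  moreover have "T (struct_bracket m (c 0) u v) = struct_bracket m (c 1) (T u) (T v)" for u v
  proof (rule Teq)
    show "struct_bracket m (c 1) (T u) (T v) \<in> Rn m" unfolding struct_bracket_def Rn_iff by simp
    fix k assume k: "k < m"
    \<comment> \<open>The pointwise bracket, with the structure constants at time t, of the two
      solutions starting at u and v.\<close>
    define z where "z k t = (\<Sum>i<m. \<Sum>j<m. w u i t * w v j t * c t i j k)" for k t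
    have "solves_ode m B' z"
      unfolding solves_ode_def
    proof (intro allI impI ballI)
      fix k t assume k: "k < m" and t: "t \<in> {0..1::real}"
      have wd: "(w u i has_real_derivative (\<Sum>l<m. B' i l t * w u l t)) (at t within {0..1})" if "i < m" for u i
        using w(1) that t unfolding solves_ode_def by blast
      let ?x = "\<lambda>i. w u i t" and ?y = "\<lambda>i. w v i t" and ?c = "c t"
      let ?d = "\<lambda>i j. ((\<Sum>l<m. B' i l t * ?x l) * ?y j + (\<Sum>l<m. B' j l t * ?y l) * ?x i) * ?c i j k
        + ((\<Sum>l<m. B i l t * ?c l j k) + (\<Sum>l<m. B j l t * ?c i l k) - (\<Sum>l<m. ?c i j l * B l k t)) * (?x i * ?y j)"
      have "((\<lambda>t. w u i t * w v j t * c t i j k) has_real_derivative ?d i j) (at t within {0..1})"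
        if "i < m" "j < m" for i j
        by (rule DERIV_cong[OF DERIV_mult[OF DERIV_mult[OF wd[OF that(1), of u] wd[OF that(2), of v]] c[OF that k t]]])
          (rule refl)
      then have "(z k has_real_derivative (\<Sum>i<m. \<Sum>j<m. ?d i j)) (at t within {0..1})"
        unfolding z_def by (intro DERIV_sum) auto
      moreover have "(\<Sum>i<m. \<Sum>j<m. ?d i j) = (\<Sum>l<m. B' k l t * z l t)"
      proof -
        \<comment> \<open>The product rule has three groups of terms. Those from differentiating the
          two solutions cancel, after renaming indices (\<open>e1\<close>, \<open>e2\<close>),
          against the first two sums in the derivative of c.\<close>
        have d: "?d i j = - (\<Sum>l<m. B l i t * ?x l * ?y j * ?c i j k) - (\<Sum>l<m. B l j t * ?y l * ?x i * ?c i j k)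
            + (\<Sum>l<m. B i l t * ?x i * ?y j * ?c l j k) + (\<Sum>l<m. B j l t * ?x i * ?y j * ?c i l k)
            - (\<Sum>l<m. B l k t * (?x i * ?y j * ?c i j l))" for i j
          unfolding B'_def
          by (simp add: sum_distrib_left sum_distrib_right sum_negf algebra_simps)
        have e1: "(\<Sum>i<m. \<Sum>j<m. \<Sum>l<m. B l i t * ?x l * ?y j * ?c i j k)
            = (\<Sum>i<m. \<Sum>j<m. \<Sum>l<m. B i l t * ?x i * ?y j * ?c l j k)"
        proof -
          have "(\<Sum>i<m. \<Sum>j<m. \<Sum>l<m. B l i t * ?x l * ?y j * ?c i j k)
              = (\<Sum>i<m. \<Sum>l<m. \<Sum>j<m. B l i t * ?x l * ?y j * ?c i j k)"
            by (intro sum.cong refl sum.swap)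
          also have "\<dots> = (\<Sum>l<m. \<Sum>i<m. \<Sum>j<m. B l i t * ?x l * ?y j * ?c i j k)" by (rule sum.swap)
          also have "\<dots> = (\<Sum>l<m. \<Sum>j<m. \<Sum>i<m. B l i t * ?x l * ?y j * ?c i j k)"
            by (intro sum.cong refl sum.swap)
          finally show ?thesis .
        qed
        have e2: "(\<Sum>i<m. \<Sum>j<m. \<Sum>l<m. B l j t * ?y l * ?x i * ?c i j k)
            = (\<Sum>i<m. \<Sum>j<m. \<Sum>l<m. B j l t * ?x i * ?y j * ?c i l k)"
        proof (rule sum.cong[OF refl])
          fix i
          have "(\<Sum>j<m. \<Sum>l<m. B l j t * ?y l * ?x i * ?c i j k) = (\<Sum>l<m. \<Sum>j<m. B l j t * ?y l * ?x i * ?c i j k)"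
            by (rule sum.swap)
          also have "\<dots> = (\<Sum>j<m. \<Sum>l<m. B j l t * ?x i * ?y j * ?c i l k)"
            by (intro sum.cong refl) (simp add: mult_ac)
          finally show "(\<Sum>j<m. \<Sum>l<m. B l j t * ?y l * ?x i * ?c i j k) = (\<Sum>j<m. \<Sum>l<m. B j l t * ?x i * ?y j * ?c i l k)" .
        qed
        have e3: "(\<Sum>i<m. \<Sum>j<m. \<Sum>l<m. B l k t * (?x i * ?y j * ?c i j l)) = (\<Sum>l<m. B l k t * z l t)"
        proof -
          have "(\<Sum>i<m. \<Sum>j<m. \<Sum>l<m. B l k t * (?x i * ?y j * ?c i j l))
              = (\<Sum>i<m. \<Sum>l<m. \<Sum>j<m. B l k t * (?x i * ?y j * ?c i j l))"
            by (intro sum.cong refl sum.swap)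
          also have "\<dots> = (\<Sum>l<m. \<Sum>i<m. \<Sum>j<m. B l k t * (?x i * ?y j * ?c i j l))" by (rule sum.swap)
          also have "\<dots> = (\<Sum>l<m. B l k t * z l t)" unfolding z_def by (simp add: sum_distrib_left)
          finally show ?thesis .
        qed
        \<comment> \<open>Only the term acting on the output index of c survives, and this is the
          transport equation for z.\<close>
        have "(\<Sum>i<m. \<Sum>j<m. ?d i j) = - (\<Sum>l<m. B l k t * z l t)"
          unfolding d sum.distrib sum_subtractf sum_negf e1 e2 e3 by simp
        then show ?thesis by (simp add: B'_def sum_negf)
      qed
      ultimately show "(z k has_real_derivative (\<Sum>l<m. B' k l t * z l t)) (at t within {0..1})" by simp
    qed
    moreover have "z k 0 = struct_bracket m (c 0) u v k" if "k < m" for k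
      unfolding z_def struct_bracket_def using that w(2) by (auto intro!: sum.cong)
    ultimately have "T (struct_bracket m (c 0) u v) k = z k 1"
      using k by (intro uniq) auto
    also have "\<dots> = struct_bracket m (c 1) (T u) (T v) k"
      unfolding z_def struct_bracket_def T_def using k by (auto intro!: sum.cong)
    finally show "T (struct_bracket m (c 0) u v) k = struct_bracket m (c 1) (T u) (T v) k" .
  qed
  ultimately show ?thesis unfolding linear_iso_def by blast
qed

section \<open>The kernel as a bundle of Lie algebras\<close>

lemma linear_iso_comp:
  assumes "linear_iso h V W" "linear_iso g W X"
  shows "linear_iso (\<lambda>v. g (h v)) V X"
proof -
  have "h v \<in> W" if "v \<in> V" for v using assms(1) that unfolding linear_iso_def bij_betw_def by blast
  then have "linear_on_set V (\<lambda>v. g (h v))"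
    using assms unfolding linear_iso_def linear_on_set_def by simp
  moreover have "bij_betw (g \<circ> h) V X"
    using assms unfolding linear_iso_def by (meson bij_betw_trans)
  ultimately show ?thesis unfolding linear_iso_def comp_def by blast
qed

lemma linear_iso_inv:
  assumes V: "subspace V" and h: "linear_iso h V W"
  shows "linear_iso (inv_into V h) W V"
proof -
  have lin: "linear_on_set V h" and bij: "bij_betw h V W" using h unfolding linear_iso_def by auto
  have inv: "inv_into V h w \<in> V" "h (inv_into V h w) = w" if "w \<in> W" for w
    using bij that unfolding bij_betw_def by (auto intro: inv_into_into f_inv_into_f)
  have eq: "inv_into V h w = v" if "v \<in> V" "h v = w" for v w
    using bij that unfolding bij_betw_def by (metis inv_into_f_f)
  have "linear_on_set W (inv_into V h)"
    unfolding linear_on_set_def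
  proof (intro conjI ballI allI)
    show "inv_into V h (u + v) = inv_into V h u + inv_into V h v" if "u \<in> W" "v \<in> W" for u v
      using inv that by (intro eq subspace_add V) (simp_all add: linear_on_set_add[OF lin])
    show "inv_into V h (c *\<^sub>R u) = c *\<^sub>R inv_into V h u" if "u \<in> W" for c u
      using inv that by (intro eq subspace_scale V) (simp_all add: linear_on_set_scale[OF lin])
  qed
  then show ?thesis using bij bij_betw_inv_into unfolding linear_iso_def by blast
qed

lemma lie_algebra_isomorphic_sym:
  assumes "lie_algebra_isomorphic V b W b'"
  shows "lie_algebra_isomorphic W b' V b"
proof -
  obtain T where T: "linear_iso T V W" "\<forall>u\<in>V. \<forall>v\<in>V. T (b u v) = b' (T u) (T v)"
    and V: "lie_algebra V b" and W: "lie_algebra W b'"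
    using assms unfolding lie_algebra_isomorphic_def by blast
  have bV: "b u v \<in> V" if "u \<in> V" "v \<in> V" for u v
    using V that unfolding lie_algebra_def by blast
  have sV: "subspace V" using V unfolding lie_algebra_def by blast
  have bij: "bij_betw T V W" using T(1) unfolding linear_iso_def by blast
  have inv: "inv_into V T w \<in> V" "T (inv_into V T w) = w" if "w \<in> W" for w
    using bij that unfolding bij_betw_def by (auto intro: inv_into_into f_inv_into_f)
  have "inv_into V T (b' u v) = b (inv_into V T u) (inv_into V T v)" if "u \<in> W" "v \<in> W" for u v
  proof -
    have "b' u v = T (b (inv_into V T u) (inv_into V T v))" using T(2) inv that by simp
    then show ?thesis using bij bV inv that unfolding bij_betw_def by (simp add: inv_into_f_f)
  qed
  then show ?thesis
    unfolding lie_algebra_isomorphic_def using V W linear_iso_inv[OF sV T(1)] by blast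
qed

lemma lie_algebra_isomorphic_trans:
  assumes "lie_algebra_isomorphic V b W b'" "lie_algebra_isomorphic W b' X b''"
  shows "lie_algebra_isomorphic V b X b''"
proof -
  obtain T T' where T: "linear_iso T V W" "\<forall>u\<in>V. \<forall>v\<in>V. T (b u v) = b' (T u) (T v)"
    and T': "linear_iso T' W X" "\<forall>u\<in>W. \<forall>v\<in>W. T' (b' u v) = b'' (T' u) (T' v)"
    using assms unfolding lie_algebra_isomorphic_def by blast
  have "T v \<in> W" if "v \<in> V" for v using T(1) that unfolding linear_iso_def bij_betw_def by blast
  then have "\<forall>u\<in>V. \<forall>v\<in>V. T' (T (b u v)) = b'' (T' (T u)) (T' (T v))" using T(2) T'(2) by simp
  moreover have "lie_algebra V b" "lie_algebra X b''"
    using assms unfolding lie_algebra_isomorphic_def by blast+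
  ultimately show ?thesis
    unfolding lie_algebra_isomorphic_def using linear_iso_comp[OF T(1) T'(1)] by blast
qed

context transitive_la
begin

section \<open>The kernel bundle and its sections\<close>

abbreviation "K \<equiv> anchor_kernel M A \<rho>"

lemma fibre_K: "fibre K x = kfibre x"
  by (simp add: anchor_kernel_def subbundle_def kfibre_def)

lemma trivs_K: "(U, r, \<Phi>) \<in> trivs K \<longleftrightarrow> open U \<and> (\<forall>x\<in>U. linear_iso (\<Phi> x) (Rn r) (kfibre x)) \<and>
    (\<forall>j<r. smooth_section M A U (\<lambda>x. \<Phi> x (unit_vec j)))"
  by (simp add: anchor_kernel_def subbundle_def kfibre_def)

text \<open>A trivialisation of K is an arbitrary smooth frame of the kernel. Near each point it is
  completed by local lifts to a frame of A, where coefficients are smooth. This yields the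
  transition functions of K and one half of \<open>sections_K\<close>.\<close>

lemma kernel_coords_smooth:
  assumes t: "(V, q, \<Psi>) \<in> trivs K" and W: "open W" and s: "smooth_section M A W \<sigma>" "\<And>x. x \<in> W \<Longrightarrow> \<rho> x (\<sigma> x) = 0"
    and i: "i < q"
  shows "smooth_fun M (W \<inter> V) (\<lambda>x. coords q (\<lambda>j. \<Psi> x (unit_vec j)) (\<sigma> x) i)"
proof (rule smooth_fun_local)
  fix x0 assume x0: "x0 \<in> W \<inter> V"
  have V: "open V" "\<And>x. x \<in> V \<Longrightarrow> is_basis q (\<lambda>j. \<Psi> x (unit_vec j)) (kfibre x)"
    "\<And>j. j < q \<Longrightarrow> smooth_section M A V (\<lambda>x. \<Psi> x (unit_vec j))"
    using t is_basis_of_linear_iso unfolding trivs_K by blast+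
  obtain U \<phi> where c: "(U, \<phi>) \<in> charts M" "x0 \<in> U" using chart_exists .
  from local_lifts[OF c] obtain W1 l where W1: "open W1" "x0 \<in> W1" "W1 \<subseteq> U"
    and l: "\<And>i. i < n \<Longrightarrow> smooth_section M A W1 (l i)"
      "\<And>i x. i < n \<Longrightarrow> x \<in> W1 \<Longrightarrow> \<rho> x (l i x) = coord_vector M U \<phi> i x"
    by blast
  have o: "open (W1 \<inter> V)" using W1 V by blast
  have l': "smooth_section M A (W1 \<inter> V) (l i)" if "i < n" for i
    by (rule smooth_section_mono[OF l(1)[OF that] W1(1) o]) blast
  have e: "smooth_section M A (W1 \<inter> V) (\<lambda>x. \<Psi> x (unit_vec j))" if "j < q" for j
    by (rule smooth_section_mono[OF V(3)[OF that] V(1) o]) blast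
  have x1: "x0 \<in> W1 \<inter> V" and sub: "W1 \<inter> V \<subseteq> U" using x0 W1 by auto
  have l2: "\<rho> x (l i x) = coord_vector M U \<phi> i x" if "i < n" "x \<in> W1 \<inter> V" for i x using l(2) that by blast
  have e2: "\<rho> x (\<Psi> x (unit_vec j)) = 0" if "j < q" "x \<in> W1 \<inter> V" for j x
    using is_basis_mem[OF V(2) that(1)] that(2) unfolding kfibre_def by blast
  have e0: "is_basis q (\<lambda>j. \<Psi> x0 (unit_vec j)) (kfibre x0)" using V(2) x0 by blast
  from kernel_frame_nearby[OF c(1) o x1 sub l' l2 e e2 e0]
  obtain W' where W': "open W'" "x0 \<in> W'"
    "\<forall>V \<sigma> j. open V \<and> V \<subseteq> W' \<and> smooth_section M A V \<sigma> \<and> (\<forall>x\<in>V. \<rho> x (\<sigma> x) = 0) \<and> j < q \<longrightarrow>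
      smooth_fun M V (\<lambda>x. coords q (\<lambda>j. \<Psi> x (unit_vec j)) (\<sigma> x) j)"
    by blast
  have oW: "open (W \<inter> W')" using W W' by blast
  have "smooth_section M A (W \<inter> W') \<sigma>" by (rule smooth_section_mono[OF s(1) W oW]) blast
  then have "smooth_fun M (W \<inter> W') (\<lambda>x. coords q (\<lambda>j. \<Psi> x (unit_vec j)) (\<sigma> x) i)"
    using W'(3)[THEN spec, of "W \<inter> W'"] oW s(2) i by blast
  then show "\<exists>V. open V \<and> x0 \<in> V \<and> smooth_fun M V (\<lambda>x. coords q (\<lambda>j. \<Psi> x (unit_vec j)) (\<sigma> x) i)"
    using oW x0 W'(2) by blast
qed

lemma adapted_frameD:
  assumes "adapted_frame U \<phi> W S m E"
  shows "(U, \<phi>) \<in> charts M" "open W" "W \<subseteq> U" "i < n \<Longrightarrow> S i \<in> sections M A"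
    "i < n \<Longrightarrow> x \<in> W \<Longrightarrow> \<rho> x (S i x) = coord_vector M U \<phi> i x"
    "j < m \<Longrightarrow> E j \<in> sections M A" "j < m \<Longrightarrow> \<rho> x (E j x) = 0"
    "x \<in> W \<Longrightarrow> is_basis m (\<lambda>j. E j x) (kfibre x)"
    "open V \<Longrightarrow> V \<subseteq> W \<Longrightarrow> smooth_section M A V \<sigma> \<Longrightarrow> (\<And>x. x \<in> V \<Longrightarrow> \<rho> x (\<sigma> x) = 0) \<Longrightarrow> j < m \<Longrightarrow>
      smooth_fun M V (\<lambda>x. coords m (\<lambda>j. E j x) (\<sigma> x) j)"
proof -
  have all: "\<forall>V \<sigma> j. open V \<and> V \<subseteq> W \<and> smooth_section M A V \<sigma> \<and> (\<forall>x\<in>V. \<rho> x (\<sigma> x) = 0) \<and> j < m \<longrightarrow>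
      smooth_fun M V (\<lambda>x. coords m (\<lambda>j. E j x) (\<sigma> x) j)"
    using assms unfolding adapted_frame_def by (elim conjE)
  show "(U, \<phi>) \<in> charts M" "open W" "W \<subseteq> U" "i < n \<Longrightarrow> S i \<in> sections M A"
    "i < n \<Longrightarrow> x \<in> W \<Longrightarrow> \<rho> x (S i x) = coord_vector M U \<phi> i x"
    "j < m \<Longrightarrow> E j \<in> sections M A" "j < m \<Longrightarrow> \<rho> x (E j x) = 0"
    "x \<in> W \<Longrightarrow> is_basis m (\<lambda>j. E j x) (kfibre x)"
    using assms unfolding adapted_frame_def by simp_all
  show "open V \<Longrightarrow> V \<subseteq> W \<Longrightarrow> smooth_section M A V \<sigma> \<Longrightarrow> (\<And>x. x \<in> V \<Longrightarrow> \<rho> x (\<sigma> x) = 0) \<Longrightarrow> j < m \<Longrightarrow>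
      smooth_fun M V (\<lambda>x. coords m (\<lambda>j. E j x) (\<sigma> x) j)"
    using all[THEN spec, THEN spec, THEN spec, of V \<sigma> j] by simp
qed

lemma kernel_triv_exists: "\<exists>U r \<Phi>. (U, r, \<Phi>) \<in> trivs K \<and> x \<in> U"
proof -
  obtain U \<phi> W S m E where x: "x \<in> W" and f: "adapted_frame U \<phi> W S m E" using adapted_frame_exists .
  have "smooth_section M A W (\<lambda>x. lincomb m (\<lambda>j. E j x) (unit_vec j))" if "j < m" for j
    unfolding lincomb_unit_vec[OF that]
    by (rule sections_smooth[OF adapted_frameD(6)[OF f that] adapted_frameD(2)[OF f]])
  then have "(W, m, \<lambda>x. lincomb m (\<lambda>j. E j x)) \<in> trivs K"
    unfolding trivs_K using adapted_frameD(2,8)[OF f] unfolding is_basis_def by blast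
  then show ?thesis using x by blast
qed

lemma kernel_vector_bundle: "vector_bundle M K"
  unfolding vector_bundle_def
proof (intro conjI allI ballI)
  show "subspace (fibre K x)" for x unfolding fibre_K by (rule kfibre_subspace)
  show "(\<Union>(U, r, \<Phi>)\<in>trivs K. U) = UNIV" using kernel_triv_exists by fast
  show "case t of (U, r, \<Phi>) \<Rightarrow> open U \<and> (\<forall>x\<in>U. linear_iso (\<Phi> x) (Rn r) (fibre K x))" if "t \<in> trivs K" for t
    using that unfolding fibre_K by (cases t) (simp add: trivs_K)
  fix t assume t: "t \<in> trivs K"
  obtain U r \<Phi> where tU: "t = (U, r, \<Phi>)" by (cases t)
  have "case t' of (V, s, \<Psi>) \<Rightarrow> \<forall>j<r. smooth_coords M (U \<inter> V) s \<Psi> (\<lambda>x. \<Phi> x (unit_vec j))" if t': "t' \<in> trivs K" for t'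
  proof -
    obtain V s \<Psi> where tV: "t' = (V, s, \<Psi>)" by (cases t')
    have U: "(U, r, \<Phi>) \<in> trivs K" and V: "(V, s, \<Psi>) \<in> trivs K" using t t' tU tV by auto
    have Uo: "open U" "open (U \<inter> V)" using U V unfolding trivs_K by auto
    have V': "linear_iso (\<Psi> x) (Rn s) (kfibre x)" if "x \<in> U \<inter> V" for x using V that unfolding trivs_K by blast
    have iff: "smooth_coords M (U \<inter> V) s \<Psi> g \<longleftrightarrow>
        (\<forall>i<s. smooth_fun M (U \<inter> V) (\<lambda>x. coords s (\<lambda>j. \<Psi> x (unit_vec j)) (g x) i))" for g
      by (rule smooth_coords_iff[OF Uo(2) V'])
    have "smooth_coords M (U \<inter> V) s \<Psi> (\<lambda>x. \<Phi> x (unit_vec j))" if j: "j < r" for j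
      unfolding iff
    proof (intro allI impI)
      fix i assume i: "i < s"
      have "smooth_section M A U (\<lambda>x. \<Phi> x (unit_vec j))" using U j unfolding trivs_K by blast
      moreover have "\<rho> x (\<Phi> x (unit_vec j)) = 0" if "x \<in> U" for x
        using U that is_basis_mem[OF is_basis_of_linear_iso j] unfolding trivs_K kfibre_def by blast
      ultimately show "smooth_fun M (U \<inter> V) (\<lambda>x. coords s (\<lambda>j. \<Psi> x (unit_vec j)) (\<Phi> x (unit_vec j)) i)"
        by (rule kernel_coords_smooth[OF V Uo(1) _ _ i])
    qed
    then show ?thesis
      unfolding tV by simp
  qed
  then show "case t of (U, r, \<Phi>) \<Rightarrow> \<forall>(V, s, \<Psi>)\<in>trivs K. \<forall>j<r. smooth_coords M (U \<inter> V) s \<Psi> (\<lambda>x. \<Phi> x (unit_vec j))"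
    unfolding tU by simp
qed

text \<open>Smoothness in K is tested with frames of K, smoothness in A with trivialisations of A.
  From K to A the section is expanded in a kernel frame, which consists of smooth sections of A; the
  converse is \<open>kernel_coords_smooth\<close>.\<close>

lemma sections_K: "s \<in> sections M K \<longleftrightarrow> s \<in> sections M A \<and> (\<forall>x. \<rho> x (s x) = 0)"
proof
  assume s: "s \<in> sections M K"
  have sK: "s x \<in> kfibre x" for x using s unfolding sections_def smooth_section_def fibre_K by blast
  have "smooth_section M A UNIV s"
  proof (rule smooth_section_local[OF open_UNIV])
    fix x :: 'm
    obtain U r \<Phi> where t: "(U, r, \<Phi>) \<in> trivs K" and x: "x \<in> U" using kernel_triv_exists by blast
    have U: "open U" "\<And>x. x \<in> U \<Longrightarrow> linear_iso (\<Phi> x) (Rn r) (kfibre x)"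
      "\<And>j. j < r \<Longrightarrow> smooth_section M A U (\<lambda>x. \<Phi> x (unit_vec j))"
      using t unfolding trivs_K by blast+
    have "smooth_coords M (UNIV \<inter> U) r \<Phi> s"
      using s t unfolding sections_def smooth_section_def by fast
    then have "smooth_fun M U (\<lambda>x. coords r (\<lambda>j. \<Phi> x (unit_vec j)) (s x) i)" if "i < r" for i
      using smooth_coords_iff[OF U(1,2)] that by simp
    then have "smooth_section M A U (\<lambda>x. lincomb r (\<lambda>j. \<Phi> x (unit_vec j)) (coords r (\<lambda>j. \<Phi> x (unit_vec j)) (s x)))"
      by (rule smooth_section_lincomb[OF U(1) _ U(3)])
    then have "smooth_section M A U s"
      by (rule smooth_section_cong[OF U(1), rotated])
        (rule lincomb_coords[OF is_basis_of_linear_iso[OF U(2)] sK])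
    then show "\<exists>V. open V \<and> x \<in> V \<and> smooth_section M A V s" using U(1) x by blast
  qed
  then show "s \<in> sections M A \<and> (\<forall>x. \<rho> x (s x) = 0)"
    using sK sectionsI unfolding kfibre_def by blast
next
  assume s: "s \<in> sections M A \<and> (\<forall>x. \<rho> x (s x) = 0)"
  have "smooth_section M K UNIV s"
    unfolding smooth_section_def
  proof (intro conjI ballI)
    show "s x \<in> fibre K x" for x unfolding fibre_K kfibre_def using s sections_in by blast
    fix t assume "t \<in> trivs K"
    then obtain V r \<Psi> where tV: "t = (V, r, \<Psi>)" "(V, r, \<Psi>) \<in> trivs K" by (cases t) auto
    then have V: "open (UNIV \<inter> V)" "\<And>x. x \<in> UNIV \<inter> V \<Longrightarrow> linear_iso (\<Psi> x) (Rn r) (kfibre x)"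
      unfolding trivs_K by auto
    have "smooth_coords M (UNIV \<inter> V) r \<Psi> s \<longleftrightarrow>
        (\<forall>i<r. smooth_fun M (UNIV \<inter> V) (\<lambda>x. coords r (\<lambda>j. \<Psi> x (unit_vec j)) (s x) i))"
      by (rule smooth_coords_iff[OF V])
    moreover have "smooth_fun M (UNIV \<inter> V) (\<lambda>x. coords r (\<lambda>j. \<Psi> x (unit_vec j)) (s x) i)" if "i < r" for i
      by (rule kernel_coords_smooth[OF tV(2) open_UNIV sections_smooth[OF _ open_UNIV] _ that]) (use s in auto)
    ultimately have "smooth_coords M (UNIV \<inter> V) r \<Psi> s" by blast
    then show "case t of (V, r, \<Psi>) \<Rightarrow> smooth_coords M (UNIV \<inter> V) r \<Psi> s" unfolding tV(1) by simp
  qed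
  then show "s \<in> sections M K" unfolding sections_def by blast
qed

lemma sections_K_A: "s \<in> sections M K \<Longrightarrow> s \<in> sections M A"
  and sections_K_anchor: "s \<in> sections M K \<Longrightarrow> \<rho> x (s x) = 0"
  using sections_K by blast+

lemma smooth_kernel_coords:
  assumes f: "adapted_frame U \<phi> W S m E" and s: "s \<in> sections M K" and "j < m"
  shows "smooth_fun M W (\<lambda>x. coords m (\<lambda>j. E j x) (s x) j)"
proof -
  note D = adapted_frameD[OF f]
  show ?thesis
    by (rule D(9)[OF D(2) order_refl sections_smooth[OF sections_K_A[OF s] D(2)] sections_K_anchor[OF s] assms(3)])
qed

text \<open>In \<open>anchor_br\<close> one term applies a derivation to the zero function, the
  other applies \<rho>(b) = 0. Here a is any section of A: the kernel is an ideal, so bracketing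
  with a lift \<open>S i\<close> acts on its sections.\<close>

lemma br_in_kernel:
  assumes a: "a \<in> sections M A" and b: "b \<in> sections M K"
  shows "br a b \<in> sections M K"
  unfolding sections_K
proof (intro conjI allI br_in[OF a sections_K_A[OF b]])
  fix x
  have D: "\<rho> x (a x) \<in> tangent_space M x" using anchor_in[OF sections_in[OF a]] .
  show "\<rho> x (br a b x) = 0"
  proof
    fix f
    show "\<rho> x (br a b x) f = 0 f"
    proof (cases "f \<in> C_infinity M")
      case True
      have "\<rho> x (br a b x) f = \<rho> x (a x) (\<lambda>y. \<rho> y (b y) f) - \<rho> x (b x) (\<lambda>y. \<rho> y (a y) f)"
        by (rule anchor_br[OF a sections_K_A[OF b] True])
      then show ?thesis using sections_K_anchor[OF b] tangent_const[OF D, of 0] by simp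
    next
      case False
      then show ?thesis
        using tangentD(3)[OF anchor_in[OF sections_in[OF br_in[OF a sections_K_A[OF b]]]]] by simp
    qed
  qed
qed

lemma sections_K_subspace: "subspace (sections M K)"
  unfolding subspace_def
proof (intro conjI ballI allI)
  show "0 \<in> sections M K"
    unfolding sections_K using subspace_0[OF sections_subspace] anchor_0 by simp
  show "a + b \<in> sections M K" if "a \<in> sections M K" "b \<in> sections M K" for a b
    using that subspace_add[OF sections_subspace] linear_on_set_add[OF anchor_linear sections_in sections_in]
    unfolding sections_K by simp
  show "c *\<^sub>R a \<in> sections M K" if "a \<in> sections M K" for c a
    using that subspace_scale[OF sections_subspace] linear_on_set_scale[OF anchor_linear sections_in]
    unfolding sections_K by simp
qed

lemma kernel_lie_algebra: "lie_algebra (sections M K) br"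
proof -
  have lin: "linear_on_set (sections M K) h" if "linear_on_set (sections M A) h"
    for h :: "('m \<Rightarrow> 'v) \<Rightarrow> ('m \<Rightarrow> 'v)"
    using that sections_K_A unfolding linear_on_set_def by blast
  show ?thesis
    unfolding lie_algebra_def
    by (intro conjI ballI sections_K_subspace br_in_kernel lin br_linear_right br_linear_left br_self br_jacobi
        sections_K_A)
qed

lemma kernel_lie_algebroid: "lie_algebroid M K \<rho> br"
  unfolding lie_algebroid_def
proof (intro conjI ballI)
  show "bundle_morphism M K (tangent_bundle M) \<rho>"
    unfolding bundle_morphism_def
  proof (intro conjI allI ballI)
    show "linear_on_set (fibre K x) (\<rho> x)" for x
      unfolding fibre_K kfibre_def using anchor_linear[of x] unfolding linear_on_set_def by blast
    show "\<rho> x ` fibre K x \<subseteq> fibre (tangent_bundle M) x" for x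
      unfolding fibre_K kfibre_def tangent_bundle_def using anchor_in by (auto simp: subspace_0[OF subspace_tangent_space])
    fix t assume t: "t \<in> trivs K"
    obtain U r \<Phi> where tU: "t = (U, r, \<Phi>)" by (cases t)
    have "case t' of (V, s, \<Psi>) \<Rightarrow> \<forall>j<r. smooth_coords M (U \<inter> V) s \<Psi> (\<lambda>x. \<rho> x (\<Phi> x (unit_vec j)))"
      if t': "t' \<in> trivs (tangent_bundle M)" for t'
    proof -
      obtain V \<phi> where tV: "t' = (V, n, \<lambda>x v. \<Sum>i<n. v i *\<^sub>R coord_vector M V \<phi> i x)" and c: "(V, \<phi>) \<in> charts M"
        using t' unfolding tangent_bundle_def by auto
      have U: "open U" "\<And>j. j < r \<Longrightarrow> smooth_section M A U (\<lambda>x. \<Phi> x (unit_vec j))"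
        using t unfolding tU trivs_K by auto
      have "smooth_fun M (U \<inter> V) (\<lambda>x. inv_into (Rn n) (\<lambda>v. \<Sum>i<n. v i *\<^sub>R coord_vector M V \<phi> i x) (\<rho> x (\<Phi> x (unit_vec j))) i)"
        if "j < r" "i < n" for i j
        using smooth_fun_acoef[OF c U(1) U(2)[OF that(1)] that(2)]
        unfolding acoef_def coords_def lincomb_def .
      then show ?thesis
        unfolding tV smooth_coords_def by simp
    qed
    then show "case t of (U, r, \<Phi>) \<Rightarrow> \<forall>(V, s, \<Psi>)\<in>trivs (tangent_bundle M).
        \<forall>j<r. smooth_coords M (U \<inter> V) s \<Psi> (\<lambda>x. \<rho> x (\<Phi> x (unit_vec j)))"
      unfolding tU by simp
  qed
  fix a b f assume "a \<in> sections M K" "b \<in> sections M K" "f \<in> C_infinity M"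
  then show "br a (\<lambda>x. f x *\<^sub>R b x) = (\<lambda>x. f x *\<^sub>R br a b x + \<rho> x (a x) f *\<^sub>R b x)"
    using leibniz_right sections_K_A by blast
qed (rule kernel_vector_bundle kernel_lie_algebra)+

subsection \<open>The fibrewise bracket\<close>

text \<open>The Leibniz rule needs coefficients that are global smooth functions, so those of the
  local expansion are cut off. The expansion then holds only near y, which is enough because the
  bracket is local.\<close>

lemma kernel_expand:
  assumes f: "adapted_frame U \<phi> W S m E" and s: "s \<in> sections M K" and y: "y \<in> W"
  shows "\<exists>c V. (\<forall>j<m. c j \<in> C_infinity M) \<and> open V \<and> y \<in> V \<and>
    (\<forall>z\<in>V. \<forall>j<m. c j z = coords m (\<lambda>j. E j z) (s z) j) \<and>
    (\<forall>z\<in>V. s z = lincomb m (\<lambda>j. E j z) (\<lambda>j. c j z))"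
proof -
  note D = adapted_frameD[OF f]
  obtain \<eta> V C where \<eta>: "smooth_fun M UNIV \<eta>" "open V" "y \<in> V" "V \<subseteq> W" "\<And>x. x \<in> V \<Longrightarrow> \<eta> x = 1"
    "closed C" "C \<subseteq> W" "\<And>x. x \<notin> C \<Longrightarrow> \<eta> x = 0"
    using bump_exists[OF D(2) y] by metis
  define c where "c j z = \<eta> z * coords m (\<lambda>j. E j z) (s z) j" for j z
  have cs: "c j \<in> C_infinity M" if "j < m" for j
    unfolding c_def
    by (intro C_infinityI smooth_fun_extend[OF \<eta>(1,6,7,8) D(2)] smooth_kernel_coords[OF f s that])
  have cV: "c j z = coords m (\<lambda>j. E j z) (s z) j" if "z \<in> V" for z j
    unfolding c_def using \<eta>(5)[OF that] by simp
  have rep: "s z = lincomb m (\<lambda>j. E j z) (\<lambda>j. c j z)" if z: "z \<in> V" for z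
  proof -
    have "s z \<in> kfibre z"
      using sections_in[OF sections_K_A[OF s]] sections_K_anchor[OF s] unfolding kfibre_def by blast
    then have "lincomb m (\<lambda>j. E j z) (coords m (\<lambda>j. E j z) (s z)) = s z"
      using lincomb_coords[OF D(8)] \<eta>(4) z by blast
    moreover have "(\<lambda>j. c j z) = coords m (\<lambda>j. E j z) (s z)" using cV[OF z] by blast
    ultimately show ?thesis by simp
  qed
  show ?thesis
    by (rule exI[of _ c], rule exI[of _ V], intro conjI allI impI ballI cs \<eta>(2,3) cV rep)
qed

lemma frame_sections_K: "adapted_frame U \<phi> W S m E \<Longrightarrow> j < m \<Longrightarrow> E j \<in> sections M K"
  unfolding sections_K using adapted_frameD(6,7) by blast

text \<open>Since \<rho>(a) = 0, the derivative terms of the Leibniz rule vanish, and the bracket at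
  y depends on s only through its value at y.\<close>

lemma br_expand_right:
  assumes f: "adapted_frame U \<phi> W S m E" and a: "a \<in> sections M K" and s: "s \<in> sections M K" and y: "y \<in> W"
  shows "br a s y = lincomb m (\<lambda>j. br a (E j) y) (coords m (\<lambda>j. E j y) (s y))"
proof -
  note D = adapted_frameD[OF f]
  from kernel_expand[OF f s y] obtain c V where c: "\<And>j. j < m \<Longrightarrow> c j \<in> C_infinity M" "open V" "y \<in> V"
    "\<forall>z\<in>V. \<forall>j<m. c j z = coords m (\<lambda>j. E j z) (s z) j" "\<forall>z\<in>V. s z = lincomb m (\<lambda>j. E j z) (\<lambda>j. c j z)"
    by blast
  note aA = sections_K_A[OF a] and sA = sections_K_A[OF s]
  have "br a s y = br a (\<lambda>z. lincomb m (\<lambda>j. E j z) (\<lambda>j. c j z)) y"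
    by (rule br_cong_right[OF aA sA section_lincomb[OF c(1) D(6)] c(2,3)]) (use c(5) in auto)
  also have "\<dots> = lincomb m (\<lambda>j. br a (E j) y) (\<lambda>j. c j y) + lincomb m (\<lambda>j. E j y) (\<lambda>j. \<rho> y (a y) (c j))"
    by (rule leibniz_lincomb[OF aA c(1) D(6)])
  also have "lincomb m (\<lambda>j. E j y) (\<lambda>j. \<rho> y (a y) (c j)) = 0"
    using sections_K_anchor[OF a] by (simp add: lincomb_def)
  also have "lincomb m (\<lambda>j. br a (E j) y) (\<lambda>j. c j y) = lincomb m (\<lambda>j. br a (E j) y) (coords m (\<lambda>j. E j y) (s y))"
    by (rule lincomb_cong) (use c(3,4) in auto)
  finally show ?thesis by simp
qed

lemma br_expand_left:
  assumes f: "adapted_frame U \<phi> W S m E" and a: "a \<in> sections M K" and s: "s \<in> sections M K" and y: "y \<in> W"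
  shows "br s a y = lincomb m (\<lambda>j. br (E j) a y) (coords m (\<lambda>j. E j y) (s y))"
proof -
  have "br s a y = - br a s y" by (rule br_anti[OF sections_K_A[OF s] sections_K_A[OF a]])
  also have "\<dots> = - lincomb m (\<lambda>j. br a (E j) y) (coords m (\<lambda>j. E j y) (s y))"
    using br_expand_right[OF f a s y] by simp
  also have "\<dots> = lincomb m (\<lambda>j. br (E j) a y) (coords m (\<lambda>j. E j y) (s y))"
    unfolding lincomb_def sum_negf[symmetric]
    using br_anti[OF sections_K_A[OF a] adapted_frameD(6)[OF f]] by (intro sum.cong) auto
  finally show ?thesis .
qed

text \<open>The definite description is justified by changing one argument at a time: by the two
  expansions, each argument enters only through its coordinates at x.\<close>

lemma fibre_bracket_eq:
  assumes "a \<in> sections M K" "b \<in> sections M K"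
  shows "fibre_bracket M K br x (a x) (b x) = br a b x"
  unfolding fibre_bracket_def
proof (rule the_equality)
  show "\<exists>a'\<in>sections M K. \<exists>b'\<in>sections M K. a' x = a x \<and> b' x = b x \<and> br a b x = br a' b' x"
    using assms by blast
  fix w assume "\<exists>a'\<in>sections M K. \<exists>b'\<in>sections M K. a' x = a x \<and> b' x = b x \<and> w = br a' b' x"
  then obtain a' b' where ab: "a' \<in> sections M K" "b' \<in> sections M K" "a' x = a x" "b' x = b x" "w = br a' b' x"
    by blast
  obtain U \<phi> W S m E where x: "x \<in> W" and f: "adapted_frame U \<phi> W S m E" using adapted_frame_exists .
  have "br a' b' x = br a b' x"
    using br_expand_left[OF f ab(2,1) x] br_expand_left[OF f ab(2) assms(1) x] ab(3) by simp
  also have "\<dots> = br a b x"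
    using br_expand_right[OF f assms(1) ab(2) x] br_expand_right[OF f assms x] ab(4) by simp
  finally show "w = br a b x" using ab(5) by simp
qed

lemma frame_lincomb_section: "adapted_frame U \<phi> W S m E \<Longrightarrow> (\<lambda>x. lincomb m (\<lambda>j. E j x) v) \<in> sections M K"
  unfolding sections_K
proof (intro conjI allI)
  assume f: "adapted_frame U \<phi> W S m E"
  show "(\<lambda>x. lincomb m (\<lambda>j. E j x) v) \<in> sections M A"
    by (rule section_lincomb[OF C_infinity_const adapted_frameD(6)[OF f]])
  show "\<rho> x (lincomb m (\<lambda>j. E j x) v) = 0" for x
    using linear_on_set_lincomb_comp[OF fibre_subspace anchor_linear sections_in[OF adapted_frameD(6)[OF f]], of m "\<lambda>j. j" x v]
      adapted_frameD(7)[OF f]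
    by (simp add: lincomb_def)
qed

lemma section_through:
  assumes "u \<in> kfibre x"
  shows "\<exists>s\<in>sections M K. s x = u"
proof -
  obtain U \<phi> W S m E where x: "x \<in> W" and f: "adapted_frame U \<phi> W S m E" using adapted_frame_exists .
  show ?thesis
    using frame_lincomb_section[OF f, of "coords m (\<lambda>j. E j x) u"] lincomb_coords[OF adapted_frameD(8)[OF f x] assms]
    by (intro bexI) auto
qed

text \<open>A section is chosen through every vector and the identities for sections are evaluated
  at x. The choice need not be linear: \<open>fibre_bracket_eq\<close> accepts any sections with the
  right values, for instance \<open>s v + s w\<close> through v + w.\<close>

lemma fibre_lie_algebra: "lie_algebra (kfibre x) (fibre_bracket M K br x)"
proof -
  have "\<exists>s. \<forall>u\<in>kfibre x. s u \<in> sections M K \<and> s u x = u"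
    using section_through by (intro bchoice) blast
  then obtain s where s: "\<And>u. u \<in> kfibre x \<Longrightarrow> s u \<in> sections M K" "\<And>u. u \<in> kfibre x \<Longrightarrow> s u x = u" by blast
  let ?b = "fibre_bracket M K br x"
  have b: "?b u v = br (s u) (s v) x" if "u \<in> kfibre x" "v \<in> kfibre x" for u v
    using fibre_bracket_eq[OF s(1)[OF that(1)] s(1)[OF that(2)], of x] s(2) that by simp
  have kf: "t x \<in> kfibre x" if "t \<in> sections M K" for t
    using that sections_in unfolding kfibre_def sections_K by blast
  have in_k: "?b u v \<in> kfibre x" if "u \<in> kfibre x" "v \<in> kfibre x" for u v
    unfolding b[OF that] using kf[OF br_in_kernel] s(1) that sections_K_A by blast
  note L = kernel_lie_algebra[unfolded lie_algebra_def]
  have addr: "?b u (v + w) = ?b u v + ?b u w" and addl: "?b (v + w) u = ?b v u + ?b w u"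
    if "u \<in> kfibre x" "v \<in> kfibre x" "w \<in> kfibre x" for u v w
  proof -
    have vw: "s v + s w \<in> sections M K" "(s v + s w) x = v + w"
      using subspace_add[OF sections_K_subspace] s that by simp_all
    show "?b u (v + w) = ?b u v + ?b u w"
      using fibre_bracket_eq[OF s(1)[OF that(1)] vw(1), of x] b that s
        linear_on_set_add[OF br_linear_right[OF sections_K_A[OF s(1)[OF that(1)]]] sections_K_A sections_K_A]
      by (simp add: vw(2)[simplified])
    show "?b (v + w) u = ?b v u + ?b w u"
      using fibre_bracket_eq[OF vw(1) s(1)[OF that(1)], of x] b that s
        linear_on_set_add[OF br_linear_left[OF sections_K_A[OF s(1)[OF that(1)]]] sections_K_A sections_K_A]
      by (simp add: vw(2)[simplified])
  qed
  have scr: "?b u (k *\<^sub>R v) = k *\<^sub>R ?b u v" and scl: "?b (k *\<^sub>R v) u = k *\<^sub>R ?b v u"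
    if "u \<in> kfibre x" "v \<in> kfibre x" for u v k
  proof -
    have kv: "k *\<^sub>R s v \<in> sections M K" "(k *\<^sub>R s v) x = k *\<^sub>R v"
      using subspace_scale[OF sections_K_subspace] s that by simp_all
    show "?b u (k *\<^sub>R v) = k *\<^sub>R ?b u v"
      using fibre_bracket_eq[OF s(1)[OF that(1)] kv(1), of x] b that s
        linear_on_set_scale[OF br_linear_right[OF sections_K_A[OF s(1)[OF that(1)]]] sections_K_A]
      by simp
    show "?b (k *\<^sub>R v) u = k *\<^sub>R ?b v u"
      using fibre_bracket_eq[OF kv(1) s(1)[OF that(1)], of x] b that s
        linear_on_set_scale[OF br_linear_left[OF sections_K_A[OF s(1)[OF that(1)]]] sections_K_A]
      by simp
  qed
  have self: "?b u u = 0" if "u \<in> kfibre x" for u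
    using b[OF that that] br_self[OF sections_K_A[OF s(1)[OF that]]] by simp
  have bb: "?b u (?b v w) = br (s u) (br (s v) (s w)) x" if "u \<in> kfibre x" "v \<in> kfibre x" "w \<in> kfibre x" for u v w
    using fibre_bracket_eq[OF s(1)[OF that(1)] br_in_kernel[OF sections_K_A[OF s(1)[OF that(2)]] s(1)[OF that(3)]], of x]
      b that s(2) by simp
  have jac: "?b u (?b v w) + ?b v (?b w u) + ?b w (?b u v) = 0"
    if "u \<in> kfibre x" "v \<in> kfibre x" "w \<in> kfibre x" for u v w
  proof -
    have "(br (s u) (br (s v) (s w)) + br (s v) (br (s w) (s u)) + br (s w) (br (s u) (s v))) x = 0"
      using br_jacobi[of "s u" "s v" "s w"] s(1) sections_K_A that by simp
    then show ?thesis using bb that by simp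
  qed
  show ?thesis
    unfolding lie_algebra_def linear_on_set_def
    by (intro conjI ballI allI kfibre_subspace in_k addr addl scr scl self jac)
qed

subsection \<open>Structure constants and their derivatives\<close>

definition struct_const :: "nat \<Rightarrow> (nat \<Rightarrow> 'm \<Rightarrow> 'v) \<Rightarrow> 'm \<Rightarrow> nat \<Rightarrow> nat \<Rightarrow> nat \<Rightarrow> real" where
  "struct_const m E y i j k = coords m (\<lambda>j. E j y) (br (E i) (E j) y) k"

text \<open>The Christoffel symbols of the partial connection: on the domain of the frame,
  [S_a, E_i] is the sum over l of \<open>conn_coef m S E y a i l\<close> times E_l.\<close>

definition conn_coef :: "nat \<Rightarrow> (nat \<Rightarrow> 'm \<Rightarrow> 'v) \<Rightarrow> (nat \<Rightarrow> 'm \<Rightarrow> 'v) \<Rightarrow> 'm \<Rightarrow> nat \<Rightarrow> nat \<Rightarrow> nat \<Rightarrow> real" where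
  "conn_coef m S E y a i l = coords m (\<lambda>j. E j y) (br (S a) (E i) y) l"

lemma section_K_in: "s \<in> sections M K \<Longrightarrow> s x \<in> kfibre x"
  using sections_in unfolding kfibre_def sections_K by blast

text \<open>In the frame, the isotropy algebra at y becomes R^m with \<open>struct_bracket\<close>.
  Vectors with constant coefficients u and v extend to global sections of K, so the two bracket
  expansions apply.\<close>

lemma fibre_bracket_lincomb:
  assumes f: "adapted_frame U \<phi> W S m E" and y: "y \<in> W" and uv: "u \<in> Rn m" "v \<in> Rn m"
  shows "fibre_bracket M K br y (lincomb m (\<lambda>j. E j y) u) (lincomb m (\<lambda>j. E j y) v)
    = lincomb m (\<lambda>j. E j y) (struct_bracket m (struct_const m E y) u v)"
proof -
  note D = adapted_frameD[OF f]
  note b = D(8)[OF y]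
  let ?e = "\<lambda>w x. lincomb m (\<lambda>j. E j x) w"
  note u = frame_lincomb_section[OF f, of u] and v = frame_lincomb_section[OF f, of v]
  note EK = frame_sections_K[OF f]
  have "fibre_bracket M K br y (?e u y) (?e v y) = br (?e u) (?e v) y"
    by (rule fibre_bracket_eq[OF u v])
  also have "\<dots> = lincomb m (\<lambda>i. br (E i) (?e v) y) u"
    using br_expand_left[OF f v u y] coords_lincomb[OF b uv(1)] by simp
  also have "\<dots> = (\<Sum>i<m. u i *\<^sub>R (\<Sum>j<m. v j *\<^sub>R (\<Sum>k<m. struct_const m E y i j k *\<^sub>R E k y)))"
    unfolding lincomb_def[of m _ u]
  proof (intro sum.cong refl)
    fix i assume "i \<in> {..<m}"
    then have i: "i < m" by simp
    have "br (E i) (?e v) y = lincomb m (\<lambda>j. br (E i) (E j) y) v"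
      using br_expand_right[OF f EK[OF i] v y] coords_lincomb[OF b uv(2)] by simp
    also have "\<dots> = (\<Sum>j<m. v j *\<^sub>R (\<Sum>k<m. struct_const m E y i j k *\<^sub>R E k y))"
      unfolding lincomb_def
    proof (intro sum.cong refl arg_cong[of _ _ "\<lambda>x. _ *\<^sub>R x"])
      fix j assume "j \<in> {..<m}"
      then have "br (E i) (E j) \<in> sections M K" using br_in_kernel[OF sections_K_A[OF EK[OF i]]] EK by simp
      from lincomb_coords[OF b section_K_in[OF this]]
      show "br (E i) (E j) y = (\<Sum>k<m. struct_const m E y i j k *\<^sub>R E k y)"
        unfolding struct_const_def lincomb_def by simp
    qed
    finally show "u i *\<^sub>R br (E i) (?e v) y = u i *\<^sub>R (\<Sum>j<m. v j *\<^sub>R (\<Sum>k<m. struct_const m E y i j k *\<^sub>R E k y))"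
      by simp
  qed
  also have "\<dots> = (\<Sum>i<m. \<Sum>j<m. \<Sum>k<m. (u i * v j * struct_const m E y i j k) *\<^sub>R E k y)"
    by (simp add: scaleR_sum_right mult.assoc)
  also have "\<dots> = (\<Sum>i<m. \<Sum>k<m. \<Sum>j<m. (u i * v j * struct_const m E y i j k) *\<^sub>R E k y)"
    by (intro sum.cong refl sum.swap)
  also have "\<dots> = (\<Sum>k<m. \<Sum>i<m. \<Sum>j<m. (u i * v j * struct_const m E y i j k) *\<^sub>R E k y)"
    by (rule sum.swap)
  also have "\<dots> = ?e (struct_bracket m (struct_const m E y) u v) y"
    unfolding lincomb_def struct_bracket_def by (simp add: scaleR_sum_left)
  finally show ?thesis .
qed

text \<open>The Jacobi identity of \<open>S\<^sub>a, E\<^sub>i, E\<^sub>j\<close>, where the derivative comes from the Leibniz rule applied to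
  \<open>[S\<^sub>a, \<Sum>\<^sub>k c\<^sub>i\<^sub>j\<^sup>k E\<^sub>k]\<close>.\<close>

lemma struct_const_derivative:
  assumes f: "adapted_frame U \<phi> W S m E" and y: "y \<in> W" and a: "a < n" and ij: "i < m" "j < m" and k: "k < m"
  shows "pd U \<phi> a (\<lambda>z. struct_const m E z i j k) y =
    (\<Sum>l<m. conn_coef m S E y a i l * struct_const m E y l j k)
    + (\<Sum>l<m. conn_coef m S E y a j l * struct_const m E y i l k)
    - (\<Sum>l<m. struct_const m E y i j l * conn_coef m S E y a l k)"
proof -
  note D = adapted_frameD[OF f]
  note b = D(8)[OF y]
  note EK = frame_sections_K[OF f]
  note SA = D(4)[OF a]
  let ?c = "coords m (\<lambda>j. E j y)"
  have Eij: "br (E i) (E j) \<in> sections M K" by (rule br_in_kernel[OF D(6)[OF ij(1)] EK[OF ij(2)]])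
  have SE: "br (S a) (E i) \<in> sections M K" if "i < m" for i by (rule br_in_kernel[OF SA EK[OF that]])
  have clin: "?c (lincomb m g v) k = (\<Sum>l<m. v l * ?c (g l) k)" if "\<And>l. l < m \<Longrightarrow> g l \<in> kfibre y" for g v
    using linear_on_set_lincomb_comp[OF kfibre_subspace linear_on_set_coords[OF b] that, of m "\<lambda>l. l" v]
    by (simp add: lincomb_def sum_fun_apply)
  from kernel_expand[OF f Eij y] obtain c V where c: "\<And>j. j < m \<Longrightarrow> c j \<in> C_infinity M" "open V" "y \<in> V"
    "\<forall>z\<in>V. \<forall>l<m. c l z = coords m (\<lambda>j. E j z) (br (E i) (E j) z) l"
    "\<forall>z\<in>V. br (E i) (E j) z = lincomb m (\<lambda>j. E j z) (\<lambda>j. c j z)"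
    by blast
  have yU: "y \<in> U" using y D(3) by blast
  have "br (S a) (br (E i) (E j)) y = br (S a) (\<lambda>z. lincomb m (\<lambda>j. E j z) (\<lambda>j. c j z)) y"
    by (rule br_cong_right[OF SA sections_K_A[OF Eij] section_lincomb[OF c(1) D(6)] c(2,3)]) (use c(5) in auto)
  also have "\<dots> = lincomb m (\<lambda>l. br (S a) (E l) y) (\<lambda>l. c l y) + lincomb m (\<lambda>l. E l y) (\<lambda>l. \<rho> y (S a y) (c l))"
    by (rule leibniz_lincomb[OF SA c(1) D(6)])
  finally have 1: "br (S a) (br (E i) (E j)) y
      = lincomb m (\<lambda>l. br (S a) (E l) y) (\<lambda>l. c l y) + lincomb m (\<lambda>l. E l y) (\<lambda>l. \<rho> y (S a y) (c l))" .
  have cy: "c l y = struct_const m E y i j l" if "l < m" for l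
    using c(3,4) that unfolding struct_const_def by blast
  \<comment> \<open>\<open>S a\<close> lifts the a-th coordinate field, so the Leibniz term is a
    partial derivative. The global function \<open>c k\<close> agrees with the structure constants
    only near y, which suffices for \<open>pd_cong\<close>.\<close>
  have "\<rho> y (S a y) (c k) = pd U \<phi> a (c k) y"
    using D(5)[OF a y] c(1)[OF k] by (simp add: coord_vector_apply)
  also have "\<dots> = pd U \<phi> a (\<lambda>z. struct_const m E z i j k) y"
    by (rule pd_cong[OF D(1) c(2) _ c(3) yU a]) (use c(4) k in \<open>auto simp: struct_const_def\<close>)
  finally have pd: "\<rho> y (S a y) (c k) = pd U \<phi> a (\<lambda>z. struct_const m E z i j k) y" .
  have lhs: "?c (br (S a) (br (E i) (E j)) y) k
      = (\<Sum>l<m. struct_const m E y i j l * conn_coef m S E y a l k) + pd U \<phi> a (\<lambda>z. struct_const m E z i j k) y"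
  proof -
    have in1: "lincomb m (\<lambda>l. br (S a) (E l) y) (\<lambda>l. c l y) \<in> kfibre y"
      by (rule lincomb_in[OF kfibre_subspace section_K_in[OF SE]])
    have in2: "lincomb m (\<lambda>l. E l y) (\<lambda>l. \<rho> y (S a y) (c l)) \<in> kfibre y"
      by (rule is_basis_lincomb_in[OF b])
    have "?c (br (S a) (br (E i) (E j)) y) k
        = ?c (lincomb m (\<lambda>l. br (S a) (E l) y) (\<lambda>l. c l y)) k + ?c (lincomb m (\<lambda>l. E l y) (\<lambda>l. \<rho> y (S a y) (c l))) k"
      unfolding 1 linear_on_set_add[OF linear_on_set_coords[OF b] in1 in2] by simp
    also have "?c (lincomb m (\<lambda>l. br (S a) (E l) y) (\<lambda>l. c l y)) k = (\<Sum>l<m. c l y * ?c (br (S a) (E l) y) k)"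
      by (rule clin[OF section_K_in[OF SE]])
    also have "\<dots> = (\<Sum>l<m. struct_const m E y i j l * conn_coef m S E y a l k)"
      using cy by (intro sum.cong) (auto simp: conn_coef_def)
    also have "?c (lincomb m (\<lambda>l. E l y) (\<lambda>l. \<rho> y (S a y) (c l))) k = \<rho> y (S a y) (c k)"
      by (rule coords_lincomb_nth[OF b k])
    finally show ?thesis unfolding pd .
  qed
  \<comment> \<open>The Jacobi identity as the derivation property of [S_a, .]; comparing
    coefficients with the Leibniz expansion isolates the derivative.\<close>
  have "br (S a) (br (E i) (E j)) y = br (br (S a) (E i)) (E j) y + br (E i) (br (S a) (E j)) y"
    by (rule br_jacobi_left[OF SA D(6)[OF ij(1)] D(6)[OF ij(2)]])
  also have "br (br (S a) (E i)) (E j) y = lincomb m (\<lambda>l. br (E l) (E j) y) (?c (br (S a) (E i) y))"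
    by (rule br_expand_left[OF f EK[OF ij(2)] SE[OF ij(1)] y])
  also have "br (E i) (br (S a) (E j)) y = lincomb m (\<lambda>l. br (E i) (E l) y) (?c (br (S a) (E j) y))"
    by (rule br_expand_right[OF f EK[OF ij(1)] SE[OF ij(2)] y])
  finally have 2: "br (S a) (br (E i) (E j)) y = lincomb m (\<lambda>l. br (E l) (E j) y) (?c (br (S a) (E i) y))
      + lincomb m (\<lambda>l. br (E i) (E l) y) (?c (br (S a) (E j) y))" .
  have EE: "br (E l) (E l') y \<in> kfibre y" if "l < m" "l' < m" for l l'
    by (rule section_K_in[OF br_in_kernel[OF D(6)[OF that(1)] EK[OF that(2)]]])
  have "?c (br (S a) (br (E i) (E j)) y) k
      = ?c (lincomb m (\<lambda>l. br (E l) (E j) y) (?c (br (S a) (E i) y))) k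
      + ?c (lincomb m (\<lambda>l. br (E i) (E l) y) (?c (br (S a) (E j) y))) k"
    unfolding 2
    by (subst linear_on_set_add[OF linear_on_set_coords[OF b] lincomb_in[OF kfibre_subspace] lincomb_in[OF kfibre_subspace]])
      (use EE ij in auto)
  also have "?c (lincomb m (\<lambda>l. br (E l) (E j) y) (?c (br (S a) (E i) y))) k
      = (\<Sum>l<m. conn_coef m S E y a i l * struct_const m E y l j k)"
    using clin[OF EE[OF _ ij(2)]] by (simp add: conn_coef_def struct_const_def)
  also have "?c (lincomb m (\<lambda>l. br (E i) (E l) y) (?c (br (S a) (E j) y))) k
      = (\<Sum>l<m. conn_coef m S E y a j l * struct_const m E y i l k)"
    using clin[OF EE[OF ij(1)]] by (simp add: conn_coef_def struct_const_def)
  finally show ?thesis using lhs by simp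
qed

subsection \<open>Local triviality and conclusion\<close>

text \<open>In one adapted frame all fibres near x0 are R^m with varying structure constants, so an
  isomorphism is a linear map of R^m that carries those at x0 to those at y.\<close>

lemma isotropy_locally_constant:
  "\<exists>V. open V \<and> x0 \<in> V \<and> (\<forall>y\<in>V. lie_algebra_isomorphic (kfibre x0) (fibre_bracket M K br x0)
    (kfibre y) (fibre_bracket M K br y))"
proof -
  obtain U \<phi> W S m E where x0: "x0 \<in> W" and f: "adapted_frame U \<phi> W S m E" using adapted_frame_exists .
  note D = adapted_frameD[OF f]
  note EK = frame_sections_K[OF f]
  have x0U: "x0 \<in> U" using x0 D(3) by blast
  have SE: "br (S a) (E i) \<in> sections M K" if "a < n" "i < m" for a i
    by (rule br_in_kernel[OF D(4)[OF that(1)] EK[OF that(2)]])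
  have EE: "br (E i) (E j) \<in> sections M K" if "i < m" "j < m" for i j
    by (rule br_in_kernel[OF D(6)[OF that(1)] EK[OF that(2)]])
  have conn_cont: "continuous_on W (\<lambda>y. conn_coef m S E y a i l)" if "a < n" "i < m" "l < m" for a i l
    unfolding conn_coef_def
    by (rule smooth_fun_continuous[OF D(2) smooth_kernel_coords[OF f SE[OF that(1,2)] that(3)]])
  have sc_smooth: "smooth_fun M W (\<lambda>y. struct_const m E y i j k)" if "i < m" "j < m" "k < m" for i j k
    unfolding struct_const_def
    by (rule smooth_kernel_coords[OF f EE[OF that(1,2)] that(3)])
  \<comment> \<open>One continuous function dominating all connection coefficients.\<close>
  define g where "g y = (\<Sum>a<n. \<Sum>i<m. \<Sum>l<m. \<bar>conn_coef m S E y a i l\<bar>)" for y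
  \<comment> \<open>The summand 1 makes c positive and leaves room for a neighbourhood of x0 on
    which g < c.\<close>
  define c where "c = g x0 + 1"
  have g0: "g y \<ge> 0" for y unfolding g_def by (intro sum_nonneg) auto
  have c1: "c \<ge> 1" unfolding c_def using g0[of x0] by simp
  have gb: "\<bar>conn_coef m S E y a i l\<bar> \<le> g y" if "a < n" "i < m" "l < m" for y a i l
  proof -
    have "\<bar>conn_coef m S E y a i l\<bar> \<le> (\<Sum>l<m. \<bar>conn_coef m S E y a i l\<bar>)"
      using that by (intro member_le_sum[of l "{..<m}" "\<lambda>l. \<bar>conn_coef m S E y a i l\<bar>"]) auto
    also have "\<dots> \<le> (\<Sum>i<m. \<Sum>l<m. \<bar>conn_coef m S E y a i l\<bar>)"
      using that by (intro member_le_sum[of i "{..<m}" "\<lambda>i. \<Sum>l<m. \<bar>conn_coef m S E y a i l\<bar>"] sum_nonneg) auto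
    also have "\<dots> \<le> g y"
      unfolding g_def using that
      by (intro member_le_sum[of a "{..<n}" "\<lambda>a. \<Sum>i<m. \<Sum>l<m. \<bar>conn_coef m S E y a i l\<bar>"] sum_nonneg) auto
    finally show ?thesis .
  qed
  have g_cont: "continuous_on W g"
    unfolding g_def by (intro continuous_on_sum continuous_on_rabs conn_cont) auto
  define W1 where "W1 = W \<inter> g -` {..<c}"
  have W1: "open W1" "x0 \<in> W1" "W1 \<subseteq> W"
    using continuous_open_preimage[OF g_cont D(2)] x0 unfolding W1_def c_def by auto
  have "\<phi> x0 \<in> \<phi> ` (U \<inter> W1)" using x0U W1(2) by blast
  then obtain \<delta> where \<delta>: "\<delta> > 0" "rbox n (\<phi> x0) \<delta> \<subseteq> \<phi> ` (U \<inter> W1)"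
    using openin_Rn_rbox[OF openin_chart_image[OF D(1) W1(1)]] by metis
  \<comment> \<open>Chosen so that m * n * \<epsilon> * c is at most 1/2, as the transport lemma
    requires; the terms + 1 keep the denominator positive when m or n is 0.\<close>
  define \<epsilon> where "\<epsilon> = min \<delta> (1 / (2 * (real m + 1) * (real n + 1) * c))"
  have \<epsilon>: "\<epsilon> > 0" "\<epsilon> \<le> \<delta>" unfolding \<epsilon>_def using \<delta>(1) c1 by auto
  have small: "real m * (real n * (\<epsilon> * c)) \<le> 1 / 2"
  proof -
    have "\<epsilon> * (2 * (real m + 1) * (real n + 1) * c) \<le> 1"
    proof -
      have "\<epsilon> \<le> 1 / (2 * (real m + 1) * (real n + 1) * c)" unfolding \<epsilon>_def by simp
      moreover have "2 * (real m + 1) * (real n + 1) * c > 0" using c1 by simp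
      ultimately show ?thesis by (simp add: pos_le_divide_eq)
    qed
    moreover have "real m * (real n * (\<epsilon> * c)) \<le> (real m + 1) * ((real n + 1) * (\<epsilon> * c))"
      using \<epsilon>(1) c1 by (intro mult_mono) auto
    moreover have "(real m + 1) * ((real n + 1) * (\<epsilon> * c)) = \<epsilon> * (2 * (real m + 1) * (real n + 1) * c) / 2"
      by simp
    ultimately show ?thesis by linarith
  qed
  define V where "V = {y \<in> U. \<phi> y \<in> rbox n (\<phi> x0) \<epsilon>}"
  note \<phi>x0 = chart_Rn[OF D(1) x0U]
  have "open V" unfolding V_def by (rule open_chart_preimage[OF D(1) openin_rbox])
  moreover have "x0 \<in> V" unfolding V_def using x0U centre_in_rbox[OF \<phi>x0 \<epsilon>(1)] by blast
  moreover have "lie_algebra_isomorphic (kfibre x0) (fibre_bracket M K br x0) (kfibre y) (fibre_bracket M K br y)"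
    if y: "y \<in> V" for y
  proof -
    have yU: "y \<in> U" and yb: "\<phi> y \<in> rbox n (\<phi> x0) \<epsilon>" using y unfolding V_def by auto
    define v where "v a = \<phi> y a - \<phi> x0 a" for a
    define \<gamma> where "\<gamma> t = (\<lambda>a. \<phi> x0 a + t * v a)" for t
    define p where "p t = inv_into U \<phi> (\<gamma> t)" for t
    have \<gamma>_box: "\<gamma> t \<in> rbox n (\<phi> x0) \<epsilon>" if "t \<in> {0..1}" for t
      unfolding \<gamma>_def v_def using rbox_starlike[OF \<phi>x0 yb] that by auto
    have \<gamma>_Rn: "\<gamma> t \<in> Rn n" for t
      using \<phi>x0 chart_Rn[OF D(1) yU] unfolding \<gamma>_def v_def Rn_iff by auto
    have p: "p t \<in> U" "p t \<in> W1" "\<phi> (p t) = \<gamma> t" if "t \<in> {0..1}" for t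
    proof -
      have "\<gamma> t \<in> \<phi> ` (U \<inter> W1)" using \<gamma>_box[OF that] rbox_mono[OF \<epsilon>(2)] \<delta>(2) by blast
      then obtain z where z: "z \<in> U" "z \<in> W1" "\<gamma> t = \<phi> z" by blast
      then have "p t = z" unfolding p_def using chart_inverse[OF D(1)] by simp
      then show "p t \<in> U" "p t \<in> W1" "\<phi> (p t) = \<gamma> t" using z by auto
    qed
    have pW: "p t \<in> W" if "t \<in> {0..1}" for t using p(2)[OF that] W1(3) by blast
    have p0: "p 0 = x0" unfolding p_def \<gamma>_def using chart_inverse[OF D(1) x0U] by simp
    have p1: "p 1 = y" unfolding p_def \<gamma>_def v_def using chart_inverse[OF D(1) yU] by simp
    have p_cont: "continuous_on {0..1} p"
      unfolding p_def
    proof (rule continuous_on_compose2[of "\<phi> ` U" "inv_into U \<phi>"])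
      show "continuous_on (\<phi> ` U) (inv_into U \<phi>)" using chart_homeo[OF D(1)] unfolding homeomorphism_def by blast
      show "continuous_on {0..1} \<gamma>"
        unfolding \<gamma>_def by (intro continuous_on_coordinatewise_then_product continuous_intros)
      show "\<gamma> ` {0..1} \<subseteq> \<phi> ` U" using p(1,3) by (metis image_eqI image_subsetI)
    qed
    \<comment> \<open>The connection coefficients contracted with the constant velocity v of the
      segment. Its components are below \<epsilon>, which makes B small.\<close>
    define B where "B i l t = (\<Sum>a<n. v a * conn_coef m S E (p t) a i l)" for i l t
    have B_cont: "continuous_on {0..1} (B i l)" if "i < m" "l < m" for i l
    proof -
      have "continuous_on {0..1} (\<lambda>t. conn_coef m S E (p t) a i l)" if "a < n" for a
        by (rule continuous_on_compose2[OF conn_cont[OF that \<open>i < m\<close> \<open>l < m\<close>] p_cont]) (use pW in blast)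
      then show ?thesis unfolding B_def by (intro continuous_on_sum continuous_on_mult continuous_on_const) auto
    qed
    have B_bound: "\<bar>B i l t\<bar> \<le> real n * (\<epsilon> * c)" if "i < m" "l < m" "t \<in> {0..1}" for i l t
    proof -
      have "\<bar>B i l t\<bar> \<le> (\<Sum>a<n. \<bar>v a * conn_coef m S E (p t) a i l\<bar>)" unfolding B_def by (rule sum_abs)
      also have "\<dots> \<le> (\<Sum>a<n. \<epsilon> * c)"
        unfolding abs_mult
      proof (intro sum_mono mult_mono)
        fix a assume a: "a \<in> {..<n}"
        show "\<bar>v a\<bar> \<le> \<epsilon>" using yb a unfolding v_def rbox_def by (auto intro: less_imp_le)
        have "g (p t) < c" using p(2)[OF that(3)] unfolding W1_def by blast
        then show "\<bar>conn_coef m S E (p t) a i l\<bar> \<le> c" using gb[of a i l "p t"] a that by auto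
      qed (use \<epsilon> in auto)
      finally show ?thesis by simp
    qed
    \<comment> \<open>The chain rule along the segment, with \<open>struct_const_derivative\<close>
      in each coordinate direction; weighting by v turns the connection coefficients into B.\<close>
    have sc_deriv: "((\<lambda>t. struct_const m E (p t) i j k) has_real_derivative
        (\<Sum>l<m. B i l t * struct_const m E (p t) l j k) + (\<Sum>l<m. B j l t * struct_const m E (p t) i l k)
        - (\<Sum>l<m. struct_const m E (p t) i j l * B l k t)) (at t within {0..1})"
      if ijk: "i < m" "j < m" "k < m" and t: "t \<in> {0..1}" for i j k t
    proof -
      let ?f = "(\<lambda>z. struct_const m E z i j k) \<circ> inv_into U \<phi>"
      note O = openin_chart_image[OF D(1,2)]
      have "\<gamma> t \<in> \<phi> ` (U \<inter> W)" using p(1,3)[OF t] pW[OF t] by (metis IntI image_eqI)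
      moreover have "((\<lambda>t. \<gamma> t a) has_real_derivative v a) (at t)" for a
        unfolding \<gamma>_def by (auto intro!: derivative_eq_intros)
      ultimately have "((\<lambda>t. ?f (\<gamma> t)) has_real_derivative (\<Sum>a<n. partial a ?f (\<gamma> t) * v a)) (at t)"
        using \<gamma>_Rn by (intro has_real_derivative_along_curve[OF O smooth_funD[OF sc_smooth[OF ijk] D(1), of "Suc 0"]]) auto
      moreover have "(\<lambda>t. ?f (\<gamma> t)) = (\<lambda>t. struct_const m E (p t) i j k)" unfolding p_def by simp
      moreover have "(\<Sum>a<n. partial a ?f (\<gamma> t) * v a)
          = (\<Sum>l<m. B i l t * struct_const m E (p t) l j k) + (\<Sum>l<m. B j l t * struct_const m E (p t) i l k)
            - (\<Sum>l<m. struct_const m E (p t) i j l * B l k t)"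
      proof -
        let ?s = "struct_const m E (p t)" and ?G = "conn_coef m S E (p t)"
        have "(\<Sum>a<n. partial a ?f (\<gamma> t) * v a) = (\<Sum>a<n. v a * ((\<Sum>l<m. ?G a i l * ?s l j k)
            + (\<Sum>l<m. ?G a j l * ?s i l k) - (\<Sum>l<m. ?s i j l * ?G a l k)))"
        proof (rule sum.cong[OF refl])
          fix a assume "a \<in> {..<n}"
          then have "partial a ?f (\<gamma> t) = (\<Sum>l<m. ?G a i l * ?s l j k)
            + (\<Sum>l<m. ?G a j l * ?s i l k) - (\<Sum>l<m. ?s i j l * ?G a l k)"
            using struct_const_derivative[OF f pW[OF t] _ ijk, of a] p(3)[OF t] unfolding pd_def by simp
          then show "partial a ?f (\<gamma> t) * v a = v a * ((\<Sum>l<m. ?G a i l * ?s l j k)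
            + (\<Sum>l<m. ?G a j l * ?s i l k) - (\<Sum>l<m. ?s i j l * ?G a l k))"
            by (simp add: mult.commute)
        qed
        also have "\<dots> = (\<Sum>a<n. \<Sum>l<m. v a * ?G a i l * ?s l j k) + (\<Sum>a<n. \<Sum>l<m. v a * ?G a j l * ?s i l k)
            - (\<Sum>a<n. \<Sum>l<m. ?s i j l * (v a * ?G a l k))"
          by (simp add: distrib_left right_diff_distrib sum.distrib sum_subtractf sum_distrib_left mult_ac)
        also have "(\<Sum>a<n. \<Sum>l<m. v a * ?G a i l * ?s l j k) = (\<Sum>l<m. B i l t * ?s l j k)"
          unfolding B_def sum_distrib_right by (rule sum.swap)
        also have "(\<Sum>a<n. \<Sum>l<m. v a * ?G a j l * ?s i l k) = (\<Sum>l<m. B j l t * ?s i l k)"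
          unfolding B_def sum_distrib_right by (rule sum.swap)
        also have "(\<Sum>a<n. \<Sum>l<m. ?s i j l * (v a * ?G a l k)) = (\<Sum>l<m. ?s i j l * B l k t)"
          unfolding B_def sum_distrib_left by (rule sum.swap)
        finally show ?thesis .
      qed
      ultimately show ?thesis by (simp add: has_field_derivative_at_within)
    qed
    have "\<exists>T. linear_iso T (Rn m) (Rn m) \<and> (\<forall>u\<in>Rn m. \<forall>v\<in>Rn m.
        T (struct_bracket m (struct_const m E (p 0)) u v) = struct_bracket m (struct_const m E (p 1)) (T u) (T v))"
      by (rule struct_bracket_transport[where c="\<lambda>t. struct_const m E (p t)", OF B_cont B_bound small sc_deriv])
    then obtain T where T: "linear_iso T (Rn m) (Rn m)" "\<And>u v. u \<in> Rn m \<Longrightarrow> v \<in> Rn m \<Longrightarrow>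
        T (struct_bracket m (struct_const m E x0) u v) = struct_bracket m (struct_const m E y) (T u) (T v)"
      unfolding p0 p1 by blast
    have yW: "y \<in> W" using pW[of 1] p1 by simp
    let ?cf = "coords m (\<lambda>j. E j x0)" and ?l = "lincomb m (\<lambda>j. E j y)"
    note bx = D(8)[OF x0] and by' = D(8)[OF yW]
    \<comment> \<open>The isomorphism is assembled from coordinates at x0, transport T in R^m, and
      the frame at y.\<close>
    have "linear_iso ?cf (kfibre x0) (Rn m)"
      using linear_iso_inv[OF subspace_Rn bx[unfolded is_basis_def]] unfolding coords_def .
    from linear_iso_comp[OF linear_iso_comp[OF this T(1)] by'[unfolded is_basis_def]]
    have iso: "linear_iso (\<lambda>u. ?l (T (?cf u))) (kfibre x0) (kfibre y)" .
    have TR: "T u \<in> Rn m" if "u \<in> Rn m" for u using T(1) that unfolding linear_iso_def bij_betw_def by blast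
    have "?l (T (?cf (fibre_bracket M K br x0 u v))) = fibre_bracket M K br y (?l (T (?cf u))) (?l (T (?cf v)))"
      if uv: "u \<in> kfibre x0" "v \<in> kfibre x0" for u v
    proof -
      have R: "?cf u \<in> Rn m" "?cf v \<in> Rn m" using coords_Rn[OF bx] uv by auto
      have "fibre_bracket M K br x0 u v
          = lincomb m (\<lambda>j. E j x0) (struct_bracket m (struct_const m E x0) (?cf u) (?cf v))"
        using fibre_bracket_lincomb[OF f x0 R] lincomb_coords[OF bx] uv by simp
      moreover have "struct_bracket m (struct_const m E x0) (?cf u) (?cf v) \<in> Rn m"
        unfolding struct_bracket_def Rn_iff by simp
      ultimately have "?cf (fibre_bracket M K br x0 u v) = struct_bracket m (struct_const m E x0) (?cf u) (?cf v)"
        using coords_lincomb[OF bx] by simp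
      then show ?thesis using T(2)[OF R] fibre_bracket_lincomb[OF f yW TR[OF R(1)] TR[OF R(2)]] by simp
    qed
    then show ?thesis
      unfolding lie_algebra_isomorphic_def using fibre_lie_algebra iso by blast
  qed
  ultimately show ?thesis by blast
qed

lemma kernel_lie_algebra_bundle:
  assumes "connected (UNIV :: 'm set)"
  shows "lie_algebra_bundle M K \<rho> br"
  unfolding lie_algebra_bundle_def fibre_K
proof (intro conjI allI ballI kernel_lie_algebroid)
  show "\<rho> x v = 0" if "v \<in> kfibre x" for x v using that unfolding kfibre_def by blast
  fix x y
  show "lie_algebra_isomorphic (kfibre x) (fibre_bracket M K br x) (kfibre y) (fibre_bracket M K br y)"
  proof (rule connected_equivalence_relation[OF assms UNIV_I UNIV_I])
    fix a :: 'm
    show "\<exists>T. openin (top_of_set UNIV) T \<and> a \<in> T \<and> (\<forall>z\<in>T. lie_algebra_isomorphic (kfibre a)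
        (fibre_bracket M K br a) (kfibre z) (fibre_bracket M K br z))"
      using isotropy_locally_constant[of a] by simp
  qed (rule lie_algebra_isomorphic_sym lie_algebra_isomorphic_trans; assumption)+
qed

end

theorem theorem4p3:
  fixes M :: "'m::{t2_space, second_countable_topology} manifold"
    and A :: "('m, 'v::real_vector) vbundle"
    and \<rho> :: "'m \<Rightarrow> 'v \<Rightarrow> ('m \<Rightarrow> real) \<Rightarrow> real"
    and br :: "('m \<Rightarrow> 'v) \<Rightarrow> ('m \<Rightarrow> 'v) \<Rightarrow> 'm \<Rightarrow> 'v"
  assumes "smooth_manifold M"
    and "transitive_lie_algebroid M A \<rho> br"
    and "connected (UNIV :: 'm set)"
  shows "lie_algebra_bundle M (anchor_kernel M A \<rho>) \<rho> br"
proof -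
  interpret transitive_la M A \<rho> br
    using assms(1,2)
    by unfold_locales (auto simp: transitive_lie_algebroid_def lie_algebroid_def)
  show ?thesis
    using assms(3) by (rule kernel_lie_algebra_bundle)
qed

end
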